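(* Let $\kappa\ge 0$, let $\mu$ be a measure on $(0,\infty)$ with $\mu(0,\infty)=\infty$ and $\int_0^\infty(1\wedge x)\,\mu(dx)<\infty$, and set $w(x)=\mu(x,\infty)$ for $x>0$. Let $S=\{S_t;t\ge0\}$ be the subordinator with drift $\kappa$ and Lévy measure $\mu$, and let $E_t=\inf\{s>0:S_s>t\}$, $t\ge0$, be the inverse subordinator. Suppose that $(\mathcal L,\mathcal D(\mathcal L))$ is the infinitesimal generator of a uniformly bounded strongly continuous semigroup $\{T_t;t\ge0\}$ in a Banach space $(\mathbb B,\|\cdot\|)$. For every $f\in\mathcal D(\mathcal L)$, $u(t,\cdot):=\mathbb E[T_{E_t}f]$ is a solution in $(\mathbb B,\|\cdot\|)$ to $$\left(\kappa\,\partial_t+\partial_t^w\right)u(t,\cdot)=\mathcal L u(t,\cdot)\quad\text{with }u(0,\cdot)=f\qquad(\ast)$$ in the following sense: (i) $\sup_{t>0}\|u(t,\cdot)\|<\infty$; $u(t,\cdot)\in\mathcal D(\mathcal L)$ for each $t\ge0$ with $\sup_{t\ge0}\|\mathcal L u(t,\cdot)\|<\infty$; and both $t\mapsto u(t,\cdot)$ and $t\mapsto\mathcal L u(t,\cdot)$ are continuous in $(\mathbb B,\|\cdot\|)$; (ii) for every $t>0$, $I_t^w(u):=\int_0^t w(t-s)\,(u(s,\cdot)-f)\,ds$ is absolutely convergent in $(\mathbb B,\|\cdot\|)$ and $$\lim_{\delta\to0}\frac1\delta\Big(\kappa\,(u(t+\delta,\cdot)-u(t,\cdot))+I_{t+\delta}^w(u)-I_t^w(u)\Big)=\mathcal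 L u(t,\cdot)\quad\text{in }(\mathbb B,\|\cdot\|).$$ When $\kappa>0$, $t\mapsto u(t,\cdot)$ is globally Lipschitz continuous in $(\mathbb B,\|\cdot\|)$, and $\partial_tu(t,\cdot)$ exists in $(\mathbb B,\|\cdot\|)$ for a.e. $t\ge0$. Conversely, if $u$ is a solution to $(\ast)$ in the sense of (i) and (ii) above (with $u(0,\cdot)=f$) and $f\in\mathcal D(\mathcal L)$, then $u(t,\cdot)=\mathbb E[T_{E_t}f]$ in $\mathbb B$ for every $t\ge0$.
   Context: A subordinator is a non-negative valued Lévy process $\{S_t;t\ge0\}$ with $S_0=0$. The subordinator with drift $\kappa$ and Lévy measure $\mu$ is characterized by $\mathbb E[e^{-\lambda S_t}]=e^{-t\phi(\lambda)}$, $\lambda>0$, with $\phi(\lambda)=\kappa\lambda+\int_0^\infty(1-e^{-\lambda x})\,\mu(dx)$. "Uniformly bounded" means $\sup_{t>0}\|T_t\|<\infty$ (operator norm on $\mathbb B$). The expectation $\mathbb E[T_{E_t}f]=\int_{[0,\infty)}T_sf\;\mathbb P(E_t\in ds)$ is a Bochner integral in $\mathbb B$. The generalized Caputo derivative is $\partial_t^w g(t)=\frac{d}{dt}\int_0^t w(t-s)(g(s)-g(0))\,ds$, whenever it is well defined; the precise meaning of equation $(\ast)$ is given by (i) and (ii). *)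

theory Defs
  imports "HOL-Probability.Probability"
begin

subsection \<open>The Bochner integral in an arbitrary Banach space\<close>

(* The library's has_bochner_integral requires a second countable codomain, i.e. a separable
   Banach space. This is the library's definition with that sort constraint removed; approximability by
   simple functions forces f to be almost everywhere separably valued. *)

definition has_banach_integral ::
  "'a measure \<Rightarrow> ('a \<Rightarrow> 'b::banach) \<Rightarrow> 'b \<Rightarrow> bool" where
  "has_banach_integral M f x \<longleftrightarrow>
     f \<in> borel_measurable M \<and>
     (\<exists>s. (\<forall>i. Bochner_Integration.simple_bochner_integrable M (s i)) \<and>
          (\<lambda>i. \<integral>\<^sup>+z. ennreal (norm (f z - s i z)) \<partial>M) \<longlonglongrightarrow> 0 \<and>
          (\<lambda>i. Bochner_Integration.simple_bochner_integral M (s i)) \<longlonglongrightarrow> x)"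

definition banach_integrable :: "'a measure \<Rightarrow> ('a \<Rightarrow> 'b::banach) \<Rightarrow> bool" where
  "banach_integrable M f \<longleftrightarrow> (\<exists>x. has_banach_integral M f x)"

definition banach_integral :: "'a measure \<Rightarrow> ('a \<Rightarrow> 'b::banach) \<Rightarrow> 'b" where
  "banach_integral M f =
     (if banach_integrable M f then (THE x. has_banach_integral M f x) else 0)"


subsection \<open>Subordinators and their inverses\<close>

(* Only the times t \<ge> 0 of a process S :: real \<Rightarrow> 'w \<Rightarrow> real or a path are meaningful. *)

definition cadlag :: "(real \<Rightarrow> real) \<Rightarrow> bool" where
  "cadlag x \<longleftrightarrow>
     (\<forall>t\<ge>0. (x \<longlongrightarrow> x t) (at_right t)) \<and> (\<forall>t>0. \<exists>l. (x \<longlongrightarrow> l) (at_left t))"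

(* Stochastic continuity follows from right continuity at 0 and stationarity. *)
definition levy_process :: "'w measure \<Rightarrow> (real \<Rightarrow> 'w \<Rightarrow> real) \<Rightarrow> bool" where
  "levy_process M S \<longleftrightarrow>
     prob_space M \<and>
     (\<forall>t\<ge>0. S t \<in> borel_measurable M) \<and>
     (AE \<omega> in M. S 0 \<omega> = 0) \<and>
     (\<forall>(t :: nat \<Rightarrow> real) n. t 0 \<ge> 0 \<and> strict_mono t \<longrightarrow>
        prob_space.indep_vars M (\<lambda>_. borel) (\<lambda>i \<omega>. S (t (Suc i)) \<omega> - S (t i) \<omega>) {..<n}) \<and>
     (\<forall>s\<ge>0. \<forall>t\<ge>0. distr M borel (\<lambda>\<omega>. S (s + t) \<omega> - S s \<omega>) = distr M borel (S t)) \<and>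
     (AE \<omega> in M. cadlag (\<lambda>t. S t \<omega>))"

definition laplace_exponent :: "real \<Rightarrow> real measure \<Rightarrow> real \<Rightarrow> real" where
  "laplace_exponent \<kappa> \<mu> l = \<kappa> * l + (\<integral>x. (1 - exp (- l * x)) \<partial>\<mu>)"

definition subordinator ::
  "'w measure \<Rightarrow> real \<Rightarrow> real measure \<Rightarrow> (real \<Rightarrow> 'w \<Rightarrow> real) \<Rightarrow> bool" where
  "subordinator M \<kappa> \<mu> S \<longleftrightarrow>
     levy_process M S \<and>
     (AE \<omega> in M. \<forall>t\<ge>0. S t \<omega> \<ge> 0) \<and>
     (\<forall>t\<ge>0. \<forall>l>0. (\<integral>\<omega>. exp (- l * S t \<omega>) \<partial>M) = exp (- t * laplace_exponent \<kappa> \<mu> l))"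

(* The set is empty only if the path stays below t, which for infinite Levy measure happens
   with probability 0; so a real-valued Inf suffices. *)
definition inverse_subordinator :: "(real \<Rightarrow> 'w \<Rightarrow> real) \<Rightarrow> real \<Rightarrow> 'w \<Rightarrow> real" where
  "inverse_subordinator S t \<omega> = Inf {s. s > 0 \<and> S s \<omega> > t}"

(* The law of E_t on [0,\<infinity>). The paths are only almost surely cadlag, so E_t is
   in general measurable only with respect to the completion of M. *)
definition inverse_law :: "'w measure \<Rightarrow> (real \<Rightarrow> 'w \<Rightarrow> real) \<Rightarrow> real \<Rightarrow> real measure" where
  "inverse_law M S t =
     restrict_space (distr (completion M) borel (inverse_subordinator S t)) {0..}"

definition levy_tail :: "real measure \<Rightarrow> real \<Rightarrow> real" where
  "levy_tail \<mu> x = measure \<mu> {x<..}"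


subsection \<open>Semigroups and generators\<close>

definition strongly_continuous_semigroup :: "(real \<Rightarrow> 'b::banach \<Rightarrow>\<^sub>L 'b) \<Rightarrow> bool" where
  "strongly_continuous_semigroup T \<longleftrightarrow>
     T 0 = id_blinfun \<and>
     (\<forall>s\<ge>0. \<forall>t\<ge>0. T (s + t) = T s o\<^sub>L T t) \<and>
     (\<forall>f. ((\<lambda>t. T t f) \<longlongrightarrow> f) (at_right 0))"

definition uniformly_bounded :: "(real \<Rightarrow> 'b::banach \<Rightarrow>\<^sub>L 'b) \<Rightarrow> bool" where
  "uniformly_bounded T \<longleftrightarrow> bdd_above ((\<lambda>t. norm (T t)) ` {0<..})"

(* The operator is given by its domain D and a function L whose values outside D are irrelevant. *)
definition infinitesimal_generator ::
  "(real \<Rightarrow> 'b::banach \<Rightarrow>\<^sub>L 'b) \<Rightarrow> 'b set \<Rightarrow> ('b \<Rightarrow> 'b) \<Rightarrow> bool" where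
  "infinitesimal_generator T D L \<longleftrightarrow>
     D = {f. \<exists>g. ((\<lambda>h. (T h f - f) /\<^sub>R h) \<longlongrightarrow> g) (at_right 0)} \<and>
     (\<forall>f\<in>D. ((\<lambda>h. (T h f - f) /\<^sub>R h) \<longlongrightarrow> L f) (at_right 0))"


subsection \<open>The time-fractional equation\<close>

definition subordinate_expectation ::
  "'w measure \<Rightarrow> (real \<Rightarrow> 'w \<Rightarrow> real) \<Rightarrow> (real \<Rightarrow> 'b::banach \<Rightarrow>\<^sub>L 'b) \<Rightarrow> 'b \<Rightarrow> real \<Rightarrow> 'b" where
  "subordinate_expectation M S T f t = banach_integral (inverse_law M S t) (\<lambda>s. T s f)"

definition memory_integral :: "(real \<Rightarrow> real) \<Rightarrow> 'b::banach \<Rightarrow> (real \<Rightarrow> 'b) \<Rightarrow> real \<Rightarrow> 'b" where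
  "memory_integral w f u t =
     banach_integral (restrict_space lborel {0<..<t}) (\<lambda>s. w (t - s) *\<^sub>R (u s - f))"

(* Bochner integrability is absolute convergence of the integral. *)
definition time_fractional_solution ::
  "real \<Rightarrow> (real \<Rightarrow> real) \<Rightarrow> 'b::banach set \<Rightarrow> ('b \<Rightarrow> 'b) \<Rightarrow> 'b \<Rightarrow> (real \<Rightarrow> 'b) \<Rightarrow> bool" where
  "time_fractional_solution \<kappa> w D L f u \<longleftrightarrow>
     u 0 = f \<and>
     bdd_above ((\<lambda>t. norm (u t)) ` {0<..}) \<and>
     (\<forall>t\<ge>0. u t \<in> D) \<and>
     bdd_above ((\<lambda>t. norm (L (u t))) ` {0..}) \<and>
     continuous_on {0..} u \<and>
     continuous_on {0..} (\<lambda>t. L (u t)) \<and>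
     (\<forall>t>0.
        banach_integrable (restrict_space lborel {0<..<t}) (\<lambda>s. w (t - s) *\<^sub>R (u s - f)) \<and>
        ((\<lambda>\<delta>. (\<kappa> *\<^sub>R (u (t + \<delta>) - u t)
                + memory_integral w f u (t + \<delta>) - memory_integral w f u t) /\<^sub>R \<delta>)
           \<longlongrightarrow> L (u t)) (at 0))"

end

theory Submission
  imports Defs
begin

text \<open>Write \<open>F r t\<close> for the probability that \<open>S r \<le> t\<close>. Since \<open>E t > r\<close> and \<open>S r \<le> t\<close> are the same
  event up to the level set \<open>S r = t\<close>, integration by parts turns the expectation of \<open>T (E t) f\<close> into
  \<open>u t = f + \<integral> F r t \<cdot> T r (L f) dr\<close>, an integral in which all the time dependence sits in a scalar function.

  Everything about \<open>F\<close> comes from one identity. With \<open>w\<close> the tail of the Levy measure and \<open>*\<close> convolution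
  in time, put \<open>flux r t = \<kappa> \<cdot> F r t + (w * F r) t\<close>. Then
  \<open>\<integral>\<^sub>a\<^sup>\<infinity> flux r t dr = \<integral>\<^sub>0\<^sup>t F a s ds\<close> for all \<open>a \<ge> 0\<close> (lemma \<open>tail_identity\<close>), because both sides
  have Laplace transform \<open>exp (- a \<cdot> \<Phi> l) / l\<^sup>2\<close> in \<open>t\<close>. In terms of measures in \<open>r\<close> it says that \<open>flux r t dr\<close> is
  the integral over \<open>0 < s < t\<close> of the laws of \<open>E s\<close>. Integrating \<open>T r (L f)\<close> against these two equal measures
  gives \<open>\<kappa> \<cdot> (u t - f) + (w * (u - f)) t = \<integral>\<^sub>0\<^sup>t L (u s) ds\<close>, which is the equation in integrated form; the
  integrand on the right is continuous, so it may be differentiated.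

  The case \<open>a = 0\<close> is the renewal equation \<open>\<kappa> \<cdot> U + w * U = t\<close> for the potential \<open>U t = \<integral> F r t dr\<close>. As \<open>w\<close> is
  unbounded near \<open>0\<close>, it forces a uniform modulus of continuity on \<open>U\<close> (\<open>potential_modulus\<close>), hence continuity
  of \<open>u\<close>; and for \<open>\<kappa> > 0\<close> it makes \<open>U\<close>, hence \<open>u\<close>, Lipschitz (\<open>potential_lipschitz\<close>).

  A Lipschitz function with values in a general Banach space may be nowhere differentiable, so differentiability has
  to come from the equation. Let \<open>W t\<close> be the asymptotic oscillation at \<open>t\<close> of the difference quotients of \<open>u\<close>. The
  right-hand side of the integrated equation is differentiable, so \<open>\<kappa> \<cdot> W \<le> w * W\<close>, and such a bounded
  function vanishes (\<open>volterra_osc_vanishes\<close>). Thus \<open>u\<close> is differentiable at every \<open>t > 0\<close>.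

  For uniqueness let \<open>d\<close> be the difference of two solutions and \<open>V\<close> its Laplace transform at \<open>l\<close>. The integrated
  equation gives \<open>\<Phi> l \<cdot> V = (transform of L d)\<close>. Applying the truncated resolvent
  \<open>\<integral>\<^sub>0\<^sup>N exp (- q r) T r dr\<close> with \<open>q = \<Phi> l > 0\<close> yields \<open>V = exp (- q N) T N V\<close> for every \<open>N\<close>, so \<open>V = 0\<close>,
  and Laplace transforms of continuous functions are injective by the Weierstrass approximation theorem
  (\<open>laplace_unique\<close>).

  The Banach space may be non-separable, where sums of Borel functions need not be Borel. The integral calculus is
  therefore built on \<open>strong_integral\<close>, which asks for approximation by simple functions but not for
  measurability of the integrand, and the only Fubini theorem is \<open>strong_integral_mixture\<close>: if a measure
  on the line is a mixture of measures, then the integral of a bounded continuous function against it is the integral of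
  its integrals against the components.\<close>

section \<open>The Bochner integral without separability\<close>

abbreviation sb_integrable :: "'a measure \<Rightarrow> ('a \<Rightarrow> 'b::real_vector) \<Rightarrow> bool" where
  "sb_integrable \<equiv> Bochner_Integration.simple_bochner_integrable"

abbreviation sb_integral :: "'a measure \<Rightarrow> ('a \<Rightarrow> 'b::real_vector) \<Rightarrow> 'b" where
  "sb_integral \<equiv> Bochner_Integration.simple_bochner_integral"

text \<open>The error of the approximation is dominated by measurable functions \<open>e i\<close> instead of being measurable itself. So the
  class of integrable functions is closed under sums even when the sum of two Borel functions is not Borel.\<close>

definition strong_integral :: "'a measure \<Rightarrow> ('a \<Rightarrow> 'b::real_normed_vector) \<Rightarrow> 'b \<Rightarrow> bool" where
  "strong_integral M f x \<longleftrightarrow>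
     (\<exists>s e. (\<forall>i. sb_integrable M (s i)) \<and> (\<forall>i. e i \<in> borel_measurable M) \<and>
        (\<forall>i. \<forall>z\<in>space M. ennreal (norm (f z - s i z)) \<le> e i z) \<and>
        (\<lambda>i. \<integral>\<^sup>+z. e i z \<partial>M) \<longlonglongrightarrow> 0 \<and>
        (\<lambda>i. sb_integral M (s i)) \<longlonglongrightarrow> x)"

lemma sb_integral_dist:
  assumes s: "sb_integrable M s" and t: "sb_integrable M t"
  shows "ennreal (norm (sb_integral M s - sb_integral M t)) \<le> (\<integral>\<^sup>+z. ennreal (norm (s z - t z)) \<partial>M)"
proof -
  have d: "sb_integrable M (\<lambda>z. s z - t z)"
    by (rule simple_bochner_integrable_compose2[OF _ s t]) simp
  have "norm (sb_integral M s - sb_integral M t) = norm (sb_integral M (\<lambda>z. s z - t z))"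
    by (simp add: simple_bochner_integral_diff[OF s t])
  also have "\<dots> \<le> sb_integral M (\<lambda>z. norm (s z - t z))"
    by (rule simple_bochner_integral_norm_bound[OF d])
  finally have "ennreal (norm (sb_integral M s - sb_integral M t)) \<le> sb_integral M (\<lambda>z. norm (s z - t z))"
    by (rule ennreal_leI)
  also have "\<dots> = (\<integral>\<^sup>+z. ennreal (norm (s z - t z)) \<partial>M)"
    by (rule simple_bochner_integral_eq_nn_integral)
       (use simple_bochner_integrable_compose2[of "\<lambda>x y. norm (x - y)" M s t] s t in auto)
  finally show ?thesis .
qed

text \<open>The basic estimate of the theory: uniqueness of the integral and all norm bounds are instances.\<close>

lemma strong_integral_dist:
  assumes f: "strong_integral M f x" and g: "strong_integral M g y"
    and b: "b \<in> borel_measurable M" "\<And>z. z \<in> space M \<Longrightarrow> ennreal (norm (f z - g z)) \<le> b z"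
  shows "ennreal (norm (x - y)) \<le> (\<integral>\<^sup>+z. b z \<partial>M)"
proof -
  obtain s c where s: "\<And>i::nat. sb_integrable M (s i)" "\<And>i. c i \<in> borel_measurable M"
      "\<And>i z. z \<in> space M \<Longrightarrow> ennreal (norm (f z - s i z)) \<le> c i z"
      "(\<lambda>i. \<integral>\<^sup>+z. c i z \<partial>M) \<longlonglongrightarrow> 0" "(\<lambda>i. sb_integral M (s i)) \<longlonglongrightarrow> x"
    using f unfolding strong_integral_def by blast
  obtain t d where t: "\<And>i::nat. sb_integrable M (t i)" "\<And>i. d i \<in> borel_measurable M"
      "\<And>i z. z \<in> space M \<Longrightarrow> ennreal (norm (g z - t i z)) \<le> d i z"
      "(\<lambda>i. \<integral>\<^sup>+z. d i z \<partial>M) \<longlonglongrightarrow> 0" "(\<lambda>i. sb_integral M (t i)) \<longlonglongrightarrow> y"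
    using g unfolding strong_integral_def by blast
  have le: "ennreal (norm (sb_integral M (s i) - sb_integral M (t i)))
      \<le> (\<integral>\<^sup>+z. c i z \<partial>M) + ((\<integral>\<^sup>+z. b z \<partial>M) + (\<integral>\<^sup>+z. d i z \<partial>M))" for i
  proof -
    have "ennreal (norm (sb_integral M (s i) - sb_integral M (t i)))
        \<le> (\<integral>\<^sup>+z. ennreal (norm (s i z - t i z)) \<partial>M)"
      by (rule sb_integral_dist[OF s(1) t(1)])
    also have "\<dots> \<le> (\<integral>\<^sup>+z. c i z + (b z + d i z) \<partial>M)"
    proof (rule nn_integral_mono)
      fix z assume z: "z \<in> space M"
      have "norm (s i z - t i z) \<le> norm (f z - s i z) + (norm (f z - g z) + norm (g z - t i z))"
        using norm_triangle_ineq[of "s i z - f z" "f z - t i z"] norm_triangle_ineq[of "f z - g z" "g z - t i z"]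
        by (simp add: norm_minus_commute)
      then have "ennreal (norm (s i z - t i z))
          \<le> ennreal (norm (f z - s i z)) + (ennreal (norm (f z - g z)) + ennreal (norm (g z - t i z)))"
        by (simp add: ennreal_leI flip: ennreal_plus)
      also have "\<dots> \<le> c i z + (b z + d i z)"
        by (intro add_mono s(3) b(2) t(3) z)
      finally show "ennreal (norm (s i z - t i z)) \<le> c i z + (b z + d i z)" .
    qed
    also have "\<dots> = (\<integral>\<^sup>+z. c i z \<partial>M) + ((\<integral>\<^sup>+z. b z \<partial>M) + (\<integral>\<^sup>+z. d i z \<partial>M))"
      using s(2) t(2) b(1) by (simp add: nn_integral_add)
    finally show ?thesis .
  qed
  have "(\<lambda>i. ennreal (norm (sb_integral M (s i) - sb_integral M (t i)))) \<longlonglongrightarrow> ennreal (norm (x - y))"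
    by (intro tendsto_ennrealI tendsto_norm tendsto_diff s(5) t(5))
  moreover have "(\<lambda>i. (\<integral>\<^sup>+z. c i z \<partial>M) + ((\<integral>\<^sup>+z. b z \<partial>M) + (\<integral>\<^sup>+z. d i z \<partial>M)))
      \<longlonglongrightarrow> 0 + ((\<integral>\<^sup>+z. b z \<partial>M) + 0)"
    by (intro tendsto_add s(4) t(4) tendsto_const)
  ultimately have "ennreal (norm (x - y)) \<le> 0 + ((\<integral>\<^sup>+z. b z \<partial>M) + 0)"
    using le LIMSEQ_le by blast
  then show ?thesis by simp
qed

lemma strong_integral_unique:
  assumes "strong_integral M f x" "strong_integral M f y"
  shows "x = y"
  using strong_integral_dist[OF assms, of "\<lambda>_. 0"] by simp

lemma strong_integral_cong:
  assumes "\<And>z. z \<in> space M \<Longrightarrow> f z = g z" "x = y"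
  shows "strong_integral M f x \<longleftrightarrow> strong_integral M g y"
  unfolding strong_integral_def using assms by simp

lemma strong_integral_simple:
  "sb_integrable M s \<Longrightarrow> strong_integral M s (sb_integral M s)"
  unfolding strong_integral_def by (intro exI[of _ "\<lambda>_. s"] exI[of _ "\<lambda>_ _. 0"]) simp

lemma strong_integral_zero: "strong_integral M (\<lambda>_. 0) 0"
proof -
  have "sb_integrable M (\<lambda>_. 0)" by (rule simple_bochner_integrable.intros) auto
  from strong_integral_simple[OF this] show ?thesis
    by (simp add: simple_bochner_integral_def sum.neutral)
qed

lemma strong_integral_norm_le:
  assumes "strong_integral M f x" "b \<in> borel_measurable M"
    "\<And>z. z \<in> space M \<Longrightarrow> ennreal (norm (f z)) \<le> b z"
  shows "ennreal (norm x) \<le> (\<integral>\<^sup>+z. b z \<partial>M)"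
  using strong_integral_dist[OF assms(1) strong_integral_zero assms(2)] assms(3) by simp

lemma strong_integral_add:
  assumes f: "strong_integral M f x" and g: "strong_integral M g y"
  shows "strong_integral M (\<lambda>z. f z + g z) (x + y)"
proof -
  obtain s c where s: "\<And>i::nat. sb_integrable M (s i)" "\<And>i. c i \<in> borel_measurable M"
      "\<And>i z. z \<in> space M \<Longrightarrow> ennreal (norm (f z - s i z)) \<le> c i z"
      "(\<lambda>i. \<integral>\<^sup>+z. c i z \<partial>M) \<longlonglongrightarrow> 0" "(\<lambda>i. sb_integral M (s i)) \<longlonglongrightarrow> x"
    using f unfolding strong_integral_def by blast
  obtain t d where t: "\<And>i::nat. sb_integrable M (t i)" "\<And>i. d i \<in> borel_measurable M"
      "\<And>i z. z \<in> space M \<Longrightarrow> ennreal (norm (g z - t i z)) \<le> d i z"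
      "(\<lambda>i. \<integral>\<^sup>+z. d i z \<partial>M) \<longlonglongrightarrow> 0" "(\<lambda>i. sb_integral M (t i)) \<longlonglongrightarrow> y"
    using g unfolding strong_integral_def by blast
  show ?thesis
    unfolding strong_integral_def
  proof (intro exI[of _ "\<lambda>i z. s i z + t i z"] exI[of _ "\<lambda>i z. c i z + d i z"] conjI allI ballI)
    fix i
    show "sb_integrable M (\<lambda>z. s i z + t i z)"
      by (rule simple_bochner_integrable_compose2[OF _ s(1) t(1)]) simp
    show "(\<lambda>z. c i z + d i z) \<in> borel_measurable M" using s(2) t(2) by simp
    fix z assume z: "z \<in> space M"
    have "ennreal (norm (f z + g z - (s i z + t i z))) \<le> ennreal (norm (f z - s i z)) + ennreal (norm (g z - t i z))"
      by (auto simp: norm_diff_triangle_ineq intro: ennreal_leI simp flip: ennreal_plus)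
    also have "\<dots> \<le> c i z + d i z" by (intro add_mono s(3) t(3) z)
    finally show "ennreal (norm (f z + g z - (s i z + t i z))) \<le> c i z + d i z" .
  next
    show "(\<lambda>i. \<integral>\<^sup>+z. c i z + d i z \<partial>M) \<longlonglongrightarrow> 0"
      using tendsto_add[OF s(4) t(4)] s(2) t(2) by (simp add: nn_integral_add)
    show "(\<lambda>i. sb_integral M (\<lambda>z. s i z + t i z)) \<longlonglongrightarrow> x + y"
      using tendsto_add[OF s(5) t(5)] by (simp add: simple_bochner_integral_add s(1) t(1))
  qed
qed

lemma strong_integral_sum:
  assumes "finite I" "\<And>i. i \<in> I \<Longrightarrow> strong_integral M (f i) (x i)"
  shows "strong_integral M (\<lambda>z. \<Sum>i\<in>I. f i z) (\<Sum>i\<in>I. x i)"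
  using assms by (induction I) (auto intro: strong_integral_add strong_integral_zero)

lemma strong_integral_bounded_linear:
  assumes T: "bounded_linear T" and f: "strong_integral M f x"
  shows "strong_integral M (\<lambda>z. T (f z)) (T x)"
proof -
  interpret T: bounded_linear T by fact
  obtain K where K: "K > 0" "\<And>x. norm (T x) \<le> norm x * K" using T.pos_bounded by blast
  obtain s c where s: "\<And>i::nat. sb_integrable M (s i)" "\<And>i. c i \<in> borel_measurable M"
      "\<And>i z. z \<in> space M \<Longrightarrow> ennreal (norm (f z - s i z)) \<le> c i z"
      "(\<lambda>i. \<integral>\<^sup>+z. c i z \<partial>M) \<longlonglongrightarrow> 0" "(\<lambda>i. sb_integral M (s i)) \<longlonglongrightarrow> x"
    using f unfolding strong_integral_def by blast
  show ?thesis
    unfolding strong_integral_def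
  proof (intro exI[of _ "\<lambda>i z. T (s i z)"] exI[of _ "\<lambda>i z. ennreal K * c i z"] conjI allI ballI)
    fix i
    show "sb_integrable M (\<lambda>z. T (s i z))"
      by (rule simple_bochner_integrable_compose2[where p="\<lambda>x y. T x", OF _ s(1) s(1)]) (simp add: T.zero)
    show "(\<lambda>z. ennreal K * c i z) \<in> borel_measurable M" using s(2) by simp
    fix z assume z: "z \<in> space M"
    have "ennreal (norm (T (f z) - T (s i z))) \<le> ennreal (K * norm (f z - s i z))"
      using K(2)[of "f z - s i z"] by (intro ennreal_leI) (simp add: T.diff mult.commute)
    also have "\<dots> = ennreal K * ennreal (norm (f z - s i z))" using K(1) by (simp add: ennreal_mult)
    also have "\<dots> \<le> ennreal K * c i z" by (intro mult_left_mono s(3) z) auto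
    finally show "ennreal (norm (T (f z) - T (s i z))) \<le> ennreal K * c i z" .
  next
    show "(\<lambda>i. \<integral>\<^sup>+z. ennreal K * c i z \<partial>M) \<longlonglongrightarrow> 0"
      using ennreal_tendsto_cmult[OF _ s(4), of "ennreal K"] s(2) by (simp add: nn_integral_cmult)
    show "(\<lambda>i. sb_integral M (\<lambda>z. T (s i z))) \<longlonglongrightarrow> T x"
      using T.tendsto[OF s(5)] by (simp add: simple_bochner_integral_linear[OF T.linear_axioms s(1)])
  qed
qed

lemma strong_integral_diff:
  assumes f: "strong_integral M f x" and g: "strong_integral M g y"
  shows "strong_integral M (\<lambda>z. f z - g z) (x - y)"
  using strong_integral_add[OF f strong_integral_bounded_linear[OF _ g, of uminus]]
  by (simp add: bounded_linear_minus[OF bounded_linear_ident])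

lemma strong_integral_real:
  fixes h :: "'a \<Rightarrow> real"
  assumes "has_bochner_integral M h x"
  shows "strong_integral M h x"
  using assms
proof cases
  case (1 s)
  have m: "s i \<in> borel_measurable M" for i
    using 1(2)[of i] by (auto elim: simple_bochner_integrable.cases intro: borel_measurable_simple_function)
  show ?thesis
    unfolding strong_integral_def
    by (intro exI[of _ s] exI[of _ "\<lambda>i z. ennreal (norm (h z - s i z))"]) (use 1 m in auto)
qed

lemma strong_integral_scaleR_const:
  assumes "has_bochner_integral M h x"
  shows "strong_integral M (\<lambda>z. h z *\<^sub>R b) (x *\<^sub>R b)"
  using strong_integral_bounded_linear[OF bounded_linear_scaleR_left strong_integral_real[OF assms]] .

text \<open>Completeness of the space is used here: the integrals of the approximants are a Cauchy sequence, and a diagonal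
  choice of simple functions approximates the limit.\<close>

lemma strong_integral_limit:
  fixes g :: "'a \<Rightarrow> 'b::banach"
  assumes f: "\<And>n::nat. strong_integral M (f n) (x n)" and e: "\<And>n. e n \<in> borel_measurable M"
    and le: "\<And>n z. z \<in> space M \<Longrightarrow> ennreal (norm (g z - f n z)) \<le> e n z"
    and lim: "(\<lambda>n. \<integral>\<^sup>+z. e n z \<partial>M) \<longlonglongrightarrow> 0"
  shows "\<exists>y. x \<longlonglongrightarrow> y \<and> strong_integral M g y"
proof -
  have dist: "ennreal (norm (x n - x m)) \<le> (\<integral>\<^sup>+z. e n z \<partial>M) + (\<integral>\<^sup>+z. e m z \<partial>M)" for n m
  proof -
    have "ennreal (norm (x n - x m)) \<le> (\<integral>\<^sup>+z. e n z + e m z \<partial>M)"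
    proof (rule strong_integral_dist[OF f f])
      fix z assume z: "z \<in> space M"
      have "norm (f n z - f m z) \<le> norm (g z - f n z) + norm (g z - f m z)"
        using norm_triangle_ineq[of "f n z - g z" "g z - f m z"] by (simp add: norm_minus_commute)
      then have "ennreal (norm (f n z - f m z)) \<le> ennreal (norm (g z - f n z)) + ennreal (norm (g z - f m z))"
        by (simp add: ennreal_leI flip: ennreal_plus)
      also have "\<dots> \<le> e n z + e m z" by (intro add_mono le z)
      finally show "ennreal (norm (f n z - f m z)) \<le> e n z + e m z" .
    qed (use e in simp)
    then show ?thesis using e by (simp add: nn_integral_add)
  qed
  have "Cauchy x"
  proof (rule CauchyI)
    fix \<epsilon> :: real assume "\<epsilon> > 0"
    then have "\<forall>\<^sub>F n in sequentially. (\<integral>\<^sup>+z. e n z \<partial>M) < ennreal (\<epsilon> / 2)"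
      using order_tendstoD(2)[OF lim, of "ennreal (\<epsilon> / 2)"] by simp
    then obtain N where N: "\<And>n. n \<ge> N \<Longrightarrow> (\<integral>\<^sup>+z. e n z \<partial>M) < ennreal (\<epsilon> / 2)"
      by (auto simp: eventually_sequentially)
    have "norm (x m - x n) < \<epsilon>" if "m \<ge> N" "n \<ge> N" for m n
    proof -
      have "ennreal (norm (x m - x n)) < ennreal (\<epsilon> / 2) + ennreal (\<epsilon> / 2)"
        using dist[of m n] add_strict_mono[OF N[OF that(1)] N[OF that(2)]] by (rule le_less_trans)
      also have "\<dots> = ennreal \<epsilon>" using \<open>\<epsilon> > 0\<close> by (simp flip: ennreal_plus)
      finally show ?thesis by (simp add: ennreal_less_iff)
    qed
    then show "\<exists>N. \<forall>m\<ge>N. \<forall>n\<ge>N. norm (x m - x n) < \<epsilon>" by blast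
  qed
  then obtain y where y: "x \<longlonglongrightarrow> y" using Cauchy_convergent convergent_def by blast
  have "\<exists>s d. sb_integrable M s \<and> d \<in> borel_measurable M \<and>
      (\<forall>z\<in>space M. ennreal (norm (f n z - s z)) \<le> d z) \<and>
      (\<integral>\<^sup>+z. d z \<partial>M) \<le> ennreal (inverse (Suc n)) \<and> norm (sb_integral M s - x n) \<le> inverse (Suc n)" for n
  proof -
    obtain s c where s: "\<And>i::nat. sb_integrable M (s i)" "\<And>i. c i \<in> borel_measurable M"
      "\<And>i z. z \<in> space M \<Longrightarrow> ennreal (norm (f n z - s i z)) \<le> c i z"
      "(\<lambda>i. \<integral>\<^sup>+z. c i z \<partial>M) \<longlonglongrightarrow> 0" "(\<lambda>i. sb_integral M (s i)) \<longlonglongrightarrow> x n"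
      using f[of n] unfolding strong_integral_def by blast
    have "\<forall>\<^sub>F i in sequentially. (\<integral>\<^sup>+z. c i z \<partial>M) < ennreal (inverse (Suc n))"
      by (rule order_tendstoD(2)[OF s(4)]) simp
    moreover have "\<forall>\<^sub>F i in sequentially. dist (sb_integral M (s i)) (x n) < inverse (Suc n)"
      by (rule tendstoD[OF s(5)]) simp
    ultimately have "\<forall>\<^sub>F i in sequentially. (\<integral>\<^sup>+z. c i z \<partial>M) < ennreal (inverse (Suc n)) \<and>
       dist (sb_integral M (s i)) (x n) < inverse (Suc n)"
      by (rule eventually_conj)
    then obtain i where "(\<integral>\<^sup>+z. c i z \<partial>M) < ennreal (inverse (Suc n)) \<and>
       dist (sb_integral M (s i)) (x n) < inverse (Suc n)"
      using eventually_happens by force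
    then show ?thesis using s(1)[of i] s(2)[of i] s(3)[of _ i]
      by (intro exI[of _ "s i"] exI[of _ "c i"]) (auto simp: dist_norm)
  qed
  then obtain s d where s: "\<And>n. sb_integrable M (s n)" "\<And>n. d n \<in> borel_measurable M"
      "\<And>n z. z \<in> space M \<Longrightarrow> ennreal (norm (f n z - s n z)) \<le> d n z"
      "\<And>n. (\<integral>\<^sup>+z. d n z \<partial>M) \<le> ennreal (inverse (Suc n))"
      "\<And>n. norm (sb_integral M (s n) - x n) \<le> inverse (Suc n)"
    by metis
  have inv0: "(\<lambda>n. ennreal (inverse (Suc n))) \<longlonglongrightarrow> 0"
    using tendsto_ennrealI[OF LIMSEQ_inverse_real_of_nat] by simp
  have d0: "(\<lambda>n. \<integral>\<^sup>+z. d n z \<partial>M) \<longlonglongrightarrow> 0"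
    by (rule tendsto_sandwich[OF _ _ tendsto_const inv0]) (use s(4) in auto)
  have "(\<lambda>n. sb_integral M (s n) - x n) \<longlonglongrightarrow> 0"
    by (rule Lim_null_comparison[OF _ LIMSEQ_inverse_real_of_nat]) (use s(5) in auto)
  from tendsto_add[OF this y] have "(\<lambda>n. sb_integral M (s n)) \<longlonglongrightarrow> y" by simp
  moreover have "ennreal (norm (g z - s n z)) \<le> e n z + d n z" if "z \<in> space M" for n z
  proof -
    have "norm (g z - s n z) \<le> norm (g z - f n z) + norm (f n z - s n z)"
      using norm_triangle_ineq[of "g z - f n z" "f n z - s n z"] by simp
    then have "ennreal (norm (g z - s n z)) \<le> ennreal (norm (g z - f n z)) + ennreal (norm (f n z - s n z))"
      by (simp add: ennreal_leI flip: ennreal_plus)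
    also have "\<dots> \<le> e n z + d n z" by (intro add_mono le s(3) that)
    finally show ?thesis .
  qed
  moreover have "(\<lambda>n. \<integral>\<^sup>+z. e n z + d n z \<partial>M) \<longlonglongrightarrow> 0"
    using tendsto_add[OF lim d0] e s(2) by (simp add: nn_integral_add)
  ultimately have "strong_integral M g y"
    unfolding strong_integral_def
    by (intro exI[of _ s] exI[of _ "\<lambda>n z. e n z + d n z"]) (use s(1,2) e in auto)
  with y show ?thesis by blast
qed

lemma strong_imp_has_banach_integral:
  assumes f: "f \<in> borel_measurable M" and "strong_integral M f x"
  shows "has_banach_integral M f x"
proof -
  obtain s c where s: "\<And>i::nat. sb_integrable M (s i)" "\<And>i. c i \<in> borel_measurable M"
      "\<And>i z. z \<in> space M \<Longrightarrow> ennreal (norm (f z - s i z)) \<le> c i z"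
      "(\<lambda>i. \<integral>\<^sup>+z. c i z \<partial>M) \<longlonglongrightarrow> 0" "(\<lambda>i. sb_integral M (s i)) \<longlonglongrightarrow> x"
    using assms(2) unfolding strong_integral_def by blast
  have "(\<lambda>i. \<integral>\<^sup>+z. ennreal (norm (f z - s i z)) \<partial>M) \<longlonglongrightarrow> 0"
    by (rule tendsto_sandwich[OF _ _ tendsto_const s(4)])
       (auto intro!: always_eventually nn_integral_mono s(3))
  with f s show ?thesis unfolding has_banach_integral_def by blast
qed

text \<open>Here the error is measurable because a simple function takes finitely many values: on each piece it
  is the norm of the difference of a Borel function and a constant.\<close>

lemma has_banach_imp_strong_integral:
  fixes f :: "'a \<Rightarrow> 'b::banach"
  assumes "has_banach_integral M f x"
  shows "strong_integral M f x"
proof -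
  obtain s where f: "f \<in> borel_measurable M" and s: "\<And>i::nat. sb_integrable M (s i)"
      "(\<lambda>i. \<integral>\<^sup>+z. ennreal (norm (f z - s i z)) \<partial>M) \<longlonglongrightarrow> 0" "(\<lambda>i. sb_integral M (s i)) \<longlonglongrightarrow> x"
    using assms unfolding has_banach_integral_def by blast
  have "(\<lambda>z. ennreal (norm (f z - s i z))) \<in> borel_measurable M" for i
  proof -
    have sf: "simple_function M (s i)" using s(1)[of i] by (rule simple_bochner_integrable.cases)
    have "s i \<in> measurable M (count_space (s i ` space M))"
      using sf by (auto simp: simple_function_def measurable_count_space_eq2 vimage_def Int_def conj_commute)
    then show ?thesis
    proof (rule measurable_compose_countable'[rotated])
      show "countable (s i ` space M)" using sf by (auto simp: simple_function_def intro: countable_finite)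
      fix y :: 'b
      have "(\<lambda>v. ennreal (norm (v - y))) \<in> borel_measurable borel"
        by (intro measurable_compose[OF _ measurable_ennreal] borel_measurable_continuous_onI continuous_intros)
      then show "(\<lambda>z. ennreal (norm (f z - y))) \<in> borel_measurable M"
        using measurable_compose[OF f] by blast
    qed
  qed
  with s show ?thesis
    unfolding strong_integral_def
    by (intro exI[of _ s] exI[of _ "\<lambda>i z. ennreal (norm (f z - s i z))"]) auto
qed

lemma banach_integral_eq:
  assumes "f \<in> borel_measurable M" "strong_integral M f x"
  shows "banach_integrable M f" "banach_integral M f = x"
proof -
  have h: "has_banach_integral M f x" by (rule strong_imp_has_banach_integral) fact+
  then show *: "banach_integrable M f" unfolding banach_integrable_def by blast
  show "banach_integral M f = x"
    unfolding banach_integral_def using *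
    by (simp add: the_equality[of "has_banach_integral M f", OF h]
         strong_integral_unique[OF has_banach_imp_strong_integral assms(2)])
qed

definition bint :: "'a measure \<Rightarrow> ('a \<Rightarrow> 'b::real_normed_vector) \<Rightarrow> 'b" where
  "bint M f = (THE x. strong_integral M f x)"

lemma bint_eq: "strong_integral M f x \<Longrightarrow> bint M f = x"
  unfolding bint_def by (blast intro: the_equality strong_integral_unique)

subsection \<open>Bounded continuous functions and finite Borel measures\<close>

text \<open>The approximants depend on the function alone, not on a measure. That is what allows
  \<open>strong_integral_mixture\<close> to approximate the integrals against all measures of a kernel at once.\<close>

lemma continuous_step_approximation:
  fixes \<phi> :: "real \<Rightarrow> 'b::real_normed_vector"
  assumes cont: "continuous_on UNIV \<phi>" and bd: "\<And>r. norm (\<phi> r) \<le> C"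
  shows "\<exists>s :: nat \<Rightarrow> real \<Rightarrow> 'b. \<forall>n::nat. simple_function borel (s n) \<and> (\<forall>r. norm (s n r) \<le> C) \<and>
     (\<forall>r. \<bar>r\<bar> \<le> real n \<longrightarrow> norm (\<phi> r - s n r) \<le> 1 / (real n + 1))"
proof (intro choice allI)
  fix n :: nat
  have C0: "C \<ge> 0" using bd[of 0] norm_ge_zero order_trans by blast
  have "uniformly_continuous_on {- real n - 1 .. real n} \<phi>"
    by (rule compact_uniformly_continuous) (use cont continuous_on_subset in auto)
  then have "\<exists>d>0. \<forall>x\<in>{- real n - 1..real n}. \<forall>y\<in>{- real n - 1..real n}.
       dist y x < d \<longrightarrow> dist (\<phi> y) (\<phi> x) < 1 / (real n + 1)"
    unfolding uniformly_continuous_on_def by (elim allE[of _ "1 / (real n + 1)"]) simp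
  then obtain d where d: "d > 0" "\<And>x y. x \<in> {- real n - 1 .. real n} \<Longrightarrow> y \<in> {- real n - 1 .. real n} \<Longrightarrow>
      dist y x < d \<Longrightarrow> dist (\<phi> y) (\<phi> x) < 1 / (real n + 1)"
    by blast
  \<comment> \<open>round down to a grid finer than the modulus of continuity; the rounded point may leave \<open>{-n..n}\<close> by at most \<open>1\<close>\<close>
  obtain N :: nat where N: "1 / d < N" using reals_Archimedean2 by blast
  have N0: "real N > 0" using N d(1) by (meson divide_pos_pos less_trans zero_less_one)
  have N1: "1 / N < d" "N \<ge> 1" using N N0 d(1) by (auto simp: field_simps)
  define s where "s r = (if \<bar>r\<bar> \<le> n then \<phi> (real_of_int \<lfloor>r * real N\<rfloor> / real N) else 0)" for r :: real
  have "range s \<subseteq> insert 0 ((\<lambda>k::int. \<phi> (real_of_int k / real N)) ` {\<lfloor>- real n * real N\<rfloor> .. \<lfloor>real n * real N\<rfloor>})"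
  proof
    fix y assume "y \<in> range s"
    then obtain r where r: "y = s r" by auto
    show "y \<in> insert 0 ((\<lambda>k::int. \<phi> (real_of_int k / real N)) ` {\<lfloor>- real n * real N\<rfloor> .. \<lfloor>real n * real N\<rfloor>})"
    proof (cases "\<bar>r\<bar> \<le> n")
      case True
      have "\<lfloor>- real n * real N\<rfloor> \<le> \<lfloor>r * real N\<rfloor>" "\<lfloor>r * real N\<rfloor> \<le> \<lfloor>real n * real N\<rfloor>"
        using True by (intro floor_mono mult_right_mono; simp)+
      then show ?thesis unfolding r s_def using True by auto
    qed (simp add: r s_def)
  qed
  then have fin: "finite (range s)" by (rule finite_subset) simp
  have "s \<in> measurable borel (count_space UNIV)" unfolding s_def by measurable
  then have sf: "simple_function borel s"
    unfolding simple_function_def using fin by (auto intro: measurable_sets[of s borel "count_space UNIV", simplified])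
  have "norm (\<phi> r - s r) \<le> 1 / (real n + 1)" if r: "\<bar>r\<bar> \<le> real n" for r :: real
  proof -
    have a: "real_of_int \<lfloor>r * real N\<rfloor> / real N \<le> r" using N0 by (simp add: divide_le_eq)
    have "r - 1 / real N = (r * real N - 1) / real N" using N0 by (simp add: diff_divide_distrib)
    also have "\<dots> < real_of_int \<lfloor>r * real N\<rfloor> / real N" using N0 by (intro divide_strict_right_mono) linarith
    finally have b: "r - 1 / real N < real_of_int \<lfloor>r * real N\<rfloor> / real N" .
    have "1 / real N \<le> 1" using N1(2) by simp
    then have "real_of_int \<lfloor>r * real N\<rfloor> / real N \<in> {- real n - 1..real n}" "r \<in> {- real n - 1..real n}"
      using a b r unfolding atLeastAtMost_iff by linarith+
    moreover have "dist r (real_of_int \<lfloor>r * real N\<rfloor> / real N) < d"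
      using a b N1(1) unfolding dist_real_def by linarith
    ultimately have "dist (\<phi> r) (\<phi> (real_of_int \<lfloor>r * real N\<rfloor> / real N)) < 1 / (real n + 1)"
      by (intro d(2))
    then show ?thesis unfolding s_def using r by (simp add: dist_norm)
  qed
  moreover have "norm (s r) \<le> C" for r :: real unfolding s_def using bd C0 by simp
  ultimately show "\<exists>s. simple_function borel s \<and> (\<forall>r. norm (s r) \<le> C) \<and>
     (\<forall>r. \<bar>r\<bar> \<le> real n \<longrightarrow> norm (\<phi> r - s r) \<le> 1 / (real n + 1))" using sf by blast
qed

lemma finite_measure_simple_integrable:
  fixes s :: "real \<Rightarrow> 'b::real_normed_vector"
  assumes "finite_measure \<nu>" "sets \<nu> = sets borel" "simple_function borel s"
  shows "sb_integrable \<nu> s"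
proof (rule simple_bochner_integrable.intros)
  show "simple_function \<nu> s"
    using assms(3) sets_eq_imp_space_eq[OF assms(2)] assms(2) by (simp add: simple_function_def)
  show "emeasure \<nu> {y \<in> space \<nu>. s y \<noteq> 0} \<noteq> \<infinity>"
    using finite_measure.emeasure_finite[OF assms(1)] by simp
qed

lemma step_error_tendsto_0:
  assumes "finite_measure \<nu>" "sets \<nu> = sets borel"
  shows "(\<lambda>n::nat. \<integral>\<^sup>+r. (if \<bar>r\<bar> \<le> real n then ennreal (1 / (real n + 1)) else ennreal C) \<partial>\<nu>) \<longlonglongrightarrow> 0"
proof -
  interpret finite_measure \<nu> by fact
  have [measurable_cong]: "sets \<nu> = sets borel" by fact
  have "(\<lambda>n::nat. \<integral>\<^sup>+r. (if \<bar>r\<bar> \<le> real n then ennreal (1 / (real n + 1)) else ennreal C) \<partial>\<nu>)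
      \<longlonglongrightarrow> (\<integral>\<^sup>+r. 0 \<partial>\<nu>)"
  proof (rule nn_integral_dominated_convergence[where w="\<lambda>_. ennreal (max 1 C)"])
    show "(\<integral>\<^sup>+r. ennreal (max 1 C) \<partial>\<nu>) < \<infinity>"
      by (simp add: less_top[symmetric] ennreal_mult_eq_top_iff)
    show "AE r in \<nu>. (if \<bar>r\<bar> \<le> real j then ennreal (1 / (real j + 1)) else ennreal C) \<le> ennreal (max 1 C)" for j
      by (auto intro!: AE_I2 ennreal_leI simp: le_max_iff_disj)
    show "AE r in \<nu>. (\<lambda>n::nat. if \<bar>r\<bar> \<le> real n then ennreal (1 / (real n + 1)) else ennreal C) \<longlonglongrightarrow> 0"
    proof (rule AE_I2)
      fix r
      have "(\<lambda>n::nat. ennreal (1 / (real n + 1))) \<longlonglongrightarrow> ennreal 0"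
        by (intro tendsto_ennrealI) real_asymp
      moreover have "\<forall>\<^sub>F n::nat in sequentially. \<bar>r\<bar> \<le> real n"
        by real_asymp
      ultimately show "(\<lambda>n::nat. if \<bar>r\<bar> \<le> real n then ennreal (1 / (real n + 1)) else ennreal C) \<longlonglongrightarrow> 0"
        by (auto elim!: Lim_transform_eventually eventually_mono)
    qed
  qed measurable
  then show ?thesis by simp
qed

lemma step_error_bound:
  fixes \<phi> :: "real \<Rightarrow> 'b::real_normed_vector"
  assumes bd: "\<And>r. norm (\<phi> r) \<le> C" and s: "\<And>r. norm (s r) \<le> C"
    "\<And>r. \<bar>r\<bar> \<le> real n \<Longrightarrow> norm (\<phi> r - s r) \<le> 1 / (real n + 1)"
  shows "ennreal (norm (\<phi> r - s r)) \<le> (if \<bar>r\<bar> \<le> real n then ennreal (1 / (real n + 1)) else ennreal (2 * C))"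
  using s(2)[of r] norm_triangle_ineq4[of "\<phi> r" "s r"] bd[of r] s(1)[of r]
  by (auto intro!: ennreal_leI)

lemma strong_integral_bint:
  fixes \<phi> :: "real \<Rightarrow> 'b::banach"
  assumes cont: "continuous_on UNIV \<phi>" and bd: "\<And>r. norm (\<phi> r) \<le> C"
    and \<nu>: "finite_measure \<nu>" "sets \<nu> = sets borel"
  shows "strong_integral \<nu> \<phi> (bint \<nu> \<phi>)"
proof -
  have [measurable_cong]: "sets \<nu> = sets borel" by fact
  obtain s where s: "\<And>n. simple_function borel (s n)" "\<And>n r. norm (s n r) \<le> C"
     "\<And>n r. \<bar>r\<bar> \<le> real n \<Longrightarrow> norm (\<phi> r - s n r) \<le> 1 / (real n + 1)"
    using continuous_step_approximation[OF cont bd] by metis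
  have "\<exists>y. (\<lambda>n. sb_integral \<nu> (s n)) \<longlonglongrightarrow> y \<and> strong_integral \<nu> \<phi> y"
    by (rule strong_integral_limit[OF strong_integral_simple _ step_error_bound step_error_tendsto_0])
       (use \<nu> bd s in \<open>auto intro: finite_measure_simple_integrable\<close>)
  then show ?thesis using bint_eq by blast
qed

text \<open>For a simple function the statement is the assumption on \<open>\<nu>\<close>, value by value. The error of the
  step approximation is bounded by a scalar function of \<open>r\<close> whose integral against \<open>\<nu>\<close> is, again by assumption, the
  mixture of its integrals against \<open>k s\<close>. Substitutions, products with scalar densities, sums of measures
  and interchanges of integrals are all obtained from this by a suitable choice of \<open>k\<close>.\<close>

lemma strong_integral_mixture:
  fixes \<phi> :: "real \<Rightarrow> 'b::banach" and k :: "'a \<Rightarrow> real measure"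
  assumes cont: "continuous_on UNIV \<phi>" and bd: "\<And>r. norm (\<phi> r) \<le> C"
    and k: "\<And>s. s \<in> space m \<Longrightarrow> finite_measure (k s)" "\<And>s. s \<in> space m \<Longrightarrow> sets (k s) = sets borel"
      "\<And>A. A \<in> sets borel \<Longrightarrow> (\<lambda>s. emeasure (k s) A) \<in> borel_measurable m"
    and \<nu>: "finite_measure \<nu>" "sets \<nu> = sets borel"
      "\<And>A. A \<in> sets borel \<Longrightarrow> (\<integral>\<^sup>+s. emeasure (k s) A \<partial>m) = emeasure \<nu> A"
  shows "strong_integral m (\<lambda>s. bint (k s) \<phi>) (bint \<nu> \<phi>)"
proof -
  obtain s where s: "\<And>n. simple_function borel (s n)" "\<And>n r. norm (s n r) \<le> C"
     "\<And>n r. \<bar>r\<bar> \<le> real n \<Longrightarrow> norm (\<phi> r - s n r) \<le> 1 / (real n + 1)"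
    using continuous_step_approximation[OF cont bd] by metis
  have fin: "finite (range (s n))" for n using s(1)[of n] by (simp add: simple_function_def)
  have A: "{x. s n x = y} \<in> sets borel" for n y
    using simple_functionD(2)[OF s(1)[of n], of "{y}"] by (simp add: vimage_def)
  define I where "I \<rho> n = (\<Sum>y\<in>range (s n). measure \<rho> {x. s n x = y} *\<^sub>R y)" for \<rho> n
  have I: "sb_integral \<rho> (s n) = I \<rho> n" if "sets \<rho> = sets borel" for \<rho> n
    unfolding simple_bochner_integral_def I_def using sets_eq_imp_space_eq[OF that] by simp
  define e where "e n r = (if \<bar>r\<bar> \<le> real n then ennreal (1 / (real n + 1)) else ennreal (2 * C))" for n :: nat and r :: real
  have e_eq: "(\<integral>\<^sup>+r. e n r \<partial>\<rho>) = ennreal (1 / (real n + 1)) * emeasure \<rho> {-real n..real n}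
      + ennreal (2 * C) * emeasure \<rho> (- {-real n..real n})" if "sets \<rho> = sets borel" for \<rho> n
  proof -
    have [measurable_cong]: "sets \<rho> = sets borel" by fact
    have "(\<integral>\<^sup>+r. e n r \<partial>\<rho>) = (\<integral>\<^sup>+r. ennreal (1 / (real n + 1)) * indicator {-real n..real n} r
      + ennreal (2 * C) * indicator (- {-real n..real n}) r \<partial>\<rho>)"
      by (rule nn_integral_cong) (auto simp: e_def indicator_def)
    then show ?thesis by (simp add: nn_integral_add nn_integral_cmult_indicator that)
  qed
  have dist: "ennreal (norm (bint \<rho> \<phi> - I \<rho> n)) \<le> (\<integral>\<^sup>+r. e n r \<partial>\<rho>)" if "finite_measure \<rho>" "sets \<rho> = sets borel" for \<rho> n
  proof -
    have [measurable_cong]: "sets \<rho> = sets borel" by fact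
    show ?thesis unfolding I[OF that(2), symmetric] e_def
      by (rule strong_integral_dist[OF strong_integral_bint[OF cont bd that]
            strong_integral_simple[OF finite_measure_simple_integrable[OF that s(1)]]])
         (measurable, rule step_error_bound, use bd s in auto)
  qed
  have "\<exists>y. I \<nu> \<longlonglongrightarrow> y \<and> strong_integral m (\<lambda>s. bint (k s) \<phi>) y"
  proof (rule strong_integral_limit)
    fix n
    show "strong_integral m (\<lambda>z. I (k z) n) (I \<nu> n)"
      unfolding I_def
    proof (intro strong_integral_sum strong_integral_scaleR_const fin)
      fix y
      show "has_bochner_integral m (\<lambda>z. measure (k z) {x. s n x = y}) (measure \<nu> {x. s n x = y})"
      proof (rule has_bochner_integral_nn_integral)
        show "(\<lambda>z. measure (k z) {x. s n x = y}) \<in> borel_measurable m"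
          unfolding measure_def using k(3)[OF A] by measurable
        have "(\<integral>\<^sup>+z. ennreal (measure (k z) {x. s n x = y}) \<partial>m) = (\<integral>\<^sup>+z. emeasure (k z) {x. s n x = y} \<partial>m)"
          by (intro nn_integral_cong) (simp add: finite_measure.emeasure_eq_measure[OF k(1)])
        then show "(\<integral>\<^sup>+z. ennreal (measure (k z) {x. s n x = y}) \<partial>m) = ennreal (measure \<nu> {x. s n x = y})"
          by (simp add: \<nu>(3)[OF A] finite_measure.emeasure_eq_measure[OF \<nu>(1)])
      qed auto
    qed
    have "(\<lambda>z. ennreal (1 / (real n + 1)) * emeasure (k z) {-real n..real n}
       + ennreal (2 * C) * emeasure (k z) (- {-real n..real n})) \<in> borel_measurable m"
      using k(3)[of "{-real n..real n}"] k(3)[of "- {-real n..real n}"] by measurable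
    then show "(\<lambda>z. \<integral>\<^sup>+r. e n r \<partial>k z) \<in> borel_measurable m"
      by (subst measurable_cong[OF e_eq[OF k(2)]])
    show "ennreal (norm (bint (k z) \<phi> - I (k z) n)) \<le> (\<integral>\<^sup>+r. e n r \<partial>k z)" if "z \<in> space m" for z
      by (rule dist) (use k that in auto)
  next
    have "(\<integral>\<^sup>+z. \<integral>\<^sup>+r. e n r \<partial>k z \<partial>m) = (\<integral>\<^sup>+r. e n r \<partial>\<nu>)" for n
    proof -
      have "(\<integral>\<^sup>+z. \<integral>\<^sup>+r. e n r \<partial>k z \<partial>m) = (\<integral>\<^sup>+z. ennreal (1 / (real n + 1)) * emeasure (k z) {-real n..real n}
       + ennreal (2 * C) * emeasure (k z) (- {-real n..real n}) \<partial>m)"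
        by (intro nn_integral_cong e_eq k(2))
      also have "\<dots> = (\<integral>\<^sup>+r. e n r \<partial>\<nu>)"
        using k(3)[of "{-real n..real n}"] k(3)[of "- {-real n..real n}"]
        by (simp add: nn_integral_add nn_integral_cmult \<nu>(3) e_eq[OF \<nu>(2)])
      finally show ?thesis .
    qed
    then show "(\<lambda>n. \<integral>\<^sup>+z. \<integral>\<^sup>+r. e n r \<partial>k z \<partial>m) \<longlonglongrightarrow> 0"
      using step_error_tendsto_0[OF \<nu>(1,2), of "2 * C"] by (simp add: e_def)
  qed
  then obtain y where y: "I \<nu> \<longlonglongrightarrow> y" "strong_integral m (\<lambda>s. bint (k s) \<phi>) y" by blast
  have e0: "(\<lambda>n. \<integral>\<^sup>+r. e n r \<partial>\<nu>) \<longlonglongrightarrow> 0"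
    using step_error_tendsto_0[OF \<nu>(1,2), of "2 * C"] by (simp add: e_def)
  have "(\<lambda>n. ennreal (norm (bint \<nu> \<phi> - I \<nu> n))) \<longlonglongrightarrow> 0"
    by (rule tendsto_sandwich[OF _ _ tendsto_const e0]) (use dist[OF \<nu>(1,2)] in auto)
  then have "(\<lambda>n. norm (bint \<nu> \<phi> - I \<nu> n)) \<longlonglongrightarrow> 0"
    by (subst (asm) ennreal_0[symmetric], subst (asm) tendsto_ennreal_iff) auto
  then have "(\<lambda>n. bint \<nu> \<phi> - I \<nu> n) \<longlonglongrightarrow> 0" by (rule tendsto_norm_zero_cancel)
  from tendsto_diff[OF tendsto_const[of "bint \<nu> \<phi>"] this] have "I \<nu> \<longlonglongrightarrow> bint \<nu> \<phi>" by simp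
  with y show ?thesis using LIMSEQ_unique by metis
qed

lemma bint_norm_le:
  fixes \<phi> :: "real \<Rightarrow> 'b::banach"
  assumes "continuous_on UNIV \<phi>" "\<And>r. norm (\<phi> r) \<le> C" "finite_measure \<nu>" "sets \<nu> = sets borel"
  shows "norm (bint \<nu> \<phi>) \<le> C * measure \<nu> UNIV"
proof -
  have "ennreal (norm (bint \<nu> \<phi>)) \<le> (\<integral>\<^sup>+r. ennreal C \<partial>\<nu>)"
    by (rule strong_integral_norm_le[OF strong_integral_bint[OF assms]]) (use assms(2) in \<open>auto intro: ennreal_leI\<close>)
  also have "\<dots> = ennreal (C * measure \<nu> UNIV)"
    using sets_eq_imp_space_eq[OF assms(4)] order_trans[OF norm_ge_zero assms(2)]
    by (simp add: finite_measure.emeasure_eq_measure[OF assms(3)] ennreal_mult)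
  finally show ?thesis
    using order_trans[OF norm_ge_zero assms(2)] by (subst (asm) ennreal_le_iff) auto
qed

lemma bint_return:
  fixes \<phi> :: "real \<Rightarrow> 'b::banach"
  assumes "continuous_on UNIV \<phi>" "\<And>r. norm (\<phi> r) \<le> C"
  shows "bint (return borel x) \<phi> = \<phi> x"
proof -
  have "ennreal (norm (bint (return borel x) \<phi> - 0 - \<phi> x)) \<le> (\<integral>\<^sup>+r. ennreal (norm (\<phi> r - \<phi> x)) \<partial>return borel x)"
  proof (rule strong_integral_dist)
    show "strong_integral (return borel x) \<phi> (bint (return borel x) \<phi> - 0)"
      using strong_integral_bint[OF assms, of "return borel x"] by (simp add: prob_space.finite_measure prob_space_return)
    have "has_bochner_integral (return borel x) (\<lambda>_. 1::real) 1"
      by (rule has_bochner_integral_nn_integral) (auto simp: nn_integral_return)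
    from strong_integral_scaleR_const[OF this, of "\<phi> x"]
    show "strong_integral (return borel x) (\<lambda>_. \<phi> x) (\<phi> x)" by simp
    show "(\<lambda>r. ennreal (norm (\<phi> r - \<phi> x))) \<in> borel_measurable (return borel x)"
      using assms(1) by (auto intro!: measurable_compose[OF _ measurable_ennreal] borel_measurable_continuous_onI continuous_intros)
  qed simp
  also have "\<dots> = 0"
    using assms(1) by (subst nn_integral_return)
      (auto intro!: measurable_compose[OF _ measurable_ennreal] borel_measurable_continuous_onI continuous_intros)
  finally show ?thesis by (simp add: ennreal_eq_0_iff)
qed

lemma bint_add_measure:
  fixes \<phi> :: "real \<Rightarrow> 'b::banach"
  assumes \<phi>: "continuous_on UNIV \<phi>" "\<And>r. norm (\<phi> r) \<le> C"
    and \<nu>1: "finite_measure \<nu>1" "sets \<nu>1 = sets borel" and \<nu>2: "finite_measure \<nu>2" "sets \<nu>2 = sets borel"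
    and \<nu>: "finite_measure \<nu>" "sets \<nu> = sets borel"
    and eq: "\<And>A. A \<in> sets borel \<Longrightarrow> emeasure \<nu> A = emeasure \<nu>1 A + emeasure \<nu>2 A"
  shows "bint \<nu> \<phi> = bint \<nu>1 \<phi> + bint \<nu>2 \<phi>"
proof -
  \<comment> \<open>a sum of two measures is a mixture over a two-point space\<close>
  let ?k = "\<lambda>b. if b then \<nu>1 else \<nu>2"
  have "strong_integral (count_space UNIV) (\<lambda>b. bint (?k b) \<phi>) (bint \<nu> \<phi>)"
    by (rule strong_integral_mixture[OF \<phi>])
       (auto simp: assms nn_integral_count_space_finite UNIV_bool)
  moreover have "strong_integral (count_space UNIV) (\<lambda>b. bint (?k b) \<phi>) (bint \<nu>1 \<phi> + bint \<nu>2 \<phi>)"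
  proof -
    have "sb_integrable (count_space UNIV) (\<lambda>b. bint (?k b) \<phi>)"
      by (intro simple_bochner_integrable.intros)
         (auto simp: simple_function_def emeasure_count_space finite_subset[OF subset_UNIV])
    note strong_integral_simple[OF this]
    also have "sb_integral (count_space UNIV) (\<lambda>b. bint (?k b) \<phi>) =
        (\<Sum>y\<in>(\<lambda>b. b) ` space (count_space UNIV). measure (count_space UNIV) {x \<in> space (count_space UNIV). x = y} *\<^sub>R bint (?k y) \<phi>)"
      by (rule simple_bochner_integral_partition) (auto simp: simple_function_def, fact)
    also have "\<dots> = bint \<nu>1 \<phi> + bint \<nu>2 \<phi>"
      by (simp add: UNIV_bool)
    finally show ?thesis .
  qed
  ultimately show ?thesis by (rule strong_integral_unique)
qed

lemma bint_scale_measure: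
  fixes \<phi> :: "real \<Rightarrow> 'b::banach"
  assumes \<phi>: "continuous_on UNIV \<phi>" "\<And>r. norm (\<phi> r) \<le> C" and \<nu>: "finite_measure \<nu>" "sets \<nu> = sets borel"
    and c: "c \<ge> 0"
  shows "bint (scale_measure (ennreal c) \<nu>) \<phi> = c *\<^sub>R bint \<nu> \<phi>"
proof -
  \<comment> \<open>a multiple of a measure is a mixture over a point of mass \<open>c\<close>\<close>
  let ?m = "scale_measure (ennreal c) (count_space (UNIV :: unit set))"
  have "finite_measure (scale_measure (ennreal c) \<nu>)"
    by (rule finite_measureI) (use finite_measure.emeasure_finite[OF \<nu>(1)] in \<open>auto simp: ennreal_mult_eq_top_iff space_scale_measure\<close>)
  then have "strong_integral ?m (\<lambda>_. bint \<nu> \<phi>) (bint (scale_measure (ennreal c) \<nu>) \<phi>)"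
    by (intro strong_integral_mixture[OF \<phi>])
       (use \<nu> in \<open>auto simp: nn_integral_scale_measure nn_integral_count_space_finite space_scale_measure mult.commute\<close>)
  moreover have "has_bochner_integral ?m (\<lambda>_. 1::real) c"
    by (rule has_bochner_integral_nn_integral)
       (use c in \<open>auto simp: nn_integral_scale_measure nn_integral_count_space_finite space_scale_measure mult.commute\<close>)
  from strong_integral_scaleR_const[OF this, of "bint \<nu> \<phi>"]
  have "strong_integral ?m (\<lambda>_. bint \<nu> \<phi>) (c *\<^sub>R bint \<nu> \<phi>)" by simp
  ultimately show ?thesis by (rule strong_integral_unique)
qed

lemma finite_scale_measure:
  assumes "finite_measure \<nu>" shows "finite_measure (scale_measure (ennreal c) \<nu>)"
  by (rule finite_measureI)
     (use finite_measure.emeasure_finite[OF assms] in \<open>auto simp: ennreal_mult_eq_top_iff space_scale_measure\<close>)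

subsection \<open>Primitives of continuous functions\<close>

definition leb :: "real \<Rightarrow> real \<Rightarrow> real measure" where
  "leb a b = density lborel (indicator {a<..<b})"

lemma sets_leb [simp, measurable_cong]: "sets (leb a b) = sets borel"
  by (simp add: leb_def)

lemma emeasure_leb: "A \<in> sets borel \<Longrightarrow> emeasure (leb a b) A = emeasure lborel (A \<inter> {a<..<b})"
  unfolding leb_def by (subst emeasure_density)
    (auto simp: indicator_inter_arith[symmetric] Int_commute simp del: nn_integral_indicator simp flip: nn_integral_indicator intro!: nn_integral_cong split: split_indicator)

lemma emeasure_leb_UNIV: "a \<le> b \<Longrightarrow> emeasure (leb a b) UNIV = ennreal (b - a)"
  by (simp add: emeasure_leb)

lemma finite_leb: "finite_measure (leb a b)"
proof (rule finite_measureI)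
  show "emeasure (leb a b) (space (leb a b)) \<noteq> \<infinity>"
    using emeasure_leb[of UNIV a b] by (cases "a \<le> b") (simp_all add: leb_def)
qed

lemma ennreal_norm_continuous_measurable:
  "continuous_on UNIV g \<Longrightarrow> (\<lambda>r::real. ennreal (norm (g r))) \<in> borel_measurable borel"
  by (rule measurable_compose[OF borel_measurable_continuous_onI[OF continuous_on_norm] measurable_ennreal])

lemma bint_norm_le_nn:
  fixes \<phi> :: "real \<Rightarrow> 'b::banach"
  assumes "continuous_on UNIV \<phi>" "\<And>r. norm (\<phi> r) \<le> C" "finite_measure \<nu>" "sets \<nu> = sets borel"
  shows "ennreal (norm (bint \<nu> \<phi>)) \<le> (\<integral>\<^sup>+r. ennreal (norm (\<phi> r)) \<partial>\<nu>)"
proof (rule strong_integral_norm_le[OF strong_integral_bint[OF assms]])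
  have "(\<lambda>r. ennreal (norm (\<phi> r))) \<in> borel_measurable borel"
    using assms(1) by (rule ennreal_norm_continuous_measurable)
  then show "(\<lambda>r. ennreal (norm (\<phi> r))) \<in> borel_measurable \<nu>"
    by (simp add: measurable_cong_sets[OF assms(4) refl])
qed simp

lemma bint_diff:
  fixes \<phi> \<psi> :: "real \<Rightarrow> 'b::banach"
  assumes "continuous_on UNIV \<phi>" "\<And>r. norm (\<phi> r) \<le> C" "continuous_on UNIV \<psi>" "\<And>r. norm (\<psi> r) \<le> C'"
    "finite_measure \<nu>" "sets \<nu> = sets borel"
  shows "bint \<nu> (\<lambda>r. \<phi> r - \<psi> r) = bint \<nu> \<phi> - bint \<nu> \<psi>"
  by (rule bint_eq, rule strong_integral_diff)
     (rule strong_integral_bint[OF assms(1,2,5,6)] strong_integral_bint[OF assms(3,4,5,6)])+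

lemma bint_linear:
  fixes \<phi> :: "real \<Rightarrow> 'b::banach" and A :: "'b \<Rightarrow> 'c::banach"
  assumes "bounded_linear A" "continuous_on UNIV \<phi>" "\<And>r. norm (\<phi> r) \<le> C" "finite_measure \<nu>" "sets \<nu> = sets borel"
  shows "bint \<nu> (\<lambda>r. A (\<phi> r)) = A (bint \<nu> \<phi>)"
  by (rule bint_eq, rule strong_integral_bounded_linear[OF assms(1)], rule strong_integral_bint[OF assms(2-)])

lemma bint_const:
  fixes c :: "'b::banach"
  assumes "finite_measure \<nu>" "sets \<nu> = sets borel"
  shows "bint \<nu> (\<lambda>_. c) = measure \<nu> UNIV *\<^sub>R c"
proof (rule bint_eq)
  have "has_bochner_integral \<nu> (\<lambda>_. 1::real) (measure \<nu> UNIV)"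
    using sets_eq_imp_space_eq[OF assms(2)]
    by (intro has_bochner_integral_nn_integral) (auto simp: finite_measure.emeasure_eq_measure[OF assms(1)])
  from strong_integral_scaleR_const[OF this, of c] show "strong_integral \<nu> (\<lambda>_. c) (measure \<nu> UNIV *\<^sub>R c)" by simp
qed

lemma bint_null:
  fixes \<phi> :: "real \<Rightarrow> 'b::banach"
  assumes "continuous_on UNIV \<phi>" "\<And>r. norm (\<phi> r) \<le> C" "finite_measure \<nu>" "sets \<nu> = sets borel" "emeasure \<nu> UNIV = 0"
  shows "bint \<nu> \<phi> = 0"
  using bint_norm_le[OF assms(1-4)] assms(5) by (simp add: measure_def)

lemma bint_leb_mean:
  fixes \<phi> :: "real \<Rightarrow> 'b::banach"
  assumes c: "continuous_on UNIV \<phi>" "\<And>r. norm (\<phi> r) \<le> C" and ab: "a \<le> b"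
    and e: "\<And>r. a < r \<Longrightarrow> r < b \<Longrightarrow> norm (\<phi> r - x) \<le> e" "e \<ge> 0"
  shows "norm (bint (leb a b) \<phi> - (b - a) *\<^sub>R x) \<le> e * (b - a)"
proof -
  have m: "measure (leb a b) UNIV = b - a" using ab by (simp add: measure_def emeasure_leb_UNIV)
  have "bint (leb a b) (\<lambda>r. \<phi> r - x) = bint (leb a b) \<phi> - bint (leb a b) (\<lambda>_. x)"
    by (rule bint_diff[OF c _ _ finite_leb sets_leb, of _ "norm x"]) (auto intro: continuous_intros)
  then have "bint (leb a b) \<phi> - (b - a) *\<^sub>R x = bint (leb a b) (\<lambda>r. \<phi> r - x)"
    by (simp add: bint_const finite_leb m)
  moreover have "ennreal (norm (bint (leb a b) (\<lambda>r. \<phi> r - x))) \<le> (\<integral>\<^sup>+r. ennreal (norm (\<phi> r - x)) \<partial>leb a b)"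
    using c
    by (intro bint_norm_le_nn[of _ "C + norm x"] finite_leb) (auto intro!: continuous_intros order_trans[OF norm_triangle_ineq4] add_mono)
  moreover have "(\<integral>\<^sup>+r. ennreal (norm (\<phi> r - x)) \<partial>leb a b) \<le> ennreal (e * (b - a))"
  proof -
    have [measurable]: "(\<lambda>r. ennreal (norm (\<phi> r - x))) \<in> borel_measurable borel"
      using c(1) by (intro ennreal_norm_continuous_measurable continuous_intros) auto
    have "(\<integral>\<^sup>+r. ennreal (norm (\<phi> r - x)) \<partial>leb a b) = (\<integral>\<^sup>+r. indicator {a<..<b} r * ennreal (norm (\<phi> r - x)) \<partial>lborel)"
      unfolding leb_def by (rule nn_integral_density) measurable
    also have "\<dots> \<le> (\<integral>\<^sup>+r. ennreal e * indicator {a<..<b} r \<partial>lborel)"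
      using e by (intro nn_integral_mono) (auto simp: indicator_def intro!: ennreal_leI)
    also have "\<dots> = ennreal (e * (b - a))"
      using ab e(2) by (simp add: nn_integral_cmult_indicator ennreal_mult)
    finally show ?thesis .
  qed
  ultimately have "ennreal (norm (bint (leb a b) \<phi> - (b - a) *\<^sub>R x)) \<le> ennreal (e * (b - a))"
    by simp
  then show ?thesis using e(2) ab by (simp add: ennreal_le_iff)
qed

lemma bint_leb_split:
  fixes \<phi> :: "real \<Rightarrow> 'b::banach"
  assumes c: "continuous_on UNIV \<phi>" "\<And>r. norm (\<phi> r) \<le> C" and ab: "a \<le> x" "x \<le> b"
  shows "bint (leb a b) \<phi> = bint (leb a x) \<phi> + bint (leb x b) \<phi>"
proof (rule bint_add_measure[OF c])
  fix A :: "real set" assume A: "A \<in> sets borel"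
  have "emeasure (leb a b) A = emeasure lborel (A \<inter> {a<..<b})" by (rule emeasure_leb[OF A])
  also have "\<dots> = emeasure lborel ((A \<inter> {a<..<x}) \<union> (A \<inter> {x<..<b}))"
  proof (rule emeasure_eq_AE)
    show "AE r in lborel. r \<in> A \<inter> {a<..<b} \<longleftrightarrow> r \<in> A \<inter> {a<..<x} \<union> A \<inter> {x<..<b}"
      using AE_lborel_singleton[of x] by eventually_elim (use ab in auto)
  qed (use A in auto)
  also have "\<dots> = emeasure (leb a x) A + emeasure (leb x b) A"
    using A by (subst plus_emeasure[symmetric]) (auto simp: emeasure_leb)
  finally show "emeasure (leb a b) A = emeasure (leb a x) A + emeasure (leb x b) A" .
qed (auto simp: finite_leb)

lemma bint_leb_has_derivative:
  fixes \<phi> :: "real \<Rightarrow> 'b::banach"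
  assumes c: "continuous_on UNIV \<phi>" "\<And>r. norm (\<phi> r) \<le> C" and ax: "a \<le> x"
  shows "((\<lambda>x. bint (leb a x) \<phi>) has_vector_derivative \<phi> x) (at x within {a..})"
  unfolding has_vector_derivative_def has_derivative_within_alt
proof (intro conjI allI impI)
  show "bounded_linear (\<lambda>h. h *\<^sub>R \<phi> x)" by (rule bounded_linear_scaleR_left)
  fix e :: real assume e: "0 < e"
  have "isCont \<phi> x" using c(1) by (simp add: continuous_on_eq_continuous_at)
  from this[unfolded continuous_at_eps_delta, rule_format, OF e]
  obtain d where d: "d > 0" "\<And>y. dist y x < d \<Longrightarrow> dist (\<phi> y) (\<phi> x) < e" by auto
  show "\<exists>d>0. \<forall>y\<in>{a..}. norm (y - x) < d \<longrightarrow>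
        norm (bint (leb a y) \<phi> - bint (leb a x) \<phi> - (y - x) *\<^sub>R \<phi> x) \<le> e * norm (y - x)"
  proof (intro exI[of _ d] conjI ballI impI d(1))
    fix y assume y: "y \<in> {a..}" "norm (y - x) < d"
    have near: "norm (\<phi> r - \<phi> x) \<le> e" if "min x y < r" "r < max x y" for r
      using d(2)[of r] that y by (auto simp: dist_norm min_def max_def split: if_splits)
    show "norm (bint (leb a y) \<phi> - bint (leb a x) \<phi> - (y - x) *\<^sub>R \<phi> x) \<le> e * norm (y - x)"
    proof (cases "x \<le> y")
      case True
      have "norm (bint (leb x y) \<phi> - (y - x) *\<^sub>R \<phi> x) \<le> e * (y - x)"
        by (rule bint_leb_mean[OF c True]) (use near True e in auto)
      then show ?thesis using bint_leb_split[OF c ax True] True by simp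
    next
      case False
      then have yx: "y \<le> x" by simp
      have "norm (bint (leb y x) \<phi> - (x - y) *\<^sub>R \<phi> x) \<le> e * (x - y)"
        by (rule bint_leb_mean[OF c yx]) (use near False e in auto)
      moreover have "bint (leb a y) \<phi> - bint (leb a x) \<phi> - (y - x) *\<^sub>R \<phi> x
         = - (bint (leb y x) \<phi> - (x - y) *\<^sub>R \<phi> x)"
        using bint_leb_split[OF c _ yx, of a] y by (simp add: algebra_simps)
      ultimately show ?thesis using yx by (simp only: norm_minus_cancel) simp
    qed
  qed
qed

lemma bint_leb_at:
  fixes \<phi> :: "real \<Rightarrow> 'b::banach"
  assumes c: "continuous_on UNIV \<phi>" "\<And>r. norm (\<phi> r) \<le> C" and ax: "a < x"
  shows "((\<lambda>x. bint (leb a x) \<phi>) has_vector_derivative \<phi> x) (at x)"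
proof -
  have "((\<lambda>x. bint (leb a x) \<phi>) has_vector_derivative \<phi> x) (at x within {a<..})"
    by (rule has_vector_derivative_within_subset[OF bint_leb_has_derivative[OF c]]) (use ax in auto)
  then show ?thesis using at_within_open[of x "{a<..}"] ax by simp
qed

text \<open>By \<open>bint_leb_has_derivative\<close> the left-hand side is an increment of an antiderivative of \<open>\<phi>\<close>, and so is the right-hand
  side; both increments equal the Henstock--Kurzweil integral of \<open>\<phi>\<close>.\<close>

lemma bint_leb_FTC:
  fixes \<phi> G :: "real \<Rightarrow> 'b::banach"
  assumes c: "continuous_on UNIV \<phi>" "\<And>r. norm (\<phi> r) \<le> C" and ab: "a \<le> b"
    and G: "continuous_on {a..b} G" "\<And>x. a < x \<Longrightarrow> x < b \<Longrightarrow> (G has_vector_derivative \<phi> x) (at x)"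
  shows "bint (leb a b) \<phi> = G b - G a"
proof -
  have 1: "(\<phi> has_integral (bint (leb a b) \<phi> - bint (leb a a) \<phi>)) {a..b}"
  proof (rule fundamental_theorem_of_calculus[OF ab])
    fix x assume "x \<in> {a..b}"
    then show "((\<lambda>x. bint (leb a x) \<phi>) has_vector_derivative \<phi> x) (at x within {a..b})"
      by (intro has_vector_derivative_within_subset[OF bint_leb_has_derivative[OF c]]) auto
  qed
  have 2: "(\<phi> has_integral (G b - G a)) {a..b}"
    by (rule fundamental_theorem_of_calculus_interior[OF ab G(1)]) (use G(2) in auto)
  have "bint (leb a a) \<phi> = 0"
    by (rule bint_null[OF c finite_leb sets_leb]) (simp add: emeasure_leb_UNIV)
  then show ?thesis using has_integral_unique[OF 1 2] by simp
qed

lemma bint_leb_continuous: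
  fixes \<phi> :: "real \<Rightarrow> 'b::banach"
  assumes c: "continuous_on UNIV \<phi>" "\<And>r. norm (\<phi> r) \<le> C"
  shows "continuous_on {a..} (\<lambda>x. bint (leb a x) \<phi>)"
  unfolding continuous_on_eq_continuous_within
  using bint_leb_has_derivative[OF c] has_vector_derivative_continuous by (metis atLeast_iff)

lemma nn_integral_leb: "g \<in> borel_measurable borel \<Longrightarrow> (\<integral>\<^sup>+s. g s \<partial>leb a b) = (\<integral>\<^sup>+s. g s * indicator {a<..<b} s \<partial>lborel)"
  unfolding leb_def by (subst nn_integral_density) (auto simp: mult.commute)

lemma has_vector_derivative_iff_quotient:
  fixes g :: "real \<Rightarrow> 'b::real_normed_vector"
  shows "(g has_vector_derivative y) (at t) \<longleftrightarrow> ((\<lambda>h. (g (t + h) - g t) /\<^sub>R h) \<longlongrightarrow> y) (at 0)"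
proof -
  have "(g has_vector_derivative y) (at t) \<longleftrightarrow> ((\<lambda>h. norm (g (t + h) - g t - h *\<^sub>R y) / norm h) \<longlongrightarrow> 0) (at 0)"
    unfolding has_vector_derivative_def has_derivative_at by (simp add: bounded_linear_scaleR_left)
  also have "\<dots> \<longleftrightarrow> ((\<lambda>h. norm ((g (t + h) - g t) /\<^sub>R h - y)) \<longlongrightarrow> 0) (at 0)"
  proof (rule filterlim_cong[OF refl refl])
    show "\<forall>\<^sub>F h in at 0. norm (g (t + h) - g t - h *\<^sub>R y) / norm h = norm ((g (t + h) - g t) /\<^sub>R h - y)"
      unfolding eventually_at_filter
    proof (rule always_eventually, intro allI impI)
      fix h :: real assume h: "h \<noteq> 0"
      have "(g (t + h) - g t) /\<^sub>R h - y = (g (t + h) - g t - h *\<^sub>R y) /\<^sub>R h"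
        using h by (simp add: scaleR_diff_right)
      then show "norm (g (t + h) - g t - h *\<^sub>R y) / norm h = norm ((g (t + h) - g t) /\<^sub>R h - y)"
        by (simp only: norm_scaleR) (simp add: divide_inverse_commute)
    qed
  qed
  also have "\<dots> \<longleftrightarrow> ((\<lambda>h. (g (t + h) - g t) /\<^sub>R h) \<longlongrightarrow> y) (at 0)"
    using LIM_zero_iff[of "\<lambda>h. (g (t + h) - g t) /\<^sub>R h" y "at 0"] by (simp add: tendsto_norm_zero_iff)
  finally show ?thesis .
qed

lemma continuous_on_uniform_approx:
  fixes f :: "'a::metric_space \<Rightarrow> 'b::metric_space"
  assumes "\<And>\<epsilon>. \<epsilon> > 0 \<Longrightarrow> \<exists>g. continuous_on A g \<and> (\<forall>x\<in>A. dist (g x) (f x) \<le> \<epsilon>)"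
  shows "continuous_on A f"
  unfolding continuous_on_iff
proof (intro ballI allI impI)
  fix x and \<epsilon> :: real assume x: "x \<in> A" and e: "\<epsilon> > 0"
  obtain g where g: "continuous_on A g" "\<And>x. x \<in> A \<Longrightarrow> dist (g x) (f x) \<le> \<epsilon> / 4"
    using assms[of "\<epsilon> / 4"] e by auto
  obtain d where d: "d > 0" "\<And>y. y \<in> A \<Longrightarrow> dist y x < d \<Longrightarrow> dist (g y) (g x) < \<epsilon> / 4"
    using g(1)[unfolded continuous_on_iff, rule_format, OF x, of "\<epsilon> / 4"] e by auto
  show "\<exists>d>0. \<forall>x'\<in>A. dist x' x < d \<longrightarrow> dist (f x') (f x) < \<epsilon>"
  proof (intro exI[of _ d] conjI ballI impI d(1))
    fix y assume y: "y \<in> A" "dist y x < d"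
    have "dist (f y) (f x) \<le> dist (g y) (f y) + dist (g y) (g x) + dist (g x) (f x)"
      using dist_triangle[of "f y" "f x" "g y"] dist_triangle[of "g y" "f x" "g x"] by (simp add: dist_commute)
    also have "\<dots> < \<epsilon>" using g(2)[OF y(1)] g(2)[OF x] d(2)[OF y] e by simp
    finally show "dist (f y) (f x) < \<epsilon>" .
  qed
qed

section \<open>The tail of the Levy measure\<close>

locale levy_characteristics =
  fixes \<kappa> :: real and \<mu> :: "real measure"
  assumes kappa_nonneg: "\<kappa> \<ge> 0"
    and sets_levy: "sets \<mu> = sets (restrict_space borel {0<..})"
    and infinite_activity: "emeasure \<mu> {0<..} = \<infinity>"
    and integrable_min: "(\<integral>\<^sup>+x. ennreal (min 1 x) \<partial>\<mu>) < \<infinity>"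
begin

abbreviation w :: "real \<Rightarrow> real" where "w \<equiv> levy_tail \<mu>"
abbreviation \<Phi> :: "real \<Rightarrow> real" where "\<Phi> \<equiv> laplace_exponent \<kappa> \<mu>"

lemma Union_greaterThan_inverse: "(\<Union>n::nat. {inverse (real (Suc n))<..}) = {0<..}"
proof (intro set_eqI iffI)
  fix x :: real assume "x \<in> (\<Union>n::nat. {inverse (real (Suc n))<..})"
  then obtain n :: nat where "inverse (real (Suc n)) < x" by blast
  moreover have "0 < inverse (real (Suc n))" by simp
  ultimately show "x \<in> {0<..}" by (metis greaterThan_iff less_trans)
next
  fix x :: real assume "x \<in> {0<..}"
  then show "x \<in> (\<Union>n::nat. {inverse (real (Suc n))<..})" using reals_Archimedean[of x] by auto
qed

lemma space_levy: "space \<mu> = {0<..}"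
  using sets_eq_imp_space_eq[OF sets_levy] by (simp add: space_restrict_space)

lemma borel_measurable_levy: "g \<in> borel_measurable borel \<Longrightarrow> g \<in> borel_measurable \<mu>"
  unfolding measurable_cong_sets[OF sets_levy refl] by (rule measurable_restrict_space1)

lemma tail_in_sets: "x \<ge> 0 \<Longrightarrow> {x<..} \<in> sets \<mu>"
  unfolding sets_levy by (auto simp: sets_restrict_space intro!: image_eqI[of _ _ "{x<..}"])

lemma emeasure_tail_finite:
  assumes "x > 0" shows "emeasure \<mu> {x<..} < \<infinity>"
proof -
  have "ennreal (min 1 x) * emeasure \<mu> {x<..} = (\<integral>\<^sup>+y. ennreal (min 1 x) * indicator {x<..} y \<partial>\<mu>)"
    using assms by (simp add: nn_integral_cmult_indicator tail_in_sets)
  also have "\<dots> \<le> (\<integral>\<^sup>+y. ennreal (min 1 y) \<partial>\<mu>)"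
    by (intro nn_integral_mono) (auto simp: indicator_def intro!: ennreal_leI)
  also note integrable_min
  finally show ?thesis using assms by (auto simp: ennreal_mult_less_top)
qed

lemma emeasure_tail: "x > 0 \<Longrightarrow> emeasure \<mu> {x<..} = ennreal (w x)"
  unfolding levy_tail_def using emeasure_tail_finite[of x] by (simp add: emeasure_eq_ennreal_measure)

lemma w_nonneg: "w x \<ge> 0"
  by (simp add: levy_tail_def)

text \<open>For \<open>x = 0\<close> the measure of an infinite set is \<open>0\<close> by convention, and for \<open>x < 0\<close> the set is not measurable. So \<open>w\<close>
  carries its own restriction to the positive half-line, and convolutions with \<open>w\<close> may be written as integrals over the
  whole line.\<close>

lemma w_nonpos_arg: "x \<le> 0 \<Longrightarrow> w x = 0"
proof (cases "x = 0")
  case True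
  then show ?thesis using infinite_activity by (simp add: levy_tail_def measure_def)
next
  case False
  assume "x \<le> 0"
  then have "{x<..} \<notin> sets \<mu>" using False sets.sets_into_space[of "{x<..}" \<mu>] unfolding space_levy
    by (metis greaterThan_iff linorder_not_less order_le_less subset_eq)
  then show ?thesis by (simp add: levy_tail_def measure_notin_sets)
qed

lemma w_antimono: "0 < x \<Longrightarrow> x \<le> y \<Longrightarrow> w y \<le> w x"
  unfolding levy_tail_def using emeasure_tail_finite[of x]
  by (intro measure_mono_fmeasurable) (auto simp: tail_in_sets fmeasurable_def)

lemma w_measurable [measurable]: "w \<in> borel_measurable borel"
proof -
  have "(\<lambda>x. - w x) \<in> borel_measurable (restrict_space borel {0<..})"
    by (rule borel_measurable_mono_on_fnc) (auto simp: mono_on_def w_antimono)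
  then have "(\<lambda>x. indicator {0<..} x *\<^sub>R (- w x)) \<in> borel_measurable borel"
    by (subst (asm) borel_measurable_restrict_space_iff) (auto simp: mult.commute)
  then have "(\<lambda>x. - (indicator {0<..} x *\<^sub>R (- w x))) \<in> borel_measurable borel" by measurable
  also have "(\<lambda>x. - (indicator {0<..} x *\<^sub>R (- w x))) = w"
  proof
    fix x show "- (indicator {0<..} x *\<^sub>R (- w x)) = w x"
      by (cases "x > 0") (simp_all add: w_nonpos_arg)
  qed
  finally show ?thesis .
qed

lemma sigma_finite_levy: "sigma_finite_measure \<mu>"
proof (rule sigma_finite_measure.intro, intro exI conjI)
  show "countable (range (\<lambda>n::nat. {inverse (real (Suc n))<..} :: real set))" by simp
  show "range (\<lambda>n::nat. {inverse (real (Suc n))<..}) \<subseteq> sets \<mu>" by (auto intro!: tail_in_sets)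
  show "\<Union> (range (\<lambda>n::nat. {inverse (real (Suc n))<..})) = space \<mu>"
    by (simp only: space_levy Union_greaterThan_inverse)
  show "\<forall>a\<in>range (\<lambda>n::nat. {inverse (real (Suc n))<..}). emeasure \<mu> a \<noteq> \<infinity>"
  proof
    fix a assume "a \<in> range (\<lambda>n::nat. {inverse (real (Suc n))<..})"
    then obtain n :: nat where "a = {inverse (real (Suc n))<..}" by blast
    then show "emeasure \<mu> a \<noteq> \<infinity>" using emeasure_tail_finite[of "inverse (real (Suc n))"] by simp
  qed
qed

lemma w_unbounded: "\<exists>h>0. w h > K"
proof (rule ccontr)
  assume "\<not> ?thesis"
  then have le: "w h \<le> K" if "h > 0" for h using that by (meson not_less)
  have "(\<lambda>n::nat. emeasure \<mu> {inverse (real (Suc n))<..}) \<longlonglongrightarrow> emeasure \<mu> (\<Union>n::nat. {inverse (real (Suc n))<..})"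
    by (rule Lim_emeasure_incseq) (auto intro!: tail_in_sets simp: incseq_def intro: le_less_trans[OF le_imp_inverse_le])
  also note Union_greaterThan_inverse
  finally have "emeasure \<mu> {0<..} \<le> ennreal K"
    by (rule LIMSEQ_le_const2) (auto simp: emeasure_tail intro!: ennreal_leI le)
  then show False using infinite_activity by (simp add: top_unique)
qed

lemma one_minus_exp_le: "l > 0 \<Longrightarrow> x > 0 \<Longrightarrow> 1 - exp (- l * x) \<le> max 1 l * min 1 (x::real)"
proof -
  assume l: "l > 0" "x > 0"
  have "1 - exp (- l * x) \<le> l * x" using exp_ge_add_one_self[of "- l * x"] by simp
  also have "\<dots> \<le> max 1 l * x" using l by (intro mult_right_mono) auto
  finally have 1: "1 - exp (- l * x) \<le> max 1 l * x" .
  have 2: "1 - exp (- l * x) \<le> max 1 l" by (simp add: le_max_iff_disj)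
  show ?thesis using 1 2 by (auto simp: min_def)
qed

lemma nn_integral_one_minus_exp:
  assumes l: "l > 0"
  shows "(\<integral>\<^sup>+x. ennreal (1 - exp (- l * x)) \<partial>\<mu>) = ennreal (\<Phi> l - \<kappa> * l)"
proof -
  have [measurable]: "(\<lambda>x. 1 - exp (- l * x)) \<in> borel_measurable \<mu>" "(\<lambda>x. ennreal (min 1 x)) \<in> borel_measurable \<mu>"
    by (auto intro!: borel_measurable_levy)
  have "(\<integral>\<^sup>+x. ennreal (1 - exp (- l * x)) \<partial>\<mu>) \<le> (\<integral>\<^sup>+x. ennreal (max 1 l) * ennreal (min 1 x) \<partial>\<mu>)"
    using l by (intro nn_integral_mono)
      (auto simp: space_levy one_minus_exp_le simp flip: ennreal_mult intro!: ennreal_leI one_minus_exp_le[OF l, simplified])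
  also have "\<dots> < \<infinity>" using integrable_min by (simp add: nn_integral_cmult ennreal_mult_less_top)
  finally have "(\<integral>\<^sup>+x. ennreal (1 - exp (- l * x)) \<partial>\<mu>) < \<infinity>" .
  moreover have nn: "AE x in \<mu>. 0 \<le> 1 - exp (- l * x)"
    using l by (auto intro!: AE_I2 simp: space_levy)
  ultimately have "integrable \<mu> (\<lambda>x. 1 - exp (- l * x))"
    by (intro integrableI_nonneg) (simp_all only: infinity_ennreal_def, measurable)
  then show ?thesis using nn by (simp add: nn_integral_eq_integral laplace_exponent_def)
qed

lemma nn_integral_exp_Ioo:
  assumes l: "l > 0" and x: "x \<ge> 0"
  shows "(\<integral>\<^sup>+s. ennreal (exp (- l * s)) * indicator {0<..<x} s \<partial>lborel) = ennreal ((1 - exp (- l * x)) / l)"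
proof -
  have "(\<integral>\<^sup>+s. ennreal (exp (- l * s)) * indicator {0<..<x} s \<partial>lborel)
      = (\<integral>\<^sup>+s. ennreal (exp (- l * s)) * indicator {0..x} s \<partial>lborel)"
  proof (rule nn_integral_cong_AE)
    have "AE s in lborel. s \<noteq> 0 \<and> s \<noteq> x" using AE_lborel_singleton[of 0] AE_lborel_singleton[of x] by auto
    then show "AE s in lborel. ennreal (exp (- l * s)) * indicator {0<..<x} s = ennreal (exp (- l * s)) * indicator {0..x} s"
      by eventually_elim (auto simp: indicator_def)
  qed
  also have "\<dots> = ennreal (- exp (- l * x) / l - (- exp (- l * 0) / l))"
  proof (rule nn_integral_FTC_Icc)
    fix s :: real assume "s \<in> {0..x}"
    show "DERIV (\<lambda>s. - exp (- l * s) / l) s :> exp (- l * s)"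
      using l by (auto intro!: derivative_eq_intros)
  qed (use x in auto)
  also have "\<dots> = ennreal ((1 - exp (- l * x)) / l)" by (simp add: diff_divide_distrib)
  finally show ?thesis .
qed

text \<open>Tonelli: the factor \<open>(1 - exp (- l x)) / l\<close> is the integral of \<open>exp (- l s)\<close> over \<open>0 < s < x\<close>.\<close>

lemma laplace_w:
  assumes l: "l > 0"
  shows "(\<integral>\<^sup>+s. ennreal (exp (- l * s) * w s) \<partial>lborel) = ennreal ((\<Phi> l - \<kappa> * l) / l)"
proof -
  interpret \<mu>: sigma_finite_measure \<mu> by (rule sigma_finite_levy)
  interpret P: pair_sigma_finite lborel \<mu> ..
  have [measurable_cong]: "sets \<mu> = sets (restrict_space borel {0<..})" by (rule sets_levy)
  have id[measurable]: "(\<lambda>x. x) \<in> measurable \<mu> borel" by (intro borel_measurable_levy) simp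
  have m: "(\<lambda>(s, x). ennreal (exp (- l * s)) * indicator {0<..<x} s) \<in> borel_measurable (lborel \<Otimes>\<^sub>M \<mu>)"
  proof -
    have "snd \<in> measurable (lborel \<Otimes>\<^sub>M \<mu>) borel" using measurable_compose[OF measurable_snd id] by simp
    then have [measurable]: "Measurable.pred (lborel \<Otimes>\<^sub>M \<mu>) (\<lambda>p. 0 < fst p \<and> fst p < snd p)" by measurable
    have "(\<lambda>p. ennreal (exp (- l * fst p)) * (if 0 < fst p \<and> fst p < snd p then 1 else 0)) \<in> borel_measurable (lborel \<Otimes>\<^sub>M \<mu>)"
      by measurable
    then show ?thesis by (rule measurable_cong[THEN iffD1, rotated]) (auto simp: indicator_def)
  qed
  have "(\<integral>\<^sup>+s. ennreal (exp (- l * s) * w s) \<partial>lborel) =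
     (\<integral>\<^sup>+s. \<integral>\<^sup>+x. ennreal (exp (- l * s)) * indicator {0<..<x} s \<partial>\<mu> \<partial>lborel)"
  proof (rule nn_integral_cong)
    fix s :: real
    show "ennreal (exp (- l * s) * w s) = (\<integral>\<^sup>+x. ennreal (exp (- l * s)) * indicator {0<..<x} s \<partial>\<mu>)"
    proof (cases "s > 0")
      case True
      have "(\<integral>\<^sup>+x. ennreal (exp (- l * s)) * indicator {0<..<x} s \<partial>\<mu>) = (\<integral>\<^sup>+x. ennreal (exp (- l * s)) * indicator {s<..} x \<partial>\<mu>)"
        using True by (intro nn_integral_cong) (auto simp: indicator_def)
      also have "\<dots> = ennreal (exp (- l * s)) * ennreal (w s)"
        using True by (simp add: nn_integral_cmult_indicator tail_in_sets emeasure_tail)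
      finally show ?thesis by (simp add: ennreal_mult w_nonneg)
    qed (simp add: w_nonpos_arg)
  qed
  also have "\<dots> = (\<integral>\<^sup>+x. \<integral>\<^sup>+s. ennreal (exp (- l * s)) * indicator {0<..<x} s \<partial>lborel \<partial>\<mu>)"
    using P.Fubini'[OF m] by simp
  also have "\<dots> = (\<integral>\<^sup>+x. ennreal (1 / l) * ennreal (1 - exp (- l * x)) \<partial>\<mu>)"
  proof (rule nn_integral_cong)
    fix x assume "x \<in> space \<mu>"
    then have "0 \<le> x" by (simp add: space_levy)
    from nn_integral_exp_Ioo[OF l this] l
    show "(\<integral>\<^sup>+s. ennreal (exp (- l * s)) * indicator {0<..<x} s \<partial>lborel) = ennreal (1 / l) * ennreal (1 - exp (- l * x))"
      by (simp flip: ennreal_mult')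
  qed
  also have "\<dots> = ennreal (1 / l) * ennreal (\<Phi> l - \<kappa> * l)"
    by (subst nn_integral_cmult) (auto intro!: borel_measurable_levy simp: nn_integral_one_minus_exp[OF l, simplified])
  also have "\<dots> = ennreal ((\<Phi> l - \<kappa> * l) / l)"
    using l by (simp flip: ennreal_mult')
  finally show ?thesis .
qed

lemma laplace_exponent_ge: "l > 0 \<Longrightarrow> \<kappa> * l \<le> \<Phi> l"
  unfolding laplace_exponent_def
  by (auto intro!: Bochner_Integration.integral_nonneg_AE AE_I2 simp: space_levy)

text \<open>Positivity is what later makes \<open>\<Phi> l\<close> a point of the resolvent set of a bounded semigroup.\<close>

lemma laplace_exponent_pos:
  assumes l: "l > 0" shows "\<Phi> l > 0"
proof -
  obtain h where h: "h > 0" "w h > 0" using w_unbounded[of 0] by blast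
  have "0 < ennreal (exp (- l * h) * w h) * emeasure lborel {0<..<h}"
    using h by (simp add: ennreal_zero_less_mult_iff)
  also have "\<dots> = (\<integral>\<^sup>+s. ennreal (exp (- l * h) * w h) * indicator {0<..<h} s \<partial>lborel)"
    by (simp add: nn_integral_cmult_indicator)
  also have "\<dots> \<le> (\<integral>\<^sup>+s. ennreal (exp (- l * s) * w s) \<partial>lborel)"
    using l by (intro nn_integral_mono)
       (auto simp: indicator_def w_nonneg intro!: ennreal_leI mult_mono w_antimono)
  also have "\<dots> = ennreal ((\<Phi> l - \<kappa> * l) / l)" by (rule laplace_w[OF l])
  finally have "0 < \<Phi> l - \<kappa> * l" using l by (simp add: zero_less_divide_iff)
  then show ?thesis using kappa_nonneg l by (simp add: add_strict_increasing2 le_less_trans[of 0 "\<kappa> * l"])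
qed

lemma nn_integral_w_Ioo_finite: "(\<integral>\<^sup>+s. ennreal (w s) * indicator {0<..<t} s \<partial>lborel) < \<infinity>"
proof -
  have "(\<integral>\<^sup>+s. ennreal (w s) * indicator {0<..<t} s \<partial>lborel) \<le> (\<integral>\<^sup>+s. ennreal (exp t) * ennreal (exp (- 1 * s) * w s) \<partial>lborel)"
  proof (rule nn_integral_mono)
    fix s
    have "w s \<le> (exp t * exp (- 1 * s)) * w s" if "s < t"
      using that w_nonneg[of s] mult_right_mono[of 1 "exp t * exp (- 1 * s)" "w s"] by (simp flip: exp_add)
    then show "ennreal (w s) * indicator {0<..<t} s \<le> ennreal (exp t) * ennreal (exp (- 1 * s) * w s)"
      by (auto simp: indicator_def w_nonneg mult.assoc simp flip: ennreal_mult intro!: ennreal_leI)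
  qed
  also have "\<dots> < \<infinity>"
    using laplace_w[of 1] by (simp add: nn_integral_cmult ennreal_mult_less_top)
  finally show ?thesis .
qed

end

section \<open>The subordinator and its inverse\<close>

locale subordinator_setting = levy_characteristics +
  fixes M :: "'w measure" and S :: "real \<Rightarrow> 'w \<Rightarrow> real"
  assumes subordinator: "subordinator M \<kappa> \<mu> S"
begin

sublocale prob_space M
  using subordinator unfolding subordinator_def levy_process_def by blast

lemma S_measurable: "t \<ge> 0 \<Longrightarrow> S t \<in> borel_measurable M"
  using subordinator unfolding subordinator_def levy_process_def by simp

text \<open>Negative levels are identified with level \<open>0\<close>, so that \<open>F\<close> is monotone in each variable on the whole plane.\<close>

definition F :: "real \<Rightarrow> real \<Rightarrow> real" where
  "F r t = prob {\<omega> \<in> space M. S (max 0 r) \<omega> \<le> t}"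

lemma F_set [measurable]: "{\<omega> \<in> space M. S (max 0 r) \<omega> \<le> t} \<in> events"
proof -
  have [measurable]: "S (max 0 r) \<in> borel_measurable M" by (rule S_measurable) simp
  show ?thesis by measurable
qed

lemma F_nonneg: "0 \<le> F r t" and F_le_1: "F r t \<le> 1"
  unfolding F_def by (rule measure_nonneg, rule prob_le_1)

lemma F_mono: "s \<le> t \<Longrightarrow> F r s \<le> F r t"
  unfolding F_def by (rule finite_measure_mono) auto

lemma F_eq_cdf: "F r t = cdf (distr M borel (S (max 0 r))) t"
proof -
  have [measurable]: "S (max 0 r) \<in> borel_measurable M" by (rule S_measurable) simp
  show ?thesis unfolding F_def cdf_def by (subst measure_distr) (auto intro!: arg_cong[where f=prob])
qed

lemma F_right_continuous: "continuous (at_right t) (F r)"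
proof -
  have [measurable]: "S (max 0 r) \<in> borel_measurable M" by (rule S_measurable) simp
  interpret D: real_distribution "distr M borel (S (max 0 r))" by (rule real_distribution_distr) simp
  have "F r = cdf (distr M borel (S (max 0 r)))" by (rule ext) (rule F_eq_cdf)
  then show ?thesis using D.cdf_is_right_cont by simp
qed

lemma S_nonneg_AE: "AE \<omega> in M. \<forall>t\<ge>0. 0 \<le> S t \<omega>"
  using subordinator unfolding subordinator_def by blast

lemma F_neg: "t < 0 \<Longrightarrow> F r t = 0"
  unfolding F_def using S_nonneg_AE
  by (subst prob_eq_0) (auto elim!: eventually_mono simp: not_le intro: less_le_trans)

lemma expectation_exp:
  assumes "t \<ge> 0" "l > 0"
  shows "(\<integral>\<^sup>+\<omega>. ennreal (exp (- l * S t \<omega>)) \<partial>M) = ennreal (exp (- t * \<Phi> l))"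
proof -
  have [measurable]: "S t \<in> borel_measurable M" by (rule S_measurable) fact
  have "integrable M (\<lambda>\<omega>. exp (- l * S t \<omega>))"
  proof (rule integrable_const_bound[where B=1])
    show "AE \<omega> in M. norm (exp (- l * S t \<omega>)) \<le> 1"
      using S_nonneg_AE by eventually_elim (use assms in simp)
  qed measurable
  moreover have "(\<integral>\<omega>. exp (- l * S t \<omega>) \<partial>M) = exp (- t * \<Phi> l)"
    using subordinator[unfolded subordinator_def, THEN conjunct2, THEN conjunct2] assms by simp
  ultimately show ?thesis by (subst nn_integral_eq_integral) auto
qed

text \<open>Markov's inequality for \<open>exp (- l \<cdot> S r)\<close>.\<close>

lemma F_le_exp:
  assumes "r \<ge> 0" "l > 0"
  shows "F r t \<le> exp (l * t - r * \<Phi> l)"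
proof -
  have [measurable]: "S r \<in> borel_measurable M" by (rule S_measurable) fact
  have "ennreal (F r t) = (\<integral>\<^sup>+\<omega>. indicator {\<omega> \<in> space M. S r \<omega> \<le> t} \<omega> \<partial>M)"
    using assms unfolding F_def by (simp add: emeasure_eq_measure max_def)
  also have "\<dots> \<le> (\<integral>\<^sup>+\<omega>. ennreal (exp (l * t)) * ennreal (exp (- l * S r \<omega>)) \<partial>M)"
    using assms by (intro nn_integral_mono) (auto simp: indicator_def simp flip: ennreal_mult exp_add)
  also have "\<dots> = ennreal (exp (l * t - r * \<Phi> l))"
    by (subst nn_integral_cmult, measurable)
       (simp only: expectation_exp[OF assms], simp flip: ennreal_mult exp_add)
  finally show ?thesis by simp
qed

lemma laplace_F:
  assumes "r \<ge> 0" "l > 0"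
  shows "(\<integral>\<^sup>+t. ennreal (exp (- l * t) * F r t) \<partial>lborel) = ennreal (exp (- r * \<Phi> l) / l)"
proof -
  interpret P: pair_sigma_finite lborel M ..
  have Sr[measurable]: "S r \<in> borel_measurable M" by (rule S_measurable) fact
  have "(\<integral>\<^sup>+t. ennreal (exp (- l * t) * F r t) \<partial>lborel)
     = (\<integral>\<^sup>+t. \<integral>\<^sup>+\<omega>. ennreal (exp (- l * t)) * indicator {S r \<omega>..} t \<partial>M \<partial>lborel)"
  proof (rule nn_integral_cong)
    fix t
    have "(\<integral>\<^sup>+\<omega>. ennreal (exp (- l * t)) * indicator {S r \<omega>..} t \<partial>M)
        = (\<integral>\<^sup>+\<omega>. ennreal (exp (- l * t)) * indicator {\<omega> \<in> space M. S r \<omega> \<le> t} \<omega> \<partial>M)"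
      by (rule nn_integral_cong) (auto simp: indicator_def)
    also have "\<dots> = ennreal (exp (- l * t) * F r t)"
      using assms by (simp add: nn_integral_cmult_indicator F_def emeasure_eq_measure ennreal_mult max_def)
    finally show "ennreal (exp (- l * t) * F r t) = (\<integral>\<^sup>+\<omega>. ennreal (exp (- l * t)) * indicator {S r \<omega>..} t \<partial>M)" ..
  qed
  also have "\<dots> = (\<integral>\<^sup>+\<omega>. \<integral>\<^sup>+t. ennreal (exp (- l * t)) * indicator {S r \<omega>..} t \<partial>lborel \<partial>M)"
  proof (rule P.Fubini'[symmetric])
    have "(\<lambda>p. ennreal (exp (- l * fst p)) * (if S r (snd p) \<le> fst p then 1 else 0)) \<in> borel_measurable (lborel \<Otimes>\<^sub>M M)"
      by measurable
    then show "(\<lambda>(t, \<omega>). ennreal (exp (- l * t)) * indicator {S r \<omega>..} t) \<in> borel_measurable (lborel \<Otimes>\<^sub>M M)"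
      by (rule measurable_cong[THEN iffD1, rotated]) (auto simp: indicator_def)
  qed
  also have "\<dots> = (\<integral>\<^sup>+\<omega>. ennreal (1 / l) * ennreal (exp (- l * S r \<omega>)) \<partial>M)"
  proof (rule nn_integral_cong)
    fix \<omega>
    have "(\<integral>\<^sup>+t. ennreal (exp (- l * t)) * indicator {S r \<omega>..} t \<partial>lborel) = ennreal (0 - (- exp (- l * S r \<omega>) / l))"
    proof (rule nn_integral_FTC_atLeast)
      show "DERIV (\<lambda>s. - exp (- l * s) / l) s :> exp (- l * s)" for s
        using assms by (auto intro!: derivative_eq_intros)
      show "((\<lambda>s. - exp (- l * s) / l) \<longlongrightarrow> 0) at_top"
        using assms by real_asymp
    qed auto
    then show "(\<integral>\<^sup>+t. ennreal (exp (- l * t)) * indicator {S r \<omega>..} t \<partial>lborel) = ennreal (1 / l) * ennreal (exp (- l * S r \<omega>))"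
      using assms by (simp flip: ennreal_mult')
  qed
  also have "\<dots> = ennreal (exp (- r * \<Phi> l) / l)"
    using assms by (subst nn_integral_cmult, measurable)
       (simp only: expectation_exp[OF assms], simp flip: ennreal_mult')
  finally show ?thesis .
qed

text \<open>The properties of a path that the inverse depends on. They hold almost surely, and from them
  the inverse can be compared with the path without further probability.\<close>

definition regular_path :: "'w \<Rightarrow> bool" where
  "regular_path \<omega> \<longleftrightarrow> S 0 \<omega> = 0 \<and> (\<forall>t\<ge>0. ((\<lambda>t. S t \<omega>) \<longlongrightarrow> S t \<omega>) (at_right t)) \<and>
     (\<forall>s t. 0 \<le> s \<and> s \<le> t \<longrightarrow> S s \<omega> \<le> S t \<omega>) \<and> (\<forall>K. \<exists>n::nat. S (real n) \<omega> > K)"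

lemma increment_nonneg_AE:
  assumes "s \<ge> 0" "t \<ge> 0"
  shows "AE \<omega> in M. S s \<omega> \<le> S (s + t) \<omega>"
proof -
  have [measurable]: "S s \<in> borel_measurable M" "S (s + t) \<in> borel_measurable M" "S t \<in> borel_measurable M"
    by (intro S_measurable; use assms in simp)+
  have "AE x in distr M borel (S t). 0 \<le> x"
    using S_nonneg_AE assms by (subst AE_distr_iff) (auto elim!: eventually_mono)
  also have "distr M borel (S t) = distr M borel (\<lambda>\<omega>. S (s + t) \<omega> - S s \<omega>)"
    using subordinator assms unfolding subordinator_def levy_process_def by simp
  finally show ?thesis by (subst (asm) AE_distr_iff) auto
qed

lemma unbounded_AE: "AE \<omega> in M. \<forall>K. \<exists>n::nat. S (real n) \<omega> > K"
proof -
  have "AE \<omega> in M. \<exists>n::nat. S (real n) \<omega> > real K" for K :: nat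
  proof -
    have [measurable]: "S (real n) \<in> borel_measurable M" for n :: nat by (rule S_measurable) simp
    have "prob {\<omega> \<in> space M. \<forall>n::nat. S (real n) \<omega> \<le> real K} \<le> 0"
    proof (rule LIMSEQ_le_const)
      have "0 < \<Phi> 1" by (rule laplace_exponent_pos) simp
      then show "(\<lambda>n::nat. exp (1 * real K - real n * \<Phi> 1)) \<longlonglongrightarrow> 0"
        by real_asymp
      show "\<exists>N. \<forall>n\<ge>N. prob {\<omega> \<in> space M. \<forall>n::nat. S (real n) \<omega> \<le> real K} \<le> exp (1 * real K - real n * \<Phi> 1)"
      proof (intro exI allI impI)
        fix n :: nat
        have "prob {\<omega> \<in> space M. \<forall>n::nat. S (real n) \<omega> \<le> real K} \<le> F (real n) (real K)"
          unfolding F_def by (rule finite_measure_mono) (auto simp: max_def)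
        also have "\<dots> \<le> exp (1 * real K - real n * \<Phi> 1)" by (rule F_le_exp) auto
        finally show "prob {\<omega> \<in> space M. \<forall>n::nat. S (real n) \<omega> \<le> real K} \<le> exp (1 * real K - real n * \<Phi> 1)" .
      qed
    qed
    then have "prob {\<omega> \<in> space M. \<forall>n::nat. S (real n) \<omega> \<le> real K} = 0"
      by (intro order_antisym measure_nonneg)
    then show ?thesis by (subst (asm) prob_eq_0) (auto simp: not_le)
  qed
  then have "AE \<omega> in M. \<forall>K::nat. \<exists>n::nat. S (real n) \<omega> > real K" by (subst AE_all_countable) blast
  then show ?thesis
  proof eventually_elim
    case (elim \<omega>)
    show ?case
    proof
      fix K :: real
      obtain k :: nat where "K < real k" using reals_Archimedean2 by blast
      moreover obtain n :: nat where "real k < S (real n) \<omega>" using elim by blast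
      ultimately show "\<exists>n::nat. K < S (real n) \<omega>" by (intro exI[of _ n]) simp
    qed
  qed
qed

text \<open>Increments are nonnegative almost surely because they have the law of some \<open>S t\<close>. This gives monotonicity along
  rational times, and right continuity extends it to all times.\<close>

lemma regular_path_AE: "AE \<omega> in M. regular_path \<omega>"
proof -
  have "AE \<omega> in M. \<forall>p::rat \<times> rat. 0 \<le> fst p \<and> 0 \<le> snd p \<longrightarrow>
      S (of_rat (fst p)) \<omega> \<le> S (of_rat (fst p) + of_rat (snd p)) \<omega>"
  proof (subst AE_all_countable, intro allI)
    fix p :: "rat \<times> rat"
    show "AE \<omega> in M. 0 \<le> fst p \<and> 0 \<le> snd p \<longrightarrow>
      S (of_rat (fst p)) \<omega> \<le> S (of_rat (fst p) + of_rat (snd p)) \<omega>"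
      by (cases "0 \<le> fst p \<and> 0 \<le> snd p") (simp_all add: increment_nonneg_AE)
  qed
  moreover have "AE \<omega> in M. S 0 \<omega> = 0" "AE \<omega> in M. cadlag (\<lambda>t. S t \<omega>)"
    using subordinator unfolding subordinator_def levy_process_def by simp_all
  ultimately show ?thesis using unbounded_AE
  proof eventually_elim
    case (elim \<omega>)
    have rc: "((\<lambda>t. S t \<omega>) \<longlongrightarrow> S t \<omega>) (at_right t)" if "t \<ge> 0" for t
      using elim(3) that unfolding cadlag_def by simp
    have rat: "S p \<omega> \<le> S q \<omega>" if pq: "p \<in> \<rat>" "q \<in> \<rat>" "0 \<le> p" "p \<le> q" for p q
    proof -
      obtain a b where ab: "p = of_rat a" "q = of_rat b" using pq(1,2) by (auto elim!: Rats_cases)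
      have "0 \<le> a" "0 \<le> b - a" using pq(3,4) ab by (simp_all add: of_rat_less_eq)
      with elim(1)[rule_format, of "(a, b - a)"] show ?thesis by (simp add: ab flip: of_rat_add)
    qed
    have mono: "S s \<omega> \<le> S t \<omega>" if st: "0 \<le> s" "s \<le> t" for s t
    proof (rule ccontr)
      assume "\<not> ?thesis"
      then obtain c where c: "S t \<omega> < c" "c < S s \<omega>" using dense[of "S t \<omega>" "S s \<omega>"] by auto
      have "s < t" using st c by (cases "s = t") auto
      obtain b where b: "b > s" "\<And>y. s < y \<Longrightarrow> y < b \<Longrightarrow> c < S y \<omega>"
        using order_tendstoD(1)[OF rc[OF st(1)] c(2)] by (auto simp: eventually_at_right_field)
      obtain d where d: "d > t" "\<And>y. t < y \<Longrightarrow> y < d \<Longrightarrow> S y \<omega> < c"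
        using order_tendstoD(2)[OF rc c(1)] st by (auto simp: eventually_at_right_field)
      obtain p where p: "p \<in> \<rat>" "s < p" "p < min b t" using Rats_dense_in_real[of s "min b t"] b \<open>s < t\<close> by auto
      obtain q where q: "q \<in> \<rat>" "t < q" "q < d" using Rats_dense_in_real[of t d] d by auto
      have "S p \<omega> \<le> S q \<omega>" using p q st by (intro rat) auto
      moreover have "c < S p \<omega>" using b(2) p by simp
      moreover have "S q \<omega> < c" using d(2) q by simp
      ultimately show False by simp
    qed
    show ?case unfolding regular_path_def using elim(2,4) rc mono by (intro conjI) simp_all
  qed
qed

lemma F_antimono:
  assumes "r \<le> r'" shows "F r' t \<le> F r t"
  unfolding F_def
proof (rule finite_measure_mono_AE)
  show "AE \<omega> in M. \<omega> \<in> {\<omega> \<in> space M. S (max 0 r') \<omega> \<le> t} \<longrightarrow> \<omega> \<in> {\<omega> \<in> space M. S (max 0 r) \<omega> \<le> t}"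
    using regular_path_AE
  proof eventually_elim
    case (elim \<omega>)
    have "S (max 0 r) \<omega> \<le> S (max 0 r') \<omega>" using elim assms unfolding regular_path_def by auto
    then show ?case by auto
  qed
qed (rule F_set)

text \<open>Joint measurability: \<open>F\<close> is monotone in its first argument and right continuous in the second, so it is the limit of
  its values at the next grid point on the right.\<close>

lemma F_measurable_pair [measurable]: "(\<lambda>p. F (fst p) (snd p)) \<in> borel_measurable (borel \<Otimes>\<^sub>M borel)"
proof (rule borel_measurable_LIMSEQ_real)
  fix n :: nat
  show "(\<lambda>p. F (fst p) (real_of_int (\<lfloor>real (Suc n) * snd p\<rfloor> + 1) / real (Suc n))) \<in> borel_measurable (borel \<Otimes>\<^sub>M borel)"
  proof (rule measurable_compose_countable[of "\<lambda>k p. F (fst p) (real_of_int (k + 1) / real (Suc n))" _ _ "\<lambda>p. \<lfloor>real (Suc n) * snd p\<rfloor>"])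
    fix k :: int
    have "(\<lambda>r. - F r (real_of_int (k + 1) / real (Suc n))) \<in> borel_measurable borel"
      by (rule borel_measurable_mono) (auto simp: mono_def F_antimono)
    then have [measurable]: "(\<lambda>r. F r (real_of_int (k + 1) / real (Suc n))) \<in> borel_measurable borel"
      by (subst (asm) borel_measurable_uminus_eq) 
    show "(\<lambda>p. F (fst p) (real_of_int (k + 1) / real (Suc n))) \<in> borel_measurable (borel \<Otimes>\<^sub>M borel)" by measurable
  qed measurable
next
  fix p :: "real \<times> real"
  let ?x = "\<lambda>n. real_of_int (\<lfloor>real (Suc n) * snd p\<rfloor> + 1) / real (Suc n)"
  have gt: "snd p < ?x n" for n
  proof -
    have "snd p = (real (Suc n) * snd p) / real (Suc n)" by simp
    also have "\<dots> < ?x n" by (rule divide_strict_right_mono) linarith+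
    finally show ?thesis .
  qed
  have le: "?x n \<le> snd p + inverse (real (Suc n))" for n
  proof -
    have "?x n \<le> (real (Suc n) * snd p + 1) / real (Suc n)" by (rule divide_right_mono) linarith+
    then show ?thesis by (simp add: add_divide_distrib inverse_eq_divide)
  qed
  have "?x \<longlonglongrightarrow> snd p"
  proof (rule tendsto_sandwich[OF _ _ tendsto_const])
    show "(\<lambda>n. snd p + inverse (real (Suc n))) \<longlonglongrightarrow> snd p"
      using tendsto_add[OF tendsto_const LIMSEQ_inverse_real_of_nat, of "snd p"] by simp
    show "\<forall>\<^sub>F n in sequentially. snd p \<le> ?x n" using gt by (intro always_eventually allI less_imp_le)
    show "\<forall>\<^sub>F n in sequentially. ?x n \<le> snd p + inverse (real (Suc n))" using le by (intro always_eventually allI)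
  qed
  then have "filterlim ?x (at_right (snd p)) sequentially"
  proof (rule tendsto_imp_filterlim_at_right)
    show "\<forall>\<^sub>F n in sequentially. snd p < ?x n" using gt by (intro always_eventually allI)
  qed
  then show "(\<lambda>n. F (fst p) (?x n)) \<longlonglongrightarrow> F (fst p) (snd p)"
    using F_right_continuous[of "snd p" "fst p"] unfolding continuous_within by (rule filterlim_compose[rotated])
qed

lemma F_measurable [measurable (raw)]:
  assumes "f \<in> borel_measurable N" "g \<in> borel_measurable N"
  shows "(\<lambda>x. F (f x) (g x)) \<in> borel_measurable N"
  using measurable_compose[OF measurable_Pair[OF assms] F_measurable_pair] by simp

subsection \<open>The law of the inverse\<close>

abbreviation E :: "real \<Rightarrow> 'w \<Rightarrow> real" where "E \<equiv> inverse_subordinator S"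

lemma regular_path_crossing:
  assumes "regular_path \<omega>" shows "\<exists>s>0. S s \<omega> > t"
proof -
  obtain n :: nat where "S (real n) \<omega> > t" using assms unfolding regular_path_def by blast
  moreover have "S (real n) \<omega> \<le> S (real n + 1) \<omega>" using assms unfolding regular_path_def by simp
  ultimately show ?thesis by (intro exI[of _ "real n + 1"]) auto
qed

lemma bdd_below_crossing: "bdd_below {s. s > 0 \<and> S s \<omega> > t}"
  by (rule bdd_belowI[of _ 0]) auto

lemma E_ge:
  assumes "regular_path \<omega>" "r \<ge> 0" "S r \<omega> \<le> t" shows "r \<le> E t \<omega>"
  unfolding inverse_subordinator_def
proof (rule cInf_greatest)
  show "{s. 0 < s \<and> t < S s \<omega>} \<noteq> {}" using regular_path_crossing[OF assms(1)] by blast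
  fix s assume s: "s \<in> {s. 0 < s \<and> t < S s \<omega>}"
  show "r \<le> s"
  proof (rule ccontr)
    assume "\<not> r \<le> s"
    then have "S s \<omega> \<le> S r \<omega>" using assms(1) s unfolding regular_path_def by auto
    then show False using s assms(3) by simp
  qed
qed

lemma E_greater:
  assumes n: "regular_path \<omega>" and r: "r \<ge> 0" "S r \<omega> < t" shows "r < E t \<omega>"
proof -
  have "((\<lambda>t. S t \<omega>) \<longlongrightarrow> S r \<omega>) (at_right r)" using n r unfolding regular_path_def by blast
  from order_tendstoD(2)[OF this r(2)] obtain b where b: "b > r" "\<And>y. r < y \<Longrightarrow> y < b \<Longrightarrow> S y \<omega> < t"
    by (auto simp: eventually_at_right_field)
  have "(r + b) / 2 \<le> E t \<omega>" using b r by (intro E_ge[OF n] less_imp_le[OF b(2)]) auto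
  moreover have "r < (r + b) / 2" using b by simp
  ultimately show ?thesis by simp
qed

lemma S_le_of_E_greater:
  assumes n: "regular_path \<omega>" and t: "t \<ge> 0" and r: "r \<ge> 0" "r < E t \<omega>" shows "S r \<omega> \<le> t"
proof (rule ccontr)
  assume *: "\<not> S r \<omega> \<le> t"
  then have "r \<noteq> 0" using n t unfolding regular_path_def by auto
  then have "E t \<omega> \<le> r"
    unfolding inverse_subordinator_def using * r by (intro cInf_lower bdd_below_crossing) auto
  with r show False by simp
qed

lemma E_nonneg: "regular_path \<omega> \<Longrightarrow> t \<ge> 0 \<Longrightarrow> 0 \<le> E t \<omega>"
  by (rule E_ge) (auto simp: regular_path_def)

lemma E_mono: "regular_path \<omega> \<Longrightarrow> s \<le> t \<Longrightarrow> E s \<omega> \<le> E t \<omega>"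
  unfolding inverse_subordinator_def
  by (rule cInf_superset_mono) (use regular_path_crossing[of \<omega> t] bdd_below_crossing[of s \<omega>] in auto)

lemma regular_path_AE_completion: "AE \<omega> in completion M. regular_path \<omega>"
  using regular_path_AE by (rule AE_completion)

text \<open>Outside a null set, \<open>E t < a\<close> holds iff the path exceeds \<open>t\<close> at some rational time below \<open>a\<close>. The exceptional
  set is only contained in a null set, which is why the completion appears.\<close>

lemma E_measurable: "E t \<in> borel_measurable (completion M)"
proof (rule borel_measurableI_less)
  fix a :: real
  let ?B = "\<Union>q\<in>{q\<in>\<rat>. 0 < q \<and> q < a}. {\<omega> \<in> space M. S q \<omega> > t}"
  have "?B \<in> sets M"
  proof (rule sets.countable_UN'')
    show "countable {q\<in>\<rat>. 0 < q \<and> q < a}" using countable_rat by (rule countable_subset[rotated]) auto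
    fix q assume "q \<in> {q\<in>\<rat>. 0 < q \<and> q < a}"
    then have [measurable]: "S q \<in> borel_measurable M" by (intro S_measurable) simp
    show "{\<omega> \<in> space M. S q \<omega> > t} \<in> sets M" by measurable
  qed
  then have B: "?B \<in> sets (completion M)" by (rule sets_completionI_sets)
  have "AE \<omega> in completion M. \<omega> \<in> {\<omega> \<in> space (completion M). E t \<omega> < a} \<longleftrightarrow> \<omega> \<in> ?B"
    using regular_path_AE_completion AE_space
  proof eventually_elim
    case (elim \<omega>)
    have "E t \<omega> < a \<longleftrightarrow> (\<exists>q\<in>\<rat>. 0 < q \<and> q < a \<and> S q \<omega> > t)"
    proof
      assume "E t \<omega> < a"
      then obtain s where s: "0 < s" "t < S s \<omega>" "s < a"
        unfolding inverse_subordinator_def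
        using cInf_less_iff[OF _ bdd_below_crossing, of t \<omega> a] regular_path_crossing[OF elim(1)] by auto
      obtain q where q: "q \<in> \<rat>" "s < q" "q < a" using Rats_dense_in_real[OF s(3)] by auto
      have "S s \<omega> \<le> S q \<omega>" using elim(1) s q unfolding regular_path_def by auto
      then show "\<exists>q\<in>\<rat>. 0 < q \<and> q < a \<and> S q \<omega> > t" using q s by (intro bexI[of _ q]) auto
    next
      assume "\<exists>q\<in>\<rat>. 0 < q \<and> q < a \<and> S q \<omega> > t"
      then obtain q where q: "0 < q" "q < a" "S q \<omega> > t" by auto
      have "E t \<omega> \<le> q" unfolding inverse_subordinator_def using q by (intro cInf_lower bdd_below_crossing) auto
      with q show "E t \<omega> < a" by simp
    qed
    then show ?case using elim(2) by auto
  qed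
  then show "{\<omega> \<in> space (completion M). E t \<omega> < a} \<in> sets (completion M)"
    by (intro completion.in_sets_AE[OF _ B]) (auto elim!: eventually_mono)
qed

definition nu :: "real \<Rightarrow> real measure" where
  "nu t = distr (completion M) borel (E t)"

lemma prob_space_nu: "prob_space (nu t)"
  unfolding nu_def by (rule prob_space.prob_space_distr[OF prob_space_completion E_measurable])

lemma sets_nu [simp, measurable_cong]: "sets (nu t) = sets borel"
  by (simp add: nu_def)

lemma measure_nu: "A \<in> sets borel \<Longrightarrow> measure (nu t) A = measure (completion M) {\<omega> \<in> space M. E t \<omega> \<in> A}"
  unfolding nu_def by (subst measure_distr[OF E_measurable]) (auto intro!: arg_cong[where f="measure (completion M)"])

lemma F_completion: "F r t = measure (completion M) {\<omega> \<in> space M. S (max 0 r) \<omega> \<le> t}"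
  unfolding F_def by (simp add: measure_completion)

lemma E_set: "A \<in> sets borel \<Longrightarrow> {\<omega> \<in> space M. E t \<omega> \<in> A} \<in> sets (completion M)"
  using measurable_sets[OF E_measurable, of A t] by (simp add: vimage_def Int_def conj_commute)

text \<open>The events \<open>E t > r\<close> and \<open>S r \<le> t\<close> agree up to \<open>S r = t\<close>. The next three bounds allow for this exception, which may have
  positive probability; they determine the tail of the law of \<open>E t\<close> for almost every level and for almost every time.\<close>

lemma nu_tail_le_F:
  assumes "t \<ge> 0" "r \<ge> 0" shows "measure (nu t) {r<..} \<le> F r t"
proof -
  interpret C: prob_space "completion M" by (rule prob_space_completion)
  show ?thesis
    unfolding measure_nu[OF borel_open[OF open_greaterThan]] F_completion
  proof (rule C.finite_measure_mono_AE)
    show "AE \<omega> in completion M. \<omega> \<in> {\<omega> \<in> space M. E t \<omega> \<in> {r<..}} \<longrightarrow> \<omega> \<in> {\<omega> \<in> space M. S (max 0 r) \<omega> \<le> t}"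
      using regular_path_AE_completion by eventually_elim (use assms S_le_of_E_greater in \<open>auto simp: max_def\<close>)
  qed (rule sets_completionI_sets[OF F_set])
qed

lemma F_le_nu_tail:
  assumes "r \<ge> 0" "t' < t" shows "F r t' \<le> measure (nu t) {r<..}"
proof -
  interpret C: prob_space "completion M" by (rule prob_space_completion)
  show ?thesis
    unfolding measure_nu[OF borel_open[OF open_greaterThan]] F_completion
  proof (rule C.finite_measure_mono_AE)
    show "AE \<omega> in completion M. \<omega> \<in> {\<omega> \<in> space M. S (max 0 r) \<omega> \<le> t'} \<longrightarrow> \<omega> \<in> {\<omega> \<in> space M. E t \<omega> \<in> {r<..}}"
      using regular_path_AE_completion by eventually_elim (use assms E_greater in \<open>auto simp: max_def\<close>)
  qed (rule E_set, simp)
qed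

lemma F_le_nu_atLeast:
  assumes "r \<ge> 0" shows "F r t \<le> measure (nu t) {r..}"
proof -
  interpret C: prob_space "completion M" by (rule prob_space_completion)
  show ?thesis
    unfolding measure_nu[OF borel_closed[OF closed_atLeast]] F_completion
  proof (rule C.finite_measure_mono_AE)
    show "AE \<omega> in completion M. \<omega> \<in> {\<omega> \<in> space M. S (max 0 r) \<omega> \<le> t} \<longrightarrow> \<omega> \<in> {\<omega> \<in> space M. E t \<omega> \<in> {r..}}"
      using regular_path_AE_completion by eventually_elim (use assms E_ge in \<open>auto simp: max_def\<close>)
  qed (rule E_set, simp)
qed

lemma nu_tail_mono:
  assumes "s \<le> t" shows "measure (nu s) {r<..} \<le> measure (nu t) {r<..}"
proof -
  interpret C: prob_space "completion M" by (rule prob_space_completion)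
  show ?thesis
    unfolding measure_nu[OF borel_open[OF open_greaterThan]]
  proof (rule C.finite_measure_mono_AE)
    show "AE \<omega> in completion M. \<omega> \<in> {\<omega> \<in> space M. E s \<omega> \<in> {r<..}} \<longrightarrow> \<omega> \<in> {\<omega> \<in> space M. E t \<omega> \<in> {r<..}}"
      using regular_path_AE_completion by eventually_elim (use assms E_mono in \<open>fastforce\<close>)
  qed (rule E_set, simp)
qed

lemma nu_nonneg_AE: "t \<ge> 0 \<Longrightarrow> AE s in nu t. 0 \<le> s"
  unfolding nu_def using regular_path_AE_completion
  by (subst AE_distr_iff[OF E_measurable]) (auto elim!: eventually_mono intro: E_nonneg)

lemma AE_countable_exception: "countable C \<Longrightarrow> AE x in lborel. x \<notin> (C :: real set)"
  using countable_imp_null_set_lborel[of C] by (rule AE_not_in)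

text \<open>The bounds differ by the mass of an atom of the law of \<open>E t\<close>, and a finite measure has countably many atoms.\<close>

lemma nu_tail_eq_F_AE_level:
  assumes "t \<ge> 0" shows "AE r in lborel. r > 0 \<longrightarrow> measure (nu t) {r<..} = F r t"
proof -
  interpret N: prob_space "nu t" by (rule prob_space_nu)
  have "countable {x. measure (nu t) {x} \<noteq> 0}" by (rule N.countable_support)
  from AE_countable_exception[OF this] show ?thesis
  proof eventually_elim
    case (elim r)
    show ?case
    proof
      assume r: "r > 0"
      have "measure (nu t) {r..} = measure (nu t) ({r} \<union> {r<..})" by (rule arg_cong[where f="measure (nu t)"]) auto
      also have "\<dots> = measure (nu t) {r} + measure (nu t) {r<..}" by (rule N.finite_measure_Union) auto
      also have "\<dots> = measure (nu t) {r<..}" using elim by simp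
      finally show "measure (nu t) {r<..} = F r t"
        using F_le_nu_atLeast[of r t] nu_tail_le_F[of t r] assms r by simp
    qed
  qed
qed

text \<open>The bounds differ by a jump of the monotone function \<open>F r\<close>, which has countably many.\<close>

lemma nu_tail_eq_F_AE_time:
  assumes "r \<ge> 0" shows "AE s in lborel. s > 0 \<longrightarrow> measure (nu s) {r<..} = F r s"
proof -
  have "countable {s. \<not> isCont (F r) s}" by (rule mono_ctble_discont) (simp add: mono_def F_mono)
  from AE_countable_exception[OF this] show ?thesis
  proof eventually_elim
    case (elim s)
    show ?case
    proof
      assume s: "s > 0"
      have "(F r \<longlongrightarrow> F r s) (at_left s)" using elim by (simp add: isCont_def filterlim_at_split)
      then have "F r s \<le> measure (nu s) {r<..}"
      proof (rule tendsto_upperbound)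
        show "\<forall>\<^sub>F x in at_left s. F r x \<le> measure (nu s) {r<..}"
          using eventually_at_left_real[of "s - 1" s] by (auto elim!: eventually_mono intro: F_le_nu_tail[OF assms])
      qed simp
      then show "measure (nu s) {r<..} = F r s" using nu_tail_le_F[of s r] s assms by simp
    qed
  qed
qed

lemma nu_kernel: "(\<lambda>s. nu s) \<in> borel \<rightarrow>\<^sub>M prob_algebra borel"
proof (rule measurable_prob_algebra_generated[where G="range greaterThan" and \<Omega>=UNIV])
  show "sets borel = sigma_sets UNIV (range (greaterThan :: real \<Rightarrow> real set))"
    by (simp add: borel_Ioi)
  show "Int_stable (range (greaterThan :: real \<Rightarrow> real set))"
  proof (rule Int_stableI_image)
    fix a b :: real
    show "\<exists>c\<in>UNIV. {a<..} \<inter> {b<..} = {c<..}" by (intro bexI[of _ "max a b"]) auto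
  qed
  fix A :: "real set" assume "A \<in> range greaterThan"
  then obtain r where r: "A = {r<..}" by blast
  interpret N: prob_space "nu t" for t by (rule prob_space_nu)
  have "(\<lambda>s. measure (nu s) {r<..}) \<in> borel_measurable borel"
    by (rule borel_measurable_mono) (auto simp: mono_def nu_tail_mono)
  then show "(\<lambda>s. emeasure (nu s) A) \<in> borel_measurable borel"
    unfolding r N.emeasure_eq_measure by measurable
qed (auto intro: prob_space_nu)

lemma nu_measurable: "A \<in> sets borel \<Longrightarrow> (\<lambda>s. emeasure (nu s) A) \<in> borel_measurable borel"
  using measurable_emeasure_kernel[OF measurable_prob_algebraD[OF nu_kernel]] by simp

end

section \<open>Uniqueness of Laplace transforms\<close>

definition laplace_measure :: "real \<Rightarrow> real measure" where
  "laplace_measure l = density lborel (\<lambda>t. ennreal (exp (- l * t)) * indicator {0<..} t)"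

lemma sets_laplace_measure [simp, measurable_cong]: "sets (laplace_measure l) = sets borel"
  by (simp add: laplace_measure_def)

lemma nn_integral_laplace_measure:
  "g \<in> borel_measurable borel \<Longrightarrow>
    (\<integral>\<^sup>+t. g t \<partial>laplace_measure l) = (\<integral>\<^sup>+t. ennreal (exp (- l * t)) * (indicator {0<..} t * g t) \<partial>lborel)"
  unfolding laplace_measure_def by (subst nn_integral_density) (auto simp: mult.assoc)

lemma emeasure_laplace_measure:
  assumes "A \<in> sets borel"
  shows "emeasure (laplace_measure l) A = (\<integral>\<^sup>+t. ennreal (exp (- l * t)) * indicator ({0<..} \<inter> A) t \<partial>lborel)"
  using assms unfolding laplace_measure_def by (subst emeasure_density) (auto simp: indicator_inter_arith mult.assoc)

lemma exp_integral_tail: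
  assumes "l > 0"
  shows "(\<integral>\<^sup>+t. ennreal (exp (- l * t)) * indicator {a<..} t \<partial>lborel) = ennreal (exp (- l * a) / l)"
proof -
  have "(\<integral>\<^sup>+t. ennreal (exp (- l * t)) * indicator {a<..} t \<partial>lborel) = (\<integral>\<^sup>+t. ennreal (exp (- l * t)) * indicator {a..} t \<partial>lborel)"
    using AE_lborel_singleton[of a] by (auto intro!: nn_integral_cong_AE simp: indicator_def elim!: eventually_mono)
  also have "\<dots> = ennreal (0 - (- exp (- l * a) / l))"
  proof (rule nn_integral_FTC_atLeast)
    show "DERIV (\<lambda>r. - exp (- l * r) / l) s :> exp (- l * s)" for s
      using assms by (auto intro!: derivative_eq_intros)
    show "((\<lambda>r. - exp (- l * r) / l) \<longlongrightarrow> 0) at_top" using assms by real_asymp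
  qed auto
  finally show ?thesis by simp
qed

lemma finite_laplace_measure:
  assumes "l > 0" shows "finite_measure (laplace_measure l)"
proof (rule finite_measureI)
  have "emeasure (laplace_measure l) UNIV = ennreal (exp (- l * 0) / l)"
    using exp_integral_tail[OF assms, of 0] emeasure_laplace_measure[of UNIV l] by simp
  then show "emeasure (laplace_measure l) (space (laplace_measure l)) \<noteq> \<infinity>" by (simp add: laplace_measure_def)
qed

abbreviation exp_measure :: "real measure" where
  "exp_measure \<equiv> laplace_measure 1"

lemma nn_integral_exp_measure:
  "g \<in> borel_measurable borel \<Longrightarrow>
    (\<integral>\<^sup>+t. g t \<partial>exp_measure) = (\<integral>\<^sup>+t. ennreal (exp (- t)) * indicator {0<..} t * g t \<partial>lborel)"
  using nn_integral_laplace_measure[of g 1] by (simp add: mult.assoc)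

lemma finite_exp_measure: "finite_measure exp_measure"
  by (rule finite_laplace_measure) simp

text \<open>By hypothesis \<open>v\<close> integrates to \<open>0\<close> against \<open>p (exp (- t))\<close> for every polynomial \<open>p\<close>. By Weierstrass the same holds
  for a tent function concentrated near \<open>exp (- t0)\<close>, and continuity at \<open>t0\<close> makes that integral
  almost a positive multiple of \<open>v t0\<close>.\<close>

lemma laplace_unique:
  fixes v :: "real \<Rightarrow> 'b::banach"
  assumes int: "\<And>n::nat. strong_integral exp_measure (\<lambda>t. exp (- t) ^ n *\<^sub>R v t) 0"
    and b: "b \<in> borel_measurable borel" "(\<integral>\<^sup>+t. b t \<partial>exp_measure) < \<infinity>" "\<And>t. ennreal (norm (v t)) \<le> b t"
    and neg: "\<And>t. t \<le> 0 \<Longrightarrow> v t = 0"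
    and t0: "t0 > 0" "isCont v t0"
  shows "v t0 = 0"
proof -
  obtain B where B: "B \<ge> 0" "(\<integral>\<^sup>+t. b t \<partial>exp_measure) = ennreal B"
    using b(2) by (cases "\<integral>\<^sup>+t. b t \<partial>exp_measure") auto
  define x0 where "x0 = exp (- t0)"
  have x0: "0 < x0" "x0 < 1" using t0 by (auto simp: x0_def)
  have "norm (v t0) \<le> 2 * \<epsilon>" if "\<epsilon> > 0" for \<epsilon>
  proof -
    obtain d where d: "d > 0" "\<And>t. dist t t0 < d \<Longrightarrow> dist (v t) (v t0) < \<epsilon>"
      using t0(2)[unfolded continuous_at_eps_delta, rule_format, OF \<open>\<epsilon> > 0\<close>] by auto
    have lnc: "isCont (\<lambda>x. - ln x) x0" using x0 by (intro continuous_intros) auto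
    have "0 < min d t0" using d(1) t0(1) by simp
    from lnc[unfolded continuous_at_eps_delta, rule_format, OF this]
    obtain e where e: "e > 0" "\<And>x. dist x x0 < e \<Longrightarrow> dist (- ln x) (- ln x0) < min d t0"
      by auto
    \<comment> \<open>\<open>e\<close> is so small that the tent lives on times within \<open>d\<close> of \<open>t0\<close>, and on positive times\<close>
    define \<psi> where "\<psi> x = max 0 (1 - \<bar>x - x0\<bar> / e)" for x :: real
    have psi_cont: "continuous_on A \<psi>" for A unfolding \<psi>_def using e(1) by (intro continuous_intros) auto
    have psi_m[measurable]: "\<psi> \<in> borel_measurable borel" by (rule borel_measurable_continuous_onI[OF psi_cont])
    have psi01: "0 \<le> \<psi> x" "\<psi> x \<le> 1" for x using e(1) by (auto simp: \<psi>_def)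
    have psi_supp: "\<psi> (exp (- t)) = 0 \<or> dist t t0 < min d t0" for t
    proof (cases "dist (exp (- t)) x0 < e")
      case True
      from e(2)[OF this] show ?thesis by (simp add: x0_def)
    next
      case False
      then have "1 \<le> \<bar>exp (- t) - x0\<bar> / e" using e(1) by (simp add: dist_real_def)
      then show ?thesis by (simp add: \<psi>_def)
    qed
    have neg_psi: "\<psi> (exp (- t)) = 0" if "t \<le> 0" for t
      using psi_supp[of t] that by (auto simp: dist_real_def)
    define c where "c = enn2real (\<integral>\<^sup>+t. ennreal (\<psi> (exp (- t))) \<partial>exp_measure)"
    have fin: "(\<integral>\<^sup>+t. ennreal (\<psi> (exp (- t))) \<partial>exp_measure) < \<infinity>"
    proof -
      have "(\<integral>\<^sup>+t. ennreal (\<psi> (exp (- t))) \<partial>exp_measure) \<le> (\<integral>\<^sup>+t. 1 \<partial>exp_measure)"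
        using psi01 by (intro nn_integral_mono) simp
      also have "\<dots> < \<infinity>" using finite_measure.emeasure_finite[OF finite_exp_measure, of UNIV]
        by (simp add: laplace_measure_def less_top[symmetric])
      finally show ?thesis .
    qed
    then have c: "(\<integral>\<^sup>+t. ennreal (\<psi> (exp (- t))) \<partial>exp_measure) = ennreal c" "c \<ge> 0"
      by (auto simp: c_def)
    have "0 < c"
    proof -
      have "ennreal (exp (- (t0 + e / 2)) / 2) * emeasure lborel {t0..t0 + e / 2}
        = (\<integral>\<^sup>+t. ennreal (exp (- (t0 + e / 2)) / 2) * indicator {t0..t0 + e / 2} t \<partial>lborel)"
        by (simp add: nn_integral_cmult_indicator)
      also have "\<dots> \<le> (\<integral>\<^sup>+t. ennreal (exp (- t)) * indicator {0<..} t * ennreal (\<psi> (exp (- t))) \<partial>lborel)"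
      proof (rule nn_integral_mono)
        fix t
        show "ennreal (exp (- (t0 + e / 2)) / 2) * indicator {t0..t0 + e / 2} t
           \<le> ennreal (exp (- t)) * indicator {0<..} t * ennreal (\<psi> (exp (- t)))"
        proof (cases "t \<in> {t0..t0 + e / 2}")
          case True
          have "exp (- t) = exp (- t0) * exp (- (t - t0))" by (simp flip: exp_add)
          moreover have "1 - (t - t0) \<le> exp (- (t - t0))" using exp_ge_add_one_self[of "- (t - t0)"] by linarith
          ultimately have "exp (- t0) - exp (- t) \<le> exp (- t0) * (t - t0)"
            using mult_left_mono[of "1 - (t - t0)" "exp (- (t - t0))" "exp (- t0)"] by (simp add: algebra_simps)
          also have "\<dots> \<le> 1 * (e / 2)" using True t0(1) by (intro mult_mono) auto
          finally have "\<bar>exp (- t) - x0\<bar> \<le> e / 2" using True by (simp add: x0_def abs_le_iff)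
          then have "\<psi> (exp (- t)) \<ge> 1 / 2" using e(1) by (simp add: \<psi>_def le_max_iff_disj field_simps)
          then have "exp (- (t0 + e / 2)) * (1 / 2) \<le> exp (- t) * \<psi> (exp (- t))"
            using True by (intro mult_mono) auto
          then show ?thesis using True t0 psi01 by (simp add: ennreal_leI flip: ennreal_mult)
        qed simp
      qed
      also have "\<dots> = ennreal c" using c(1) by (subst (asm) nn_integral_exp_measure) auto
      finally have "ennreal (exp (- (t0 + e / 2)) / 2 * (e / 2)) \<le> ennreal c"
        using e(1) by (simp flip: ennreal_mult)
      moreover have "0 < exp (- (t0 + e / 2)) / 2 * (e / 2)" using e(1) by simp
      ultimately show ?thesis using c(2) by (subst (asm) ennreal_le_iff) linarith+
    qed
    have psi_int: "has_bochner_integral exp_measure (\<lambda>t. \<psi> (exp (- t))) c"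
      by (rule has_bochner_integral_nn_integral) (use c psi01 in auto)
    \<comment> \<open>the tolerance makes the approximation error, integrated against \<open>b\<close>, at most \<open>\<epsilon> * c\<close>\<close>
    have "0 < \<epsilon> * c / (B + 1)" using \<open>\<epsilon> > 0\<close> \<open>c > 0\<close> B by simp
    from Stone_Weierstrass_real_polynomial_function[OF compact_Icc psi_cont this]
    obtain p where p: "real_polynomial_function p" "\<And>x. x \<in> {0..1} \<Longrightarrow> \<bar>\<psi> x - p x\<bar> < \<epsilon> * c / (B + 1)"
      by metis
    obtain a n where an: "p = (\<lambda>x. \<Sum>i\<le>n. a i * x ^ i)" using p(1) real_polynomial_function_iff_sum by metis
    have "strong_integral exp_measure (\<lambda>t. \<Sum>i\<le>n. a i *\<^sub>R (exp (- t) ^ i *\<^sub>R v t)) (\<Sum>i\<le>n. a i *\<^sub>R 0)"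
      by (intro strong_integral_sum strong_integral_bounded_linear[OF bounded_linear_scaleR_right] int) simp
    then have pint: "strong_integral exp_measure (\<lambda>t. p (exp (- t)) *\<^sub>R v t) 0"
      by (simp add: an scaleR_sum_left)
    have "ennreal (norm (0 - c *\<^sub>R v t0)) \<le> (\<integral>\<^sup>+t. ennreal (\<epsilon> * c / (B + 1)) * b t + ennreal \<epsilon> * ennreal (\<psi> (exp (- t))) \<partial>exp_measure)"
    proof (rule strong_integral_dist[OF pint strong_integral_scaleR_const[OF psi_int]])
      show "(\<lambda>t. ennreal (\<epsilon> * c / (B + 1)) * b t + ennreal \<epsilon> * ennreal (\<psi> (exp (- t)))) \<in> borel_measurable exp_measure"
        using b(1) by measurable
      fix t
      show "ennreal (norm (p (exp (- t)) *\<^sub>R v t - \<psi> (exp (- t)) *\<^sub>R v t0))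
         \<le> ennreal (\<epsilon> * c / (B + 1)) * b t + ennreal \<epsilon> * ennreal (\<psi> (exp (- t)))"
      proof (cases "t \<le> 0")
        case True
        then show ?thesis by (simp add: neg neg_psi)
      next
        case False
        have 1: "\<bar>p (exp (- t)) - \<psi> (exp (- t))\<bar> \<le> \<epsilon> * c / (B + 1)"
          using p(2)[of "exp (- t)"] False by (simp add: abs_minus_commute)
        have 2: "\<psi> (exp (- t)) * norm (v t - v t0) \<le> \<psi> (exp (- t)) * \<epsilon>"
          using psi_supp[of t]
        proof
          assume "dist t t0 < min d t0"
          then have "norm (v t - v t0) \<le> \<epsilon>" using d(2)[of t] by (simp add: dist_norm)
          then show ?thesis using psi01 by (intro mult_left_mono) auto
        qed simp
        have "p (exp (- t)) *\<^sub>R v t - \<psi> (exp (- t)) *\<^sub>R v t0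
          = (p (exp (- t)) - \<psi> (exp (- t))) *\<^sub>R v t + \<psi> (exp (- t)) *\<^sub>R (v t - v t0)"
          by (simp add: algebra_simps)
        then have "norm (p (exp (- t)) *\<^sub>R v t - \<psi> (exp (- t)) *\<^sub>R v t0)
          \<le> \<bar>p (exp (- t)) - \<psi> (exp (- t))\<bar> * norm (v t) + \<psi> (exp (- t)) * norm (v t - v t0)"
          using norm_triangle_ineq[of "(p (exp (- t)) - \<psi> (exp (- t))) *\<^sub>R v t" "\<psi> (exp (- t)) *\<^sub>R (v t - v t0)"] psi01
          by simp
        also have "\<dots> \<le> \<epsilon> * c / (B + 1) * norm (v t) + \<epsilon> * \<psi> (exp (- t))"
          using 1 2 by (intro add_mono mult_right_mono) (auto simp: mult.commute)
        finally have "ennreal (norm (p (exp (- t)) *\<^sub>R v t - \<psi> (exp (- t)) *\<^sub>R v t0))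
          \<le> ennreal (\<epsilon> * c / (B + 1)) * ennreal (norm (v t)) + ennreal \<epsilon> * ennreal (\<psi> (exp (- t)))"
          using \<open>\<epsilon> > 0\<close> \<open>c > 0\<close> B(1) psi01 by (simp add: ennreal_leI flip: ennreal_mult ennreal_plus)
        also have "\<dots> \<le> ennreal (\<epsilon> * c / (B + 1)) * b t + ennreal \<epsilon> * ennreal (\<psi> (exp (- t)))"
          by (intro add_mono mult_left_mono b(3)) auto
        finally show ?thesis .
      qed
    qed
    also have "\<dots> = ennreal (\<epsilon> * c / (B + 1)) * ennreal B + ennreal \<epsilon> * ennreal c"
      using b(1) by (simp add: nn_integral_add nn_integral_cmult B(2) c(1))
    also have "\<dots> = ennreal (\<epsilon> * c * (B / (B + 1)) + \<epsilon> * c)"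
      using \<open>\<epsilon> > 0\<close> \<open>c > 0\<close> B(1) by (simp flip: ennreal_mult ennreal_plus)
    finally have "c * norm (v t0) \<le> \<epsilon> * c * (B / (B + 1)) + \<epsilon> * c"
      using \<open>\<epsilon> > 0\<close> \<open>c > 0\<close> B(1) by (subst (asm) ennreal_le_iff) auto
    also have "\<dots> \<le> \<epsilon> * c * 1 + \<epsilon> * c"
      using \<open>\<epsilon> > 0\<close> \<open>c > 0\<close> B(1) by (intro add_mono mult_left_mono) auto
    finally have "c * norm (v t0) \<le> c * (2 * \<epsilon>)" by (simp add: algebra_simps)
    then show ?thesis using \<open>c > 0\<close> by simp
  qed
  from this[of "norm (v t0) / 3"] show ?thesis by (cases "v t0 = 0") auto
qed

lemma exists_not_in_countable:
  fixes a b :: real assumes "countable C" "a < b"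
  shows "\<exists>x. a < x \<and> x < b \<and> x \<notin> C"
proof (rule ccontr)
  assume "\<not> ?thesis"
  then have "{a<..<b} \<subseteq> C" by auto
  with assms show False using countable_subset uncountable_open_interval by blast
qed

text \<open>A monotone function is continuous off a countable set, where \<open>laplace_unique\<close> applies; between such points it is squeezed by
  the continuous function \<open>y\<close>.\<close>

lemma laplace_unique_mono:
  fixes X :: "real \<Rightarrow> ennreal" and y :: "real \<Rightarrow> real"
  assumes Xm: "X \<in> borel_measurable borel" and X: "mono X" and y: "mono y" "\<And>t. y t \<ge> 0" "continuous_on UNIV y"
    and neg: "\<And>t. t < 0 \<Longrightarrow> X t = 0" "\<And>t. t < 0 \<Longrightarrow> y t = 0"
    and eq: "\<And>l. l > 0 \<Longrightarrow> (\<integral>\<^sup>+t. ennreal (exp (- l * t)) * X t \<partial>lborel) = (\<integral>\<^sup>+t. ennreal (exp (- l * t)) * ennreal (y t) \<partial>lborel)"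
    and fin: "\<And>l. l > 0 \<Longrightarrow> (\<integral>\<^sup>+t. ennreal (exp (- l * t)) * X t \<partial>lborel) < \<infinity>"
  shows "X t = ennreal (y t)"
proof -
  note Xm[measurable]
  have ym[measurable]: "y \<in> borel_measurable borel" using y(1) by (rule borel_measurable_mono)
  have Xfin: "X t < \<infinity>" for t
  proof -
    have "ennreal (exp (- (t + 1))) * X t = (\<integral>\<^sup>+s. ennreal (exp (- (t + 1))) * X t * indicator {t..t + 1} s \<partial>lborel)"
      by (simp add: nn_integral_cmult_indicator)
    also have "\<dots> \<le> (\<integral>\<^sup>+s. ennreal (exp (- 1 * s)) * X s \<partial>lborel)"
      by (intro nn_integral_mono) (auto simp: indicator_def intro!: mult_mono monoD[OF X])
    also have "\<dots> < \<infinity>" by (rule fin) simp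
    finally show ?thesis by (auto simp: ennreal_mult_less_top)
  qed
  define x where "x t = enn2real (X t)" for t
  have Xx: "X t = ennreal (x t)" for t using Xfin[of t] by (simp add: x_def)
  have x0: "x t \<ge> 0" for t by (simp add: x_def)
  have xm: "mono x" unfolding mono_def x_def using X Xfin by (auto intro!: enn2real_mono dest: monoD)
  then have [measurable]: "x \<in> borel_measurable borel" by (rule borel_measurable_mono)
  let ?C = "{t. \<not> isCont x t}"
  have C: "countable ?C" using xm by (rule mono_ctble_discont)
  have shift: "(\<integral>\<^sup>+t. ennreal (exp (- t) ^ n * (indicator {0<..} t * z t)) \<partial>exp_measure)
      = (\<integral>\<^sup>+t. ennreal (exp (- real (Suc n) * t)) * ennreal (z t) \<partial>lborel)"
    if [measurable]: "z \<in> borel_measurable borel" and z: "\<And>t. z t \<ge> 0" "\<And>t. t < 0 \<Longrightarrow> z t = 0" for n z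
  proof -
    have "(\<integral>\<^sup>+t. ennreal (exp (- t) ^ n * (indicator {0<..} t * z t)) \<partial>exp_measure)
       = (\<integral>\<^sup>+t. ennreal (exp (- t)) * indicator {0<..} t * ennreal (exp (- t) ^ n * (indicator {0<..} t * z t)) \<partial>lborel)"
      by (rule nn_integral_exp_measure) measurable
    also have "\<dots> = (\<integral>\<^sup>+t. ennreal (exp (- real (Suc n) * t)) * ennreal (z t) \<partial>lborel)"
    proof (rule nn_integral_cong_AE)
      show "AE t in lborel. ennreal (exp (- t)) * indicator {0<..} t * ennreal (exp (- t) ^ n * (indicator {0<..} t * z t))
         = ennreal (exp (- real (Suc n) * t)) * ennreal (z t)"
        using AE_lborel_singleton[of 0]
      proof eventually_elim
        case (elim t)
        have "exp (- real (Suc n) * t) = exp (- t) * exp (- t) ^ n"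
          by (simp add: algebra_simps flip: exp_of_nat_mult exp_add)
        then show ?case using elim z(1)[of t] z(2)[of t]
          by (cases "t > 0") (simp_all add: mult.assoc flip: ennreal_mult)
      qed
    qed
    finally show ?thesis .
  qed
  have main: "x t = y t" if t: "t > 0" "t \<notin> ?C" for t
  proof -
    define v where "v t = indicator {0<..} t * x t - indicator {0<..} t * y t" for t :: real
    let ?b = "\<lambda>t. ennreal (exp (- t) ^ 0 * (indicator {0<..} t * x t)) + ennreal (exp (- t) ^ 0 * (indicator {0<..} t * y t))"
    have "v t = 0"
    proof (rule laplace_unique[where b="?b" and v=v])
      fix n :: nat
      define I where "I = enn2real (\<integral>\<^sup>+t. ennreal (exp (- real (Suc n) * t)) * X t \<partial>lborel)"
      have I: "(\<integral>\<^sup>+t. ennreal (exp (- real (Suc n) * t)) * X t \<partial>lborel) = ennreal I" "I \<ge> 0"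
        using fin[of "real (Suc n)"] by (simp_all add: I_def)
      have "has_bochner_integral exp_measure (\<lambda>t. exp (- t) ^ n * (indicator {0<..} t * x t)) I"
        by (rule has_bochner_integral_nn_integral)
           (use I x0 neg in \<open>auto simp: shift Xx simp del: of_nat_Suc\<close>)
      moreover have "has_bochner_integral exp_measure (\<lambda>t. exp (- t) ^ n * (indicator {0<..} t * y t)) I"
        by (rule has_bochner_integral_nn_integral)
           (use I y neg eq[of "real (Suc n)"] in \<open>auto simp: shift simp del: of_nat_Suc\<close>)
      ultimately have "has_bochner_integral exp_measure (\<lambda>t. exp (- t) ^ n * (indicator {0<..} t * x t)
          - exp (- t) ^ n * (indicator {0<..} t * y t)) (I - I)"
        by (rule has_bochner_integral_diff)
      from strong_integral_real[OF this]
      show "strong_integral exp_measure (\<lambda>t. exp (- t) ^ n *\<^sub>R v t) 0"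
        by (simp add: v_def right_diff_distrib)
    next
      show "?b \<in> borel_measurable borel" by measurable
      fix t show "ennreal (norm (v t)) \<le> ?b t"
        using x0[of t] y(2)[of t] by (auto simp: v_def indicator_def simp flip: ennreal_plus intro!: ennreal_leI)
      have "(\<integral>\<^sup>+t. ?b t \<partial>exp_measure) = (\<integral>\<^sup>+t. ennreal (exp (- t) ^ 0 * (indicator {0<..} t * x t)) \<partial>exp_measure)
         + (\<integral>\<^sup>+t. ennreal (exp (- t) ^ 0 * (indicator {0<..} t * y t)) \<partial>exp_measure)"
        by (rule nn_integral_add) auto
      also have "\<dots> < \<infinity>"
        using fin[of 1] eq[of 1] x0 y(2) neg
        by (subst (1 2) shift) (auto simp: Xx)
      finally show "(\<integral>\<^sup>+t. ?b t \<partial>exp_measure) < \<infinity>" .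
    next
      have "isCont (\<lambda>t. x t - y t) t" using t y(3) by (auto intro!: continuous_intros simp: continuous_on_eq_continuous_at)
      moreover have "\<forall>\<^sub>F s in nhds t. x s - y s = v s"
        using eventually_nhds_in_open[OF open_greaterThan, of t 0] t
        by (auto elim!: eventually_mono simp: v_def)
      ultimately show "isCont v t" by (simp add: isCont_cong)
    qed (use t in \<open>auto simp: v_def\<close>)
    then show ?thesis using t by (simp add: v_def)
  qed
  have ycont: "(y \<longlongrightarrow> y t) (at_right t)" "(y \<longlongrightarrow> y t) (at_left t)" for t
    using y(3) by (auto simp: continuous_on_eq_continuous_at isCont_def filterlim_at_split)
  have "x t \<le> y t" if "t \<ge> 0"
  proof (rule tendsto_lowerbound[OF ycont(1)])
    show "\<forall>\<^sub>F s in at_right t. x t \<le> y s"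
      using eventually_at_right_real[of t "t + 1"]
    proof (rule eventually_mono)
      fix s assume s: "s \<in> {t<..<t + 1}"
      obtain r where r: "t < r" "r < s" "r \<notin> ?C" using exists_not_in_countable[OF C, of t s] s by auto
      have "x t \<le> x r" using xm r by (simp add: monoD)
      also have "\<dots> = y r" using main r that by simp
      also have "\<dots> \<le> y s" using y(1) r by (simp add: monoD)
      finally show "x t \<le> y s" .
    qed simp
  qed simp
  moreover have "y t \<le> x t" if "t > 0"
  proof (rule tendsto_upperbound[OF ycont(2)])
    show "\<forall>\<^sub>F s in at_left t. y s \<le> x t"
      using eventually_at_left_real[OF that]
    proof (rule eventually_mono)
      fix s assume s: "s \<in> {0<..<t}"
      obtain r where r: "s < r" "r < t" "r \<notin> ?C" using exists_not_in_countable[OF C, of s t] s by auto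
      have "y s \<le> y r" using y(1) r by (simp add: monoD)
      also have "\<dots> = x r" using main r s by simp
      also have "\<dots> \<le> x t" using xm r by (simp add: monoD)
      finally show "y s \<le> x t" .
    qed
  qed simp
  moreover have "y 0 = 0"
  proof -
    have "y 0 \<le> 0"
      by (rule tendsto_upperbound[OF ycont(2)])
         (use eventually_at_left_real[of "-1" "0::real"] in \<open>auto elim!: eventually_mono simp: neg\<close>)
    then show ?thesis using y(2)[of 0] by simp
  qed
  moreover have "x t = 0" if "t < 0" using that neg(1)[of t] by (simp add: x_def)
  ultimately have "x t = y t"
    using neg(2)[of t] x0[of t] by (cases t "0::real" rule: linorder_cases) simp_all
  then show ?thesis by (simp add: Xx)
qed

text \<open>The values at integers \<open>l = n + 1\<close> suffice: against \<open>exp (- t) dt\<close> they are the moments required by \<open>laplace_unique\<close>.\<close>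

lemma bint_laplace_unique:
  fixes d :: "real \<Rightarrow> 'b::banach"
  assumes d: "continuous_on UNIV d" "\<And>r. norm (d r) \<le> C" and neg: "\<And>t. t \<le> 0 \<Longrightarrow> d t = 0"
    and zero: "\<And>l. l > 0 \<Longrightarrow> bint (laplace_measure l) d = 0"
  shows "d t = 0"
proof (cases "t > 0")
  case True
  show ?thesis
  proof (rule laplace_unique[where v=d and b="\<lambda>_. ennreal C"])
    fix n :: nat
    have "strong_integral exp_measure (\<lambda>t. bint (scale_measure (ennreal (exp (- t) ^ n)) (return borel t)) d) (bint (laplace_measure (real (Suc n))) d)"
    proof (rule strong_integral_mixture[OF d])
      fix A :: "real set" assume A[measurable]: "A \<in> sets borel"
      show "(\<lambda>t. emeasure (scale_measure (ennreal (exp (- t) ^ n)) (return borel t)) A) \<in> borel_measurable exp_measure"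
        by simp
      have "(\<integral>\<^sup>+t. emeasure (scale_measure (ennreal (exp (- t) ^ n)) (return borel t)) A \<partial>exp_measure)
        = (\<integral>\<^sup>+t. ennreal (exp (- t)) * indicator {0<..} t * (ennreal (exp (- t) ^ n) * indicator A t) \<partial>lborel)"
        by (subst nn_integral_exp_measure[symmetric]) auto
      also have "\<dots> = (\<integral>\<^sup>+t. ennreal (exp (- real (Suc n) * t)) * indicator ({0<..} \<inter> A) t \<partial>lborel)"
      proof (rule nn_integral_cong)
        fix t :: real
        have "exp (- real (Suc n) * t) = exp (- t) * exp (- t) ^ n"
          by (simp add: algebra_simps flip: exp_of_nat_mult exp_add)
        then show "ennreal (exp (- t)) * indicator {0<..} t * (ennreal (exp (- t) ^ n) * indicator A t)
          = ennreal (exp (- real (Suc n) * t)) * indicator ({0<..} \<inter> A) t"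
          by (simp add: indicator_inter_arith ac_simps ennreal_mult)
      qed
      finally show "(\<integral>\<^sup>+t. emeasure (scale_measure (ennreal (exp (- t) ^ n)) (return borel t)) A \<partial>exp_measure)
        = emeasure (laplace_measure (real (Suc n))) A" by (simp only: emeasure_laplace_measure[OF A])
    qed (auto simp: finite_scale_measure prob_space.finite_measure prob_space_return finite_laplace_measure)
    moreover have "bint (laplace_measure (real (Suc n))) d = 0" by (rule zero) simp
    moreover have "bint (scale_measure (ennreal (exp (- t) ^ n)) (return borel t)) d = exp (- t) ^ n *\<^sub>R d t" for t
      by (subst bint_scale_measure[OF d]) (auto simp: bint_return[OF d] prob_space.finite_measure prob_space_return)
    ultimately show "strong_integral exp_measure (\<lambda>t. exp (- t) ^ n *\<^sub>R d t) 0" by simp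
  next
    show "(\<integral>\<^sup>+t. ennreal C \<partial>exp_measure) < \<infinity>"
      using finite_measure.emeasure_finite[OF finite_exp_measure, of UNIV]
      by (simp add: laplace_measure_def less_top[symmetric] ennreal_mult_eq_top_iff)
    show "isCont d t" using d(1) by (simp add: continuous_on_eq_continuous_at)
  qed (use d neg True in \<open>auto intro: ennreal_leI\<close>)
qed (simp add: neg)

lemma laplace_primitive:
  fixes z :: "real \<Rightarrow> 'b::banach"
  assumes z: "continuous_on UNIV z" "\<And>r. norm (z r) \<le> C" and l: "l > 0"
  shows "strong_integral (laplace_measure l) (\<lambda>t. bint (leb 0 t) z) ((1 / l) *\<^sub>R bint (laplace_measure l) z)"
proof -
  have "strong_integral (laplace_measure l) (\<lambda>t. bint (leb 0 t) z) (bint (scale_measure (ennreal (1 / l)) (laplace_measure l)) z)"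
  proof (rule strong_integral_mixture[OF z])
    fix A :: "real set" assume A[measurable]: "A \<in> sets borel"
    have eq: "emeasure (leb 0 t) A = (\<integral>\<^sup>+s. indicator A s * (if 0 < s \<and> s < t then 1 else 0) \<partial>lborel)" for t
    proof -
      have "emeasure (leb 0 t) A = (\<integral>\<^sup>+r. indicator (A \<inter> {0<..<t}) r \<partial>lborel)" by (simp add: emeasure_leb)
      also have "\<dots> = (\<integral>\<^sup>+s. indicator A s * (if 0 < s \<and> s < t then 1 else 0) \<partial>lborel)"
        by (intro nn_integral_cong) (auto simp: indicator_def)
      finally show ?thesis .
    qed
    have m[measurable]: "(\<lambda>t. emeasure (leb 0 t) A) \<in> borel_measurable borel" unfolding eq by measurable
    then show "(\<lambda>t. emeasure (leb 0 t) A) \<in> borel_measurable (laplace_measure l)"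
      by (simp add: measurable_cong_sets[OF sets_laplace_measure refl])
    have "(\<integral>\<^sup>+t. emeasure (leb 0 t) A \<partial>laplace_measure l)
      = (\<integral>\<^sup>+t. \<integral>\<^sup>+s. ennreal (exp (- l * t)) * (indicator {0<..} t * (indicator A s * (if 0 < s \<and> s < t then 1 else 0))) \<partial>lborel \<partial>lborel)"
      unfolding nn_integral_laplace_measure[OF m] unfolding eq
      by (intro nn_integral_cong) (subst nn_integral_cmult[symmetric] nn_integral_cmult, measurable)+
    also have "\<dots> = (\<integral>\<^sup>+s. \<integral>\<^sup>+t. ennreal (exp (- l * t)) * (indicator {0<..} t * (indicator A s * (if 0 < s \<and> s < t then 1 else 0))) \<partial>lborel \<partial>lborel)"
      by (rule lborel_pair.Fubini') measurable
    also have "\<dots> = (\<integral>\<^sup>+s. ennreal (1 / l) * (ennreal (exp (- l * s)) * indicator ({0<..} \<inter> A) s) \<partial>lborel)"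
    proof (rule nn_integral_cong)
      fix s :: real
      have "(\<integral>\<^sup>+t. ennreal (exp (- l * t)) * (indicator {0<..} t * (indicator A s * (if 0 < s \<and> s < t then 1 else 0))) \<partial>lborel)
        = (\<integral>\<^sup>+t. indicator ({0<..} \<inter> A) s * (ennreal (exp (- l * t)) * indicator {s<..} t) \<partial>lborel)"
        by (intro nn_integral_cong) (auto simp: indicator_def)
      also have "\<dots> = indicator ({0<..} \<inter> A) s * ennreal (exp (- l * s) / l)"
        by (subst nn_integral_cmult) (measurable, simp only: exp_integral_tail[OF l])
      also have "\<dots> = ennreal (1 / l) * (ennreal (exp (- l * s)) * indicator ({0<..} \<inter> A) s)"
        using l by (auto simp: indicator_def simp flip: ennreal_mult)
      finally show "(\<integral>\<^sup>+t. ennreal (exp (- l * t)) * (indicator {0<..} t * (indicator A s * (if 0 < s \<and> s < t then 1 else 0))) \<partial>lborel)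
        = ennreal (1 / l) * (ennreal (exp (- l * s)) * indicator ({0<..} \<inter> A) s)" .
    qed
    also have "\<dots> = ennreal (1 / l) * emeasure (laplace_measure l) A"
      unfolding emeasure_laplace_measure[OF A] by (rule nn_integral_cmult) measurable
    finally show "(\<integral>\<^sup>+t. emeasure (leb 0 t) A \<partial>laplace_measure l) = emeasure (scale_measure (ennreal (1 / l)) (laplace_measure l)) A"
      by simp
  qed (auto simp: finite_leb finite_scale_measure finite_laplace_measure l)
  then show ?thesis using l by (simp add: bint_scale_measure[OF z finite_laplace_measure[OF l]])
qed

section \<open>The renewal identity\<close>

context subordinator_setting
begin

text \<open>The convolution of \<open>w\<close> with \<open>F r\<close> in time. Both factors vanish on the negative half-line, so only \<open>0 < s \<le> t\<close> contributes.\<close>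

definition conv :: "real \<Rightarrow> real \<Rightarrow> ennreal" where
  "conv r t = (\<integral>\<^sup>+s. ennreal (w s) * ennreal (F r (t - s)) \<partial>lborel)"

definition flux :: "real \<Rightarrow> real \<Rightarrow> ennreal" where
  "flux r t = ennreal \<kappa> * ennreal (F r t) + conv r t"

definition tail_mass :: "real \<Rightarrow> real \<Rightarrow> ennreal" where
  "tail_mass a t = (\<integral>\<^sup>+s. ennreal (F a s) * indicator {0<..<t} s \<partial>lborel)"

lemma conv_measurable [measurable]: "(\<lambda>p. conv (fst p) (snd p)) \<in> borel_measurable (borel \<Otimes>\<^sub>M borel)"
  unfolding conv_def by measurable

lemma flux_measurable_pair [measurable]: "(\<lambda>p. flux (fst p) (snd p)) \<in> borel_measurable (borel \<Otimes>\<^sub>M borel)"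
  unfolding flux_def by measurable

lemma flux_measurable [measurable (raw)]:
  assumes "f \<in> borel_measurable N" "g \<in> borel_measurable N"
  shows "(\<lambda>x. flux (f x) (g x)) \<in> borel_measurable N"
  using measurable_compose[OF measurable_Pair[OF assms] flux_measurable_pair] by simp

lemma conv_measurable' [measurable (raw)]:
  assumes "f \<in> borel_measurable N" "g \<in> borel_measurable N"
  shows "(\<lambda>x. conv (f x) (g x)) \<in> borel_measurable N"
  using measurable_compose[OF measurable_Pair[OF assms] conv_measurable] by simp

lemma conv_mono: "s \<le> t \<Longrightarrow> conv r s \<le> conv r t"
  unfolding conv_def by (intro nn_integral_mono mult_left_mono ennreal_leI F_mono) auto

lemma flux_mono: "s \<le> t \<Longrightarrow> flux r s \<le> flux r t"
  unfolding flux_def by (intro add_mono mult_left_mono conv_mono ennreal_leI F_mono) auto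

lemma conv_neg: "t < 0 \<Longrightarrow> conv r t = 0"
proof -
  assume t: "t < 0"
  have "ennreal (w s) * ennreal (F r (t - s)) = 0" for s
    using t by (cases "s > 0") (simp_all add: F_neg w_nonpos_arg)
  then show ?thesis unfolding conv_def by (simp only: nn_integral_const mult_zero_left)
qed

lemma flux_neg: "t < 0 \<Longrightarrow> flux r t = 0"
  by (simp add: flux_def F_neg conv_neg)

lemma laplace_F':
  assumes "r \<ge> 0" "l > 0"
  shows "(\<integral>\<^sup>+t. ennreal (exp (- l * t)) * ennreal (F r t) \<partial>lborel) = ennreal (exp (- r * \<Phi> l) / l)"
  using laplace_F[OF assms] by (simp add: ennreal_mult F_nonneg)

lemma laplace_w':
  assumes "l > 0"
  shows "(\<integral>\<^sup>+s. ennreal (exp (- l * s)) * ennreal (w s) \<partial>lborel) = ennreal ((\<Phi> l - \<kappa> * l) / l)"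
  using laplace_w[OF assms] by (simp add: ennreal_mult w_nonneg)

lemma laplace_shift:
  fixes g :: "real \<Rightarrow> ennreal"
  assumes [measurable]: "g \<in> borel_measurable borel"
  shows "(\<integral>\<^sup>+t. ennreal (exp (- l * t)) * g (t - s) \<partial>lborel) = ennreal (exp (- l * s)) * (\<integral>\<^sup>+t. ennreal (exp (- l * t)) * g t \<partial>lborel)"
proof -
  have "(\<integral>\<^sup>+t. ennreal (exp (- l * t)) * g (t - s) \<partial>lborel)
      = ennreal \<bar>1\<bar> * (\<integral>\<^sup>+t. ennreal (exp (- l * (s + 1 * t))) * g (s + 1 * t - s) \<partial>lborel)"
    by (rule nn_integral_real_affine) auto
  also have "\<dots> = (\<integral>\<^sup>+t. ennreal (exp (- l * s)) * (ennreal (exp (- l * t)) * g t) \<partial>lborel)"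
  proof -
    have "ennreal (exp (- l * (s + 1 * t))) = ennreal (exp (- l * s)) * ennreal (exp (- l * t))" for t
      by (simp add: distrib_left flip: exp_add ennreal_mult)
    then show ?thesis by (simp add: mult.assoc)
  qed
  also have "\<dots> = ennreal (exp (- l * s)) * (\<integral>\<^sup>+t. ennreal (exp (- l * t)) * g t \<partial>lborel)"
    by (rule nn_integral_cmult) measurable
  finally show ?thesis .
qed

lemma laplace_convolution:
  fixes g :: "real \<Rightarrow> ennreal"
  assumes [measurable]: "g \<in> borel_measurable borel" and l: "l > 0"
  shows "(\<integral>\<^sup>+t. ennreal (exp (- l * t)) * (\<integral>\<^sup>+s. ennreal (w s) * g (t - s) \<partial>lborel) \<partial>lborel)
    = ennreal ((\<Phi> l - \<kappa> * l) / l) * (\<integral>\<^sup>+t. ennreal (exp (- l * t)) * g t \<partial>lborel)"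
proof -
  have "(\<integral>\<^sup>+t. ennreal (exp (- l * t)) * (\<integral>\<^sup>+s. ennreal (w s) * g (t - s) \<partial>lborel) \<partial>lborel)
     = (\<integral>\<^sup>+t. \<integral>\<^sup>+s. ennreal (exp (- l * t)) * (ennreal (w s) * g (t - s)) \<partial>lborel \<partial>lborel)"
    by (intro nn_integral_cong nn_integral_cmult[symmetric]) measurable
  also have "\<dots> = (\<integral>\<^sup>+s. \<integral>\<^sup>+t. ennreal (exp (- l * t)) * (ennreal (w s) * g (t - s)) \<partial>lborel \<partial>lborel)"
    by (rule lborel_pair.Fubini') measurable
  also have "\<dots> = (\<integral>\<^sup>+s. ennreal (w s) * (\<integral>\<^sup>+t. ennreal (exp (- l * t)) * g (t - s) \<partial>lborel) \<partial>lborel)"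
    by (subst nn_integral_cmult[symmetric]) (auto intro!: nn_integral_cong simp: ac_simps)
  also have "\<dots> = (\<integral>\<^sup>+s. (ennreal (exp (- l * s)) * ennreal (w s)) * (\<integral>\<^sup>+t. ennreal (exp (- l * t)) * g t \<partial>lborel) \<partial>lborel)"
    by (simp only: laplace_shift[OF assms(1)] mult.assoc mult.left_commute)
  also have "\<dots> = ennreal ((\<Phi> l - \<kappa> * l) / l) * (\<integral>\<^sup>+t. ennreal (exp (- l * t)) * g t \<partial>lborel)"
    using laplace_w'[OF l] by (simp add: nn_integral_multc)
  finally show ?thesis .
qed

lemma laplace_flux:
  assumes r: "r \<ge> 0" and l: "l > 0"
  shows "(\<integral>\<^sup>+t. ennreal (exp (- l * t)) * flux r t \<partial>lborel) = ennreal (\<Phi> l * exp (- r * \<Phi> l) / l\<^sup>2)"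
proof -
  have "(\<integral>\<^sup>+t. ennreal (exp (- l * t)) * flux r t \<partial>lborel)
     = (\<integral>\<^sup>+t. ennreal \<kappa> * (ennreal (exp (- l * t)) * ennreal (F r t)) + ennreal (exp (- l * t)) * conv r t \<partial>lborel)"
    by (intro nn_integral_cong) (simp add: flux_def distrib_left ac_simps)
  also have "\<dots> = ennreal \<kappa> * ennreal (exp (- r * \<Phi> l) / l) + ennreal ((\<Phi> l - \<kappa> * l) / l) * ennreal (exp (- r * \<Phi> l) / l)"
    using laplace_convolution[of "\<lambda>t. ennreal (F r t)" l] laplace_F'[OF r l] l
    by (simp add: nn_integral_add nn_integral_cmult conv_def)
  also have "\<dots> = ennreal (\<kappa> * (exp (- r * \<Phi> l) / l) + (\<Phi> l - \<kappa> * l) / l * (exp (- r * \<Phi> l) / l))"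
    using kappa_nonneg laplace_exponent_ge[OF l] l by (simp flip: ennreal_mult ennreal_plus)
  also have "\<kappa> * (exp (- r * \<Phi> l) / l) + (\<Phi> l - \<kappa> * l) / l * (exp (- r * \<Phi> l) / l) = \<Phi> l * exp (- r * \<Phi> l) / l\<^sup>2"
    using l by (simp add: field_simps power2_eq_square)
  finally show ?thesis .
qed

lemma nn_integral_exp_tail:
  "q > 0 \<Longrightarrow> (\<integral>\<^sup>+r. ennreal (exp (- r * q)) * indicator {a<..} r \<partial>lborel) = ennreal (exp (- a * q) / q)"
  using exp_integral_tail[of q a] by (simp add: mult.commute)

lemma tail_mass_finite: "tail_mass a t \<le> ennreal (max 0 t)"
proof -
  have "tail_mass a t \<le> (\<integral>\<^sup>+s. indicator {0<..<t} s \<partial>lborel)"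
    unfolding tail_mass_def using F_le_1 by (intro nn_integral_mono) (auto simp: indicator_def)
  also have "\<dots> = ennreal (max 0 t)" by (cases "t \<ge> 0") (auto simp: max_def)
  finally show ?thesis .
qed

lemma tail_mass_increment: "s \<le> t \<Longrightarrow> tail_mass a t \<le> tail_mass a s + ennreal (t - s)"
proof -
  assume st: "s \<le> t"
  have "tail_mass a t \<le> (\<integral>\<^sup>+x. ennreal (F a x) * indicator {0<..<s} x + indicator {s..<t} x \<partial>lborel)"
    unfolding tail_mass_def using F_le_1 by (intro nn_integral_mono) (auto simp: indicator_def)
  also have "\<dots> = tail_mass a s + ennreal (t - s)"
    unfolding tail_mass_def using st by (subst nn_integral_add) auto
  finally show ?thesis .
qed

lemma tail_mass_mono: "s \<le> t \<Longrightarrow> tail_mass a s \<le> tail_mass a t"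
  unfolding tail_mass_def by (intro nn_integral_mono) (auto simp: indicator_def)

text \<open>Both sides have Laplace transform \<open>exp (- a \<cdot> \<Phi> l) / l\<^sup>2\<close> in \<open>t\<close>. On the left, the transform of \<open>flux r\<close>
  is \<open>\<Phi> l \<cdot> exp (- r \<cdot> \<Phi> l) / l\<^sup>2\<close>: the memory term supplies exactly the part of \<open>\<Phi>\<close> that the drift does not, and
  the factor \<open>\<Phi> l\<close> is absorbed by the integration over \<open>r > a\<close>.\<close>

lemma tail_identity:
  assumes a: "a \<ge> 0"
  shows "(\<integral>\<^sup>+r. flux r t * indicator {a<..} r \<partial>lborel) = tail_mass a t"
proof -
  define y where "y t = enn2real (tail_mass a t)" for t
  have fin: "tail_mass a t < \<infinity>" for t
    using le_less_trans[OF tail_mass_finite[of a t], of "\<infinity>"] by simp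
  then have Yy: "tail_mass a t = ennreal (y t)" for t by (simp add: y_def)
  have y0: "y t \<ge> 0" for t by (simp add: y_def)
  have ymono: "mono y" unfolding mono_def y_def using fin by (auto intro!: enn2real_mono tail_mass_mono)
  have lip: "y t \<le> y s + (t - s)" if "s \<le> t" for s t
  proof -
    have "ennreal (y t) \<le> ennreal (y s + (t - s))"
      using tail_mass_increment[OF that, of a] that y0[of s] by (simp add: Yy)
    then show ?thesis using that y0[of s] by (subst (asm) ennreal_le_iff) auto
  qed
  have "1-lipschitz_on UNIV y"
  proof (rule lipschitz_onI)
    fix s t show "dist (y s) (y t) \<le> 1 * dist s t"
      using lip[of s t] lip[of t s] monoD[OF ymono, of s t] monoD[OF ymono, of t s]
      by (cases "s \<le> t") (auto simp: dist_real_def)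
  qed simp
  then have ycont: "continuous_on UNIV y" by (rule lipschitz_on_continuous_on)
  have lapX: "(\<integral>\<^sup>+t. ennreal (exp (- l * t)) * (\<integral>\<^sup>+r. flux r t * indicator {a<..} r \<partial>lborel) \<partial>lborel)
      = ennreal (exp (- a * \<Phi> l) / l\<^sup>2)" if l: "l > 0" for l
  proof -
    have "(\<integral>\<^sup>+t. ennreal (exp (- l * t)) * (\<integral>\<^sup>+r. flux r t * indicator {a<..} r \<partial>lborel) \<partial>lborel)
       = (\<integral>\<^sup>+t. \<integral>\<^sup>+r. ennreal (exp (- l * t)) * (flux r t * indicator {a<..} r) \<partial>lborel \<partial>lborel)"
      by (intro nn_integral_cong nn_integral_cmult[symmetric]) measurable
    also have "\<dots> = (\<integral>\<^sup>+r. \<integral>\<^sup>+t. ennreal (exp (- l * t)) * (flux r t * indicator {a<..} r) \<partial>lborel \<partial>lborel)"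
      by (rule lborel_pair.Fubini') measurable
    also have "\<dots> = (\<integral>\<^sup>+r. (\<integral>\<^sup>+t. ennreal (exp (- l * t)) * flux r t \<partial>lborel) * indicator {a<..} r \<partial>lborel)"
      by (subst nn_integral_multc[symmetric]) (auto intro!: nn_integral_cong simp: ac_simps)
    also have "\<dots> = (\<integral>\<^sup>+r. ennreal (\<Phi> l / l\<^sup>2) * (ennreal (exp (- r * \<Phi> l)) * indicator {a<..} r) \<partial>lborel)"
      using a l laplace_exponent_pos[OF l]
      by (intro nn_integral_cong) (auto simp: indicator_def laplace_flux[simplified] simp flip: ennreal_mult)
    also have "\<dots> = ennreal (\<Phi> l / l\<^sup>2) * ennreal (exp (- a * \<Phi> l) / \<Phi> l)"
      using laplace_exponent_pos[OF l] by (subst nn_integral_cmult) (auto simp: nn_integral_exp_tail[simplified])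
    also have "\<dots> = ennreal (exp (- a * \<Phi> l) / l\<^sup>2)"
      using laplace_exponent_pos[OF l] l by (simp flip: ennreal_mult)
    finally show ?thesis .
  qed
  have lapY: "(\<integral>\<^sup>+t. ennreal (exp (- l * t)) * tail_mass a t \<partial>lborel) = ennreal (exp (- a * \<Phi> l) / l\<^sup>2)" if l: "l > 0" for l
  proof -
    have "(\<integral>\<^sup>+t. ennreal (exp (- l * t)) * tail_mass a t \<partial>lborel)
       = (\<integral>\<^sup>+t. \<integral>\<^sup>+s. ennreal (exp (- l * t)) * (ennreal (F a s) * (if 0 < s \<and> s < t then 1 else 0)) \<partial>lborel \<partial>lborel)"
      unfolding tail_mass_def
      by (subst nn_integral_cmult[symmetric]) (auto intro!: nn_integral_cong simp: indicator_def)
    also have "\<dots> = (\<integral>\<^sup>+s. \<integral>\<^sup>+t. ennreal (exp (- l * t)) * (ennreal (F a s) * (if 0 < s \<and> s < t then 1 else 0)) \<partial>lborel \<partial>lborel)"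
      by (rule lborel_pair.Fubini') measurable
    also have "\<dots> = (\<integral>\<^sup>+s. ennreal (1 / l) * (ennreal (exp (- l * s)) * ennreal (F a s)) \<partial>lborel)"
    proof (rule nn_integral_cong_AE)
      show "AE s in lborel. (\<integral>\<^sup>+t. ennreal (exp (- l * t)) * (ennreal (F a s) * (if 0 < s \<and> s < t then 1 else 0)) \<partial>lborel)
         = ennreal (1 / l) * (ennreal (exp (- l * s)) * ennreal (F a s))"
        using AE_lborel_singleton[of 0]
      proof eventually_elim
        case (elim s)
        show ?case
        proof (cases "s > 0")
          case True
          have "(\<integral>\<^sup>+t. ennreal (exp (- l * t)) * (ennreal (F a s) * (if 0 < s \<and> s < t then 1 else 0)) \<partial>lborel)
            = (\<integral>\<^sup>+t. ennreal (F a s) * (ennreal (exp (- t * l)) * indicator {s<..} t) \<partial>lborel)"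
            using True by (intro nn_integral_cong) (auto simp: indicator_def ac_simps)
          also have "\<dots> = ennreal (F a s) * ennreal (exp (- s * l) / l)"
            using l by (subst nn_integral_cmult) (auto simp: nn_integral_exp_tail[simplified])
          also have "\<dots> = ennreal (1 / l) * (ennreal (exp (- l * s)) * ennreal (F a s))"
            using l F_nonneg by (simp add: ac_simps flip: ennreal_mult)
          finally show ?thesis .
        qed (use elim in \<open>simp add: F_neg\<close>)
      qed
    qed
    also have "\<dots> = ennreal (1 / l) * ennreal (exp (- a * \<Phi> l) / l)"
      using laplace_F'[OF a l] by (simp add: nn_integral_cmult)
    also have "\<dots> = ennreal (exp (- a * \<Phi> l) / l\<^sup>2)"
      using l by (simp add: power2_eq_square flip: ennreal_mult)
    finally show ?thesis .
  qed
  have "(\<integral>\<^sup>+r. flux r t * indicator {a<..} r \<partial>lborel) = ennreal (y t)"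
  proof (rule laplace_unique_mono[where X="\<lambda>t. \<integral>\<^sup>+r. flux r t * indicator {a<..} r \<partial>lborel"])
    show "mono (\<lambda>t. \<integral>\<^sup>+r. flux r t * indicator {a<..} r \<partial>lborel)"
      by (auto simp: mono_def intro!: nn_integral_mono mult_right_mono flux_mono)
    show "(\<integral>\<^sup>+t. ennreal (exp (- l * t)) * (\<integral>\<^sup>+r. flux r t * indicator {a<..} r \<partial>lborel) \<partial>lborel)
      = (\<integral>\<^sup>+t. ennreal (exp (- l * t)) * ennreal (y t) \<partial>lborel)" if "l > 0" for l
      unfolding lapX[OF that] using lapY[OF that] by (simp add: Yy)
    show "(\<integral>\<^sup>+t. ennreal (exp (- l * t)) * (\<integral>\<^sup>+r. flux r t * indicator {a<..} r \<partial>lborel) \<partial>lborel) < \<infinity>" if "l > 0" for l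
      unfolding lapX[OF that] by simp
    show "y t = 0" if "t < 0" for t
      using that by (simp add: y_def tail_mass_def)
  qed (use ymono y0 ycont in \<open>auto simp: flux_neg\<close>)
  then show ?thesis by (simp add: Yy)
qed

lemma F_0: "t \<ge> 0 \<Longrightarrow> F 0 t = 1"
proof -
  assume t: "t \<ge> 0"
  have "AE \<omega> in M. \<omega> \<in> {\<omega> \<in> space M. S (max 0 0) \<omega> \<le> t}"
    using regular_path_AE AE_space by eventually_elim (use t in \<open>simp add: regular_path_def\<close>)
  then show ?thesis unfolding F_def using prob_eq_1[OF F_set[of 0 t]] by simp
qed

lemma tail_mass_0: "tail_mass 0 t = ennreal t"
proof -
  have "tail_mass 0 t = (\<integral>\<^sup>+s. indicator {0<..<t} s \<partial>lborel)"
    unfolding tail_mass_def by (intro nn_integral_cong) (auto simp: indicator_def F_0)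
  also have "\<dots> = ennreal t" by (cases "t \<ge> 0") (auto simp: ennreal_neg)
  finally show ?thesis .
qed

text \<open>The expectation of \<open>E t\<close>, known a priori only as an extended real; \<open>potential\<close> below is its real value.\<close>

definition potential_nn :: "real \<Rightarrow> ennreal" where
  "potential_nn t = (\<integral>\<^sup>+r. ennreal (F r t) * indicator {0<..} r \<partial>lborel)"

lemma potential_nn_measurable [measurable]: "potential_nn \<in> borel_measurable borel"
  unfolding potential_nn_def by measurable

lemma potential_nn_mono: "s \<le> t \<Longrightarrow> potential_nn s \<le> potential_nn t"
  unfolding potential_nn_def by (intro nn_integral_mono mult_right_mono ennreal_leI F_mono) auto

lemma nn_integral_conv:
  assumes [measurable]: "A \<in> sets borel"
  shows "(\<integral>\<^sup>+r. conv r t * indicator A r \<partial>lborel)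
      = (\<integral>\<^sup>+s. ennreal (w s) * (\<integral>\<^sup>+r. ennreal (F r (t - s)) * indicator A r \<partial>lborel) \<partial>lborel)"
proof -
  have "(\<integral>\<^sup>+r. conv r t * indicator A r \<partial>lborel)
     = (\<integral>\<^sup>+r. \<integral>\<^sup>+s. ennreal (w s) * (ennreal (F r (t - s)) * indicator A r) \<partial>lborel \<partial>lborel)"
    unfolding conv_def by (subst nn_integral_multc[symmetric]) (auto intro!: nn_integral_cong simp: ac_simps)
  also have "\<dots> = (\<integral>\<^sup>+s. \<integral>\<^sup>+r. ennreal (w s) * (ennreal (F r (t - s)) * indicator A r) \<partial>lborel \<partial>lborel)"
    by (rule lborel_pair.Fubini') measurable
  also have "\<dots> = (\<integral>\<^sup>+s. ennreal (w s) * (\<integral>\<^sup>+r. ennreal (F r (t - s)) * indicator A r \<partial>lborel) \<partial>lborel)"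
    by (intro nn_integral_cong nn_integral_cmult) measurable
  finally show ?thesis .
qed

lemma renewal_equation:
  "ennreal \<kappa> * potential_nn t + (\<integral>\<^sup>+s. ennreal (w s) * potential_nn (t - s) \<partial>lborel) = ennreal t"
proof -
  have "ennreal t = (\<integral>\<^sup>+r. flux r t * indicator {0<..} r \<partial>lborel)"
    using tail_identity[of 0 t] tail_mass_0 by simp
  also have "\<dots> = (\<integral>\<^sup>+r. ennreal \<kappa> * (ennreal (F r t) * indicator {0<..} r) + conv r t * indicator {0<..} r \<partial>lborel)"
    by (intro nn_integral_cong) (simp add: flux_def distrib_right mult.assoc)
  also have "\<dots> = ennreal \<kappa> * potential_nn t + (\<integral>\<^sup>+r. conv r t * indicator {0<..} r \<partial>lborel)"
    by (simp add: nn_integral_add nn_integral_cmult potential_nn_def)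
  also have "\<dots> = ennreal \<kappa> * potential_nn t + (\<integral>\<^sup>+s. ennreal (w s) * potential_nn (t - s) \<partial>lborel)"
    by (subst nn_integral_conv) (auto simp: potential_nn_def)
  finally show ?thesis ..
qed

lemma w_short_mass:
  assumes "h > 0" shows "ennreal (h * w h) \<le> (\<integral>\<^sup>+s. ennreal (w s) * indicator {0<..<h} s \<partial>lborel)"
proof -
  have "ennreal (h * w h) = (\<integral>\<^sup>+s. ennreal (w h) * indicator {0<..<h} s \<partial>lborel)"
    using assms by (simp add: nn_integral_cmult_indicator ennreal_mult w_nonneg mult.commute)
  also have "\<dots> \<le> (\<integral>\<^sup>+s. ennreal (w s) * indicator {0<..<h} s \<partial>lborel)"
    by (intro nn_integral_mono) (auto simp: indicator_def intro!: ennreal_leI w_antimono)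
  finally show ?thesis .
qed

text \<open>Near \<open>s = 0\<close> the memory term of the renewal equation at time \<open>t + h\<close> already contains a positive multiple of the
  potential at \<open>t\<close>.\<close>

lemma potential_nn_finite: "potential_nn t < \<infinity>"
proof -
  obtain h where h: "h > 0" "w h > 0" using w_unbounded[of 0] by blast
  have "ennreal (h * w h) * potential_nn t \<le> (\<integral>\<^sup>+s. ennreal (w s) * indicator {0<..<h} s * potential_nn t \<partial>lborel)"
    using w_short_mass[OF h(1)] by (simp add: nn_integral_multc mult_right_mono)
  also have "\<dots> \<le> (\<integral>\<^sup>+s. ennreal (w s) * potential_nn (t + h - s) \<partial>lborel)"
    by (intro nn_integral_mono) (auto simp: indicator_def intro!: mult_left_mono potential_nn_mono)
  also have "\<dots> \<le> ennreal (t + h)" by (subst renewal_equation[of "t + h", symmetric]) simp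
  also have "\<dots> < \<infinity>" by simp
  finally show ?thesis using h by (auto simp: ennreal_mult_less_top)
qed

definition potential :: "real \<Rightarrow> real" where "potential t = enn2real (potential_nn t)"

lemma potential_nn_eq: "potential_nn t = ennreal (potential t)"
  using potential_nn_finite[of t] by (simp add: potential_def)

lemma potential_nonneg: "potential t \<ge> 0" by (simp add: potential_def)

lemma potential_mono: "s \<le> t \<Longrightarrow> potential s \<le> potential t"
  unfolding potential_def using potential_nn_finite by (auto intro!: enn2real_mono potential_nn_mono)

lemma ennreal_cancel_increment:
  assumes "ennreal t + ennreal x \<le> ennreal (t + h)" "h \<ge> 0" shows "x \<le> h"
proof (rule ccontr)
  assume "\<not> x \<le> h"
  have "ennreal (t + h) \<le> ennreal t + ennreal h"
    using assms(2) by (cases "t \<ge> 0") (auto simp: ennreal_neg simp flip: ennreal_plus intro!: ennreal_leI)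
  then have "ennreal t + ennreal x \<le> ennreal t + ennreal h" using assms(1) by (rule order_trans[rotated])
  then have "ennreal x \<le> ennreal h" by (simp add: ennreal_add_left_cancel_le)
  then show False using \<open>\<not> x \<le> h\<close> assms(2) by (simp add: ennreal_le_iff)
qed

text \<open>Compare the renewal equation at \<open>t\<close> and at \<open>t + 2h\<close>. For \<open>0 < s < h\<close> the point \<open>t + 2h - s\<close> lies beyond
  \<open>t + h\<close> and \<open>t - s\<close> before \<open>t\<close>, so on this range the memory term grows by at least the increment over \<open>[t, t + h]\<close>
  times \<open>w h\<close>; the total growth is at most \<open>2h\<close>.\<close>

lemma potential_increment:
  assumes h: "h > 0" shows "w h * (potential (t + h) - potential t) \<le> 2"
proof -
  let ?d = "potential (t + h) - potential t"
  have d0: "?d \<ge> 0" using h by (simp add: potential_mono)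
  have "ennreal t + ennreal (h * w h) * ennreal ?d
     \<le> ennreal \<kappa> * potential_nn t + (\<integral>\<^sup>+s. ennreal (w s) * potential_nn (t - s) \<partial>lborel)
       + (\<integral>\<^sup>+s. ennreal (w s) * indicator {0<..<h} s * ennreal ?d \<partial>lborel)"
    using w_short_mass[OF h] unfolding renewal_equation by (simp add: nn_integral_multc add_left_mono mult_right_mono)
  also have "\<dots> = ennreal \<kappa> * potential_nn t + (\<integral>\<^sup>+s. ennreal (w s) * potential_nn (t - s)
       + ennreal (w s) * indicator {0<..<h} s * ennreal ?d \<partial>lborel)"
    by (subst nn_integral_add) (auto simp: add.assoc)
  also have "\<dots> \<le> ennreal \<kappa> * potential_nn (t + 2 * h) + (\<integral>\<^sup>+s. ennreal (w s) * potential_nn (t + 2 * h - s) \<partial>lborel)"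
  proof (intro add_mono nn_integral_mono mult_left_mono)
    show "potential_nn t \<le> potential_nn (t + 2 * h)" using h by (intro potential_nn_mono) simp
    fix s
    have "potential_nn (t - s) + indicator {0<..<h} s * ennreal ?d \<le> potential_nn (t + 2 * h - s)"
    proof (cases "s \<in> {0<..<h}")
      case True
      have "potential (t - s) + ?d \<le> potential (t + 2 * h - s)"
        using True potential_mono[of "t - s" t] potential_mono[of "t + h" "t + 2 * h - s"] by auto
      then show ?thesis using True d0 potential_nonneg by (simp add: potential_nn_eq ennreal_leI flip: ennreal_plus)
    qed (use h in \<open>auto intro: potential_nn_mono\<close>)
    from mult_left_mono[OF this, of "ennreal (w s)"]
    show "ennreal (w s) * potential_nn (t - s) + ennreal (w s) * indicator {0<..<h} s * ennreal ?d
       \<le> ennreal (w s) * potential_nn (t + 2 * h - s)" by (simp add: distrib_left mult.assoc)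
  qed simp
  also have "\<dots> = ennreal (t + 2 * h)" by (rule renewal_equation)
  finally have "ennreal t + ennreal (h * w h * ?d) \<le> ennreal (t + 2 * h)"
    using h d0 w_nonneg by (simp add: ennreal_mult)
  then have "h * w h * ?d \<le> 2 * h" by (rule ennreal_cancel_increment) (use h in simp)
  then have "h * (w h * ?d) \<le> h * 2" by (simp add: algebra_simps)
  then show ?thesis using h by (simp only: mult_le_cancel_left_pos)
qed

lemma potential_lipschitz:
  assumes h: "h \<ge> 0" shows "\<kappa> * (potential (t + h) - potential t) \<le> h"
proof -
  let ?d = "potential (t + h) - potential t"
  have d0: "?d \<ge> 0" using h by (simp add: potential_mono)
  have p: "potential_nn (t + h) = potential_nn t + ennreal ?d"
    using d0 potential_nonneg by (simp add: potential_nn_eq flip: ennreal_plus)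
  have "ennreal t + ennreal \<kappa> * ennreal ?d
      = ennreal \<kappa> * potential_nn (t + h) + (\<integral>\<^sup>+s. ennreal (w s) * potential_nn (t - s) \<partial>lborel)"
    unfolding renewal_equation[of t, symmetric] p by (simp add: distrib_left ac_simps)
  also have "\<dots> \<le> ennreal \<kappa> * potential_nn (t + h) + (\<integral>\<^sup>+s. ennreal (w s) * potential_nn (t + h - s) \<partial>lborel)"
    using h by (intro add_left_mono nn_integral_mono mult_left_mono potential_nn_mono) auto
  also have "\<dots> = ennreal (t + h)" by (rule renewal_equation)
  finally have "ennreal t + ennreal (\<kappa> * ?d) \<le> ennreal (t + h)"
    using kappa_nonneg d0 by (simp add: ennreal_mult)
  then show ?thesis by (rule ennreal_cancel_increment) fact
qed

lemma potential_neg: "t < 0 \<Longrightarrow> potential t = 0"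
  by (simp add: potential_def potential_nn_def F_neg)

text \<open>\<open>w h\<close> can be made as large as desired. For \<open>\<kappa> = 0\<close> this is the only source of continuity in time.\<close>

lemma potential_modulus: "\<epsilon> > 0 \<Longrightarrow> \<exists>h>0. \<forall>s t. s \<le> t \<and> t < s + h \<longrightarrow> potential t - potential s < \<epsilon>"
proof -
  assume e: "\<epsilon> > 0"
  obtain h where h: "h > 0" "w h > 2 / \<epsilon>" using w_unbounded by blast
  have "potential t - potential s < \<epsilon>" if "s \<le> t" "t < s + h" for s t
  proof -
    have w0: "w h > 0" using h(2) e by (meson divide_pos_pos less_trans zero_less_numeral)
    have "w h * (potential t - potential s) \<le> w h * (potential (s + h) - potential s)"
      using that w0 by (intro mult_left_mono) (auto intro: potential_mono)
    also have "\<dots> \<le> 2" by (rule potential_increment[OF h(1)])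
    also have "2 < w h * \<epsilon>" using h(2) e by (simp add: divide_less_eq)
    finally show ?thesis using w0 by simp
  qed
  with h show ?thesis by blast
qed

lemma potential_0: "potential 0 = 0"
proof -
  have *: "potential 0 \<le> \<epsilon>" if e: "\<epsilon> > 0" for \<epsilon>
  proof -
    obtain h where h: "h > 0" "\<forall>s t. s \<le> t \<and> t < s + h \<longrightarrow> potential t - potential s < \<epsilon>"
      using potential_modulus[OF e] by blast
    \<comment> \<open>the potential vanishes at negative times, so a jump at \<open>0\<close> is excluded by the same modulus\<close>
    have "potential 0 - potential (- h / 2) < \<epsilon>" using h(1) by (intro h(2)[rule_format]) simp
    then show ?thesis using h(1) potential_neg[of "- h / 2"] by simp
  qed
  have "potential 0 \<le> 0" by (rule field_le_epsilon) (simp add: *)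
  then show ?thesis using potential_nonneg[of 0] by simp
qed

end

section \<open>Bounded semigroups and their generators\<close>

locale bounded_semigroup =
  fixes T :: "real \<Rightarrow> 'b::banach \<Rightarrow>\<^sub>L 'b" and D :: "'b set" and L :: "'b \<Rightarrow> 'b"
  assumes semigroup: "strongly_continuous_semigroup T"
    and bounded: "uniformly_bounded T"
    and generator: "infinitesimal_generator T D L"
begin

definition K :: real where "K = max 1 (SUP t\<in>{0<..}. norm (T t))"

lemma K_ge_1: "K \<ge> 1" by (simp add: K_def)

lemma T_0: "T 0 x = x"
  using semigroup by (simp add: strongly_continuous_semigroup_def)

lemma T_add: "s \<ge> 0 \<Longrightarrow> t \<ge> 0 \<Longrightarrow> T (s + t) x = T s (T t x)"
  using semigroup by (simp add: strongly_continuous_semigroup_def)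

lemma norm_T_le: "t \<ge> 0 \<Longrightarrow> norm (T t) \<le> K"
proof (cases "t = 0")
  case True
  have "norm (T 0) \<le> 1" by (rule norm_blinfun_bound) (auto simp: T_0)
  then show ?thesis using True K_ge_1 by simp
next
  case False
  assume "t \<ge> 0"
  then have "norm (T t) \<le> (SUP t\<in>{0<..}. norm (T t))"
    using bounded False unfolding uniformly_bounded_def by (intro cSUP_upper) auto
  then show ?thesis by (simp add: K_def)
qed

lemma T_bound: "t \<ge> 0 \<Longrightarrow> norm (T t x) \<le> K * norm x"
  using norm_blinfun[of "T t" x] mult_right_mono[OF norm_T_le, of t "norm x"] by simp

lemma T_increment:
  assumes "s \<ge> 0" "h \<ge> 0" shows "norm (T (s + h) x - T s x) \<le> K * norm (T h x - x)"
  using T_bound[OF assms(1), of "T h x - x"] by (simp add: T_add[OF assms] blinfun.diff_right)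

text \<open>The orbit is frozen at negative times, which makes it a bounded uniformly continuous function on the line.\<close>

definition orbit :: "'b \<Rightarrow> real \<Rightarrow> 'b" where "orbit x r = T (max 0 r) x"

lemma orbit_bound: "norm (orbit x r) \<le> K * norm x"
  unfolding orbit_def by (rule T_bound) simp

lemma orbit_modulus:
  assumes "\<epsilon> > 0" shows "\<exists>d>0. \<forall>r s. \<bar>r - s\<bar> < d \<longrightarrow> norm (orbit x r - orbit x s) < \<epsilon>"
proof -
  have "((\<lambda>t. T t x) \<longlongrightarrow> x) (at_right 0)"
    using semigroup by (simp add: strongly_continuous_semigroup_def)
  from tendstoD[OF this, of "\<epsilon> / K"] assms K_ge_1
  obtain d where d: "d > 0" "\<And>h. 0 < h \<Longrightarrow> h < d \<Longrightarrow> norm (T h x - x) < \<epsilon> / K"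
    by (auto simp: eventually_at_right_field dist_norm)
  have *: "norm (orbit x (s + h) - orbit x s) < \<epsilon>" if "0 \<le> h" "h < d" for s h
  proof -
    define h' where "h' = max 0 (s + h) - max 0 s"
    have h': "0 \<le> h'" "h' < d" using that by (auto simp: h'_def max_def)
    have "norm (T h' x - x) < \<epsilon> / K"
      using d(2)[of h'] h' assms K_ge_1 by (cases "h' = 0") (auto simp: T_0)
    have "norm (orbit x (s + h) - orbit x s) = norm (T (max 0 s + h') x - T (max 0 s) x)"
      by (simp add: orbit_def h'_def)
    also have "\<dots> \<le> K * norm (T h' x - x)" by (rule T_increment) (use h' in auto)
    also have "\<dots> < K * (\<epsilon> / K)" using \<open>norm (T h' x - x) < \<epsilon> / K\<close> K_ge_1 by (intro mult_strict_left_mono) auto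
    finally show ?thesis using K_ge_1 by simp
  qed
  have "norm (orbit x r - orbit x s) < \<epsilon>" if "\<bar>r - s\<bar> < d" for r s
    using *[of "r - s" s] *[of "s - r" r] that by (cases "s \<le> r") (auto simp: norm_minus_commute)
  with d(1) show ?thesis by blast
qed

lemma orbit_continuous: "continuous_on UNIV (orbit x)"
  unfolding continuous_on_eq_continuous_at[OF open_UNIV] continuous_at_eps_delta
proof (intro ballI allI impI)
  fix t \<epsilon> :: real assume "\<epsilon> > 0"
  from orbit_modulus[OF this, of x] obtain d where "d > 0" "\<forall>r s. \<bar>r - s\<bar> < d \<longrightarrow> norm (orbit x r - orbit x s) < \<epsilon>" by blast
  then show "\<exists>d>0. \<forall>t'. dist t' t < d \<longrightarrow> dist (orbit x t') (orbit x t) < \<epsilon>"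
    by (intro exI[of _ d]) (auto simp: dist_norm)
qed

lemma generatorI: "((\<lambda>h. (T h x - x) /\<^sub>R h) \<longlongrightarrow> y) (at_right 0) \<Longrightarrow> x \<in> D \<and> L x = y"
proof -
  assume lim: "((\<lambda>h. (T h x - x) /\<^sub>R h) \<longlongrightarrow> y) (at_right 0)"
  have "x \<in> D" using generator lim unfolding infinitesimal_generator_def by auto
  moreover from this have "((\<lambda>h. (T h x - x) /\<^sub>R h) \<longlongrightarrow> L x) (at_right 0)"
    using generator unfolding infinitesimal_generator_def by simp
  ultimately show ?thesis using tendsto_unique[OF _ lim] by simp
qed

lemma generatorD: "x \<in> D \<Longrightarrow> ((\<lambda>h. (T h x - x) /\<^sub>R h) \<longlongrightarrow> L x) (at_right 0)"
  using generator unfolding infinitesimal_generator_def by simp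

lemma generator_diff:
  assumes "x \<in> D" "y \<in> D" shows "x - y \<in> D" "L (x - y) = L x - L y"
proof -
  have "((\<lambda>h. (T h x - x) /\<^sub>R h - (T h y - y) /\<^sub>R h) \<longlongrightarrow> L x - L y) (at_right 0)"
    by (intro tendsto_diff generatorD assms)
  then have "((\<lambda>h. (T h (x - y) - (x - y)) /\<^sub>R h) \<longlongrightarrow> L x - L y) (at_right 0)"
    by (simp add: blinfun.diff_right algebra_simps)
  from generatorI[OF this] show "x - y \<in> D" "L (x - y) = L x - L y" by auto
qed

lemma generator_remainder:
  assumes "x \<in> D" "\<epsilon> > 0"
  shows "\<exists>d>0. \<forall>h. 0 \<le> h \<and> h < d \<longrightarrow> norm (T h x - x - h *\<^sub>R L x) \<le> \<epsilon> * h"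
proof -
  from tendstoD[OF generatorD[OF assms(1)] assms(2)]
  obtain d where d: "d > 0" "\<And>h. 0 < h \<Longrightarrow> h < d \<Longrightarrow> norm ((T h x - x) /\<^sub>R h - L x) < \<epsilon>"
    by (auto simp: eventually_at_right_field dist_norm)
  have "norm (T h x - x - h *\<^sub>R L x) \<le> \<epsilon> * h" if "0 \<le> h" "h < d" for h
  proof (cases "h = 0")
    case False
    then have h: "h > 0" using that by simp
    have "T h x - x - h *\<^sub>R L x = h *\<^sub>R ((T h x - x) /\<^sub>R h - L x)"
      using h by (simp add: scaleR_diff_right)
    then have "norm (T h x - x - h *\<^sub>R L x) = h * norm ((T h x - x) /\<^sub>R h - L x)"
      using h by (simp only: norm_scaleR abs_of_pos)
    also have "\<dots> \<le> h * \<epsilon>" using d(2)[OF h that(2)] h by (intro mult_left_mono) auto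
    finally show ?thesis by (simp add: mult.commute)
  qed (simp add: T_0)
  with d(1) show ?thesis by blast
qed

text \<open>The defining limit is one-sided. The left derivative follows from the same remainder estimate with base point
  \<open>y < s\<close> in place of \<open>s\<close>, at the cost of replacing \<open>T y (L x)\<close> by \<open>T s (L x)\<close>.\<close>

lemma orbit_derivative:
  assumes x: "x \<in> D" and s: "s \<ge> 0"
  shows "((\<lambda>r. T r x) has_vector_derivative T s (L x)) (at s within {0..})"
  unfolding has_vector_derivative_def has_derivative_within_alt
proof (intro conjI allI impI)
  show "bounded_linear (\<lambda>h. h *\<^sub>R T s (L x))" by (rule bounded_linear_scaleR_left)
  fix e :: real assume e: "0 < e"
  have e': "0 < e / (2 * K)" using e K_ge_1 by simp
  obtain d1 where d1: "d1 > 0" "\<And>h. 0 \<le> h \<Longrightarrow> h < d1 \<Longrightarrow> norm (T h x - x - h *\<^sub>R L x) \<le> e / (2 * K) * h"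
    using generator_remainder[OF x e'] by auto
  obtain d2 where d2: "d2 > 0" "\<And>r s. \<bar>r - s\<bar> < d2 \<Longrightarrow> norm (orbit (L x) r - orbit (L x) s) < e / 2"
    using orbit_modulus[of "e / 2" "L x"] e by auto
  have est: "norm (T (a + h) x - T a x - h *\<^sub>R T a (L x)) \<le> e / 2 * h" if "a \<ge> 0" "0 \<le> h" "h < d1" for a h
  proof -
    have "T (a + h) x - T a x - h *\<^sub>R T a (L x) = T a (T h x - x - h *\<^sub>R L x)"
      using that by (simp add: T_add blinfun.diff_right blinfun.scaleR_right)
    also have "norm \<dots> \<le> K * norm (T h x - x - h *\<^sub>R L x)" by (rule T_bound) fact
    also have "\<dots> \<le> K * (e / (2 * K) * h)" using d1(2)[OF that(2,3)] K_ge_1 by (intro mult_left_mono) auto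
    also have "\<dots> = e / 2 * h" using K_ge_1 by simp
    finally show ?thesis .
  qed
  show "\<exists>d>0. \<forall>y\<in>{0..}. norm (y - s) < d \<longrightarrow> norm (T y x - T s x - (y - s) *\<^sub>R T s (L x)) \<le> e * norm (y - s)"
  proof (intro exI[of _ "min d1 d2"] conjI ballI impI)
    show "0 < min d1 d2" using d1 d2 by simp
    fix y assume y: "y \<in> {0..}" "norm (y - s) < min d1 d2"
    show "norm (T y x - T s x - (y - s) *\<^sub>R T s (L x)) \<le> e * norm (y - s)"
    proof (cases "s \<le> y")
      case True
      then have "norm (T y x - T s x - (y - s) *\<^sub>R T s (L x)) \<le> e / 2 * (y - s)"
        using est[of s "y - s"] y s by simp
      also have "\<dots> \<le> e * norm (y - s)" using e True by (simp add: mult_right_mono)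
      finally show ?thesis .
    next
      case False
      have "norm (T s x - T y x - (s - y) *\<^sub>R T y (L x)) \<le> e / 2 * (s - y)"
        using est[of y "s - y"] y False by simp
      moreover have "norm ((s - y) *\<^sub>R (T y (L x) - T s (L x))) \<le> e / 2 * (s - y)"
        using d2(2)[of y s] y s False by (simp add: orbit_def mult.commute mult_left_mono)
      moreover have "T y x - T s x - (y - s) *\<^sub>R T s (L x)
          = - (T s x - T y x - (s - y) *\<^sub>R T y (L x)) - (s - y) *\<^sub>R (T y (L x) - T s (L x))"
        by (simp add: algebra_simps)
      ultimately have "norm (T y x - T s x - (y - s) *\<^sub>R T s (L x)) \<le> e / 2 * (s - y) + e / 2 * (s - y)"
        using norm_triangle_ineq4[of "- (T s x - T y x - (s - y) *\<^sub>R T y (L x))" "(s - y) *\<^sub>R (T y (L x) - T s (L x))"]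
        by (simp only: norm_minus_cancel)
      then show ?thesis using False by simp
    qed
  qed
qed

lemma orbit_integral:
  assumes x: "x \<in> D" and s: "s \<ge> 0"
  shows "bint (leb 0 s) (orbit (L x)) = T s x - x"
proof -
  have d: "((\<lambda>r. T r x) has_vector_derivative orbit (L x) r) (at r within {0..})" if "r \<ge> 0" for r
    using orbit_derivative[OF x that] that by (simp add: orbit_def)
  have "bint (leb 0 s) (orbit (L x)) = T s x - T 0 x"
  proof (rule bint_leb_FTC[OF orbit_continuous orbit_bound s])
    show "continuous_on {0..s} (\<lambda>r. T r x)"
    proof (rule continuous_on_subset)
      show "continuous_on {0..} (\<lambda>r. T r x)"
        unfolding continuous_on_eq_continuous_within
        using has_vector_derivative_continuous[OF d] by simp
    qed auto
    show "((\<lambda>r. T r x) has_vector_derivative orbit (L x) r) (at r)" if "0 < r" for r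
    proof -
      have "((\<lambda>r. T r x) has_vector_derivative orbit (L x) r) (at r within {0<..})"
        by (rule has_vector_derivative_within_subset[OF d]) (use that in auto)
      then show ?thesis using at_within_open[of r "{0<..}"] that by simp
    qed
  qed
  then show ?thesis by (simp add: T_0)
qed

end

section \<open>Integrals against the law of the inverse\<close>

context subordinator_setting
begin

text \<open>Three measures in the level \<open>r\<close>, with densities \<open>F r t\<close>, its memory convolution, and the flux. By Tonelli, \<open>sojourn t A\<close> is
  the expected time in \<open>A\<close> that the subordinator spends at or below \<open>t\<close>.\<close>

definition sojourn :: "real \<Rightarrow> real measure" where
  "sojourn t = density lborel (\<lambda>r. ennreal (F r t) * indicator {0<..} r)"

definition memory_sojourn :: "real \<Rightarrow> real measure" where
  "memory_sojourn t = density lborel (\<lambda>r. conv r t * indicator {0<..} r)"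

definition flux_measure :: "real \<Rightarrow> real measure" where
  "flux_measure t = density lborel (\<lambda>r. flux r t * indicator {0<..} r)"

lemma sets_sojourn [simp, measurable_cong]: "sets (sojourn t) = sets borel" "sets (memory_sojourn t) = sets borel" "sets (flux_measure t) = sets borel"
  by (simp_all add: sojourn_def memory_sojourn_def flux_measure_def)

lemma emeasure_sojourn: "A \<in> sets borel \<Longrightarrow>
    emeasure (sojourn t) A = (\<integral>\<^sup>+r. ennreal (F r t) * indicator ({0<..} \<inter> A) r \<partial>lborel)"
  unfolding sojourn_def by (subst emeasure_density) (auto simp: indicator_inter_arith mult.assoc)

lemma emeasure_memory_sojourn: "A \<in> sets borel \<Longrightarrow>
    emeasure (memory_sojourn t) A = (\<integral>\<^sup>+r. conv r t * indicator ({0<..} \<inter> A) r \<partial>lborel)"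
  unfolding memory_sojourn_def by (subst emeasure_density) (auto simp: indicator_inter_arith mult.assoc)

lemma emeasure_flux_measure: "A \<in> sets borel \<Longrightarrow>
    emeasure (flux_measure t) A = (\<integral>\<^sup>+r. flux r t * indicator ({0<..} \<inter> A) r \<partial>lborel)"
  unfolding flux_measure_def by (subst emeasure_density) (auto simp: indicator_inter_arith mult.assoc)

lemma emeasure_sojourn_UNIV: "emeasure (sojourn t) UNIV = ennreal (potential t)"
  by (simp add: emeasure_sojourn potential_nn_def flip: potential_nn_eq)

lemma emeasure_sojourn_nonpos:
  assumes "t \<le> 0" shows "emeasure (sojourn t) A = 0"
proof -
  have "emeasure (sojourn t) A \<le> emeasure (sojourn t) UNIV" by (rule emeasure_mono) auto
  moreover have "potential t = 0" using potential_mono[OF assms] potential_nonneg[of t] potential_0 by simp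
  ultimately show ?thesis by (simp add: emeasure_sojourn_UNIV)
qed

lemma finite_sojourn: "finite_measure (sojourn t)"
  by (rule finite_measureI) (simp add: sojourn_def emeasure_sojourn_UNIV[unfolded sojourn_def])

lemma emeasure_sojourn_measurable: "A \<in> sets borel \<Longrightarrow> (\<lambda>t. emeasure (sojourn t) A) \<in> borel_measurable borel"
  by (simp add: emeasure_sojourn)

lemma emeasure_flux_measure_eq:
  assumes [measurable]: "A \<in> sets borel"
  shows "emeasure (flux_measure t) A = ennreal \<kappa> * emeasure (sojourn t) A + emeasure (memory_sojourn t) A"
  by (simp add: emeasure_flux_measure emeasure_memory_sojourn emeasure_sojourn flux_def distrib_right nn_integral_add nn_integral_cmult mult.assoc)

lemma emeasure_memory_sojourn_eq:
  assumes [measurable]: "A \<in> sets borel"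
  shows "emeasure (memory_sojourn t) A = (\<integral>\<^sup>+s. ennreal (w (t - s)) * emeasure (sojourn s) A \<partial>lborel)"
proof -
  have "emeasure (memory_sojourn t) A = (\<integral>\<^sup>+s. ennreal (w s) * emeasure (sojourn (t - s)) A \<partial>lborel)"
    by (simp add: emeasure_memory_sojourn nn_integral_conv emeasure_sojourn)
  also have "\<dots> = ennreal \<bar>-1\<bar> * (\<integral>\<^sup>+s. ennreal (w (t + (-1) * s)) * emeasure (sojourn (t - (t + (-1) * s))) A \<partial>lborel)"
  proof (rule nn_integral_real_affine)
    have [measurable]: "(\<lambda>s. emeasure (sojourn (t - s)) A) \<in> borel_measurable borel"
      by (rule measurable_compose[OF _ emeasure_sojourn_measurable[OF assms]]) measurable
    show "(\<lambda>s. ennreal (w s) * emeasure (sojourn (t - s)) A) \<in> borel_measurable borel" by measurable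
  qed simp
  finally show ?thesis by simp
qed

lemma emeasure_flux_measure_UNIV: "emeasure (flux_measure t) UNIV = ennreal t"
  using tail_identity[of 0 t] by (simp add: emeasure_flux_measure tail_mass_0)

lemma finite_flux_measure: "finite_measure (flux_measure t)"
  by (rule finite_measureI) (simp add: flux_measure_def emeasure_flux_measure_UNIV[unfolded flux_measure_def])

lemma finite_memory_sojourn: "finite_measure (memory_sojourn t)"
proof (rule finite_measureI)
  have "emeasure (memory_sojourn t) UNIV \<le> emeasure (flux_measure t) UNIV" by (simp add: emeasure_flux_measure_eq)
  then have "emeasure (memory_sojourn t) UNIV < \<infinity>" unfolding emeasure_flux_measure_UNIV by (rule le_less_trans) simp
  then show "emeasure (memory_sojourn t) (space (memory_sojourn t)) \<noteq> \<infinity>" by (simp add: memory_sojourn_def)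
qed

lemma finite_nu: "finite_measure (nu t)"
  using prob_space_nu prob_space.finite_measure by blast

lemma measure_nu_UNIV: "measure (nu t) UNIV = 1"
  using prob_space.prob_space[OF prob_space_nu, of t] sets_eq_imp_space_eq[OF sets_nu, of t] by simp

text \<open>\<open>tail_identity\<close> as an equality of measures: both sides agree on the half-lines \<open>{x<..}\<close>.\<close>

lemma flux_measure_mixture:
  assumes A: "A \<in> sets borel"
  shows "(\<integral>\<^sup>+s. emeasure (nu s) A \<partial>leb 0 t) = emeasure (flux_measure t) A"
proof -
  have K: "nu \<in> measurable (leb 0 t) (subprob_algebra borel)"
    using measurable_prob_algebraD[OF nu_kernel] by (simp add: measurable_cong_sets[OF sets_leb refl])
  have sp: "space (leb 0 t) \<noteq> {}" by (simp add: leb_def)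
  define N where "N = leb 0 t \<bind> nu"
  have sN: "sets N = sets borel" unfolding N_def using sp by (intro sets_bind) simp_all
  have eN: "emeasure N A = (\<integral>\<^sup>+s. emeasure (nu s) A \<partial>leb 0 t)" if "A \<in> sets borel" for A
    unfolding N_def using emeasure_bind[OF sp K that] .
  have tail: "emeasure N {a<..} = tail_mass a t" if "a \<ge> 0" for a
  proof -
    have "emeasure N {a<..} = (\<integral>\<^sup>+s. emeasure (nu s) {a<..} * indicator {0<..<t} s \<partial>lborel)"
      by (simp add: eN nn_integral_leb nu_measurable)
    also have "\<dots> = tail_mass a t"
      unfolding tail_mass_def
    proof (rule nn_integral_cong_AE)
      show "AE s in lborel. emeasure (nu s) {a<..} * indicator {0<..<t} s = ennreal (F a s) * indicator {0<..<t} s"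
        using nu_tail_eq_F_AE_time[OF that]
        by eventually_elim (auto simp: indicator_def finite_measure.emeasure_eq_measure[OF finite_nu])
    qed
    finally show ?thesis .
  qed
  have "flux_measure t = N"
  proof (rule measure_eqI_lessThan)
    show "emeasure (flux_measure t) {x<..} < \<infinity>" for x
      using finite_measure.emeasure_finite[OF finite_flux_measure, of t "{x<..}"] by (simp add: less_top)
    show "emeasure (flux_measure t) {x<..} = emeasure N {x<..}" for x
    proof (cases "x \<ge> 0")
      case True
      then have "{0<..} \<inter> {x<..} = {x<..}" by auto
      then show ?thesis using tail[OF True] tail_identity[OF True] by (simp add: emeasure_flux_measure)
    next
      case False
      then have x: "{0<..} \<inter> {x<..} = {0<..}" by auto
      have "emeasure N {x<..} = (\<integral>\<^sup>+s. emeasure (nu s) {x<..} * indicator {0<..<t} s \<partial>lborel)"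
        by (simp add: eN nn_integral_leb nu_measurable)
      also have "\<dots> = (\<integral>\<^sup>+s. indicator {0<..<t} s \<partial>lborel)"
      proof (rule nn_integral_cong)
        fix s :: real
        have "emeasure (nu s) {x<..} = 1" if "s \<ge> 0"
        proof -
          have "AE r in nu s. r \<in> {x<..}" using nu_nonneg_AE[OF that] by eventually_elim (use False in auto)
          then show ?thesis using prob_space.emeasure_eq_1_AE[OF prob_space_nu, of "{x<..}" s] by simp
        qed
        then show "emeasure (nu s) {x<..} * indicator {0<..<t} s = indicator {0<..<t} s" by (auto simp: indicator_def)
      qed
      also have "\<dots> = ennreal t" by (cases "t \<ge> 0") (auto simp: ennreal_neg)
      finally show ?thesis using tail_identity[of 0 t] by (simp add: emeasure_flux_measure x tail_mass_0)
    qed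
  qed (simp_all add: sN)
  then show ?thesis using eN[OF A] by simp
qed

text \<open>The law of the inverse lives on a restricted space. As a mixture of point masses over that space it is the measure
  \<open>nu t\<close> on the whole line.\<close>

lemma strong_integral_inverse_law:
  fixes \<phi> :: "real \<Rightarrow> 'b::banach"
  assumes \<phi>: "continuous_on UNIV \<phi>" "\<And>r. norm (\<phi> r) \<le> C" and t: "t \<ge> 0"
  shows "strong_integral (inverse_law M S t) \<phi> (bint (nu t) \<phi>)"
proof -
  have il: "inverse_law M S t = restrict_space (nu t) {0..}" by (simp add: inverse_law_def nu_def)
  have "strong_integral (inverse_law M S t) (\<lambda>s. bint (return borel s) \<phi>) (bint (nu t) \<phi>)"
  proof (rule strong_integral_mixture[OF \<phi>])
    fix A :: "real set" assume A: "A \<in> sets borel"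
    have "(\<lambda>s. indicator A s :: ennreal) \<in> borel_measurable (nu t)" using A by simp
    then show "(\<lambda>s. emeasure (return borel s) A) \<in> borel_measurable (inverse_law M S t)"
      using A unfolding il by (simp add: measurable_restrict_space1)
    have "(\<integral>\<^sup>+s. emeasure (return borel s) A \<partial>inverse_law M S t) = (\<integral>\<^sup>+s. indicator A s * indicator {0..} s \<partial>nu t)"
      using A unfolding il by (subst nn_integral_restrict_space) auto
    also have "\<dots> = (\<integral>\<^sup>+s. indicator A s \<partial>nu t)"
      using nu_nonneg_AE[OF t] by (intro nn_integral_cong_AE) (auto elim!: eventually_mono)
    finally show "(\<integral>\<^sup>+s. emeasure (return borel s) A \<partial>inverse_law M S t) = emeasure (nu t) A" using A by simp
  qed (auto simp: finite_nu prob_space.finite_measure prob_space_return)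
  then show ?thesis by (simp add: bint_return[OF \<phi>])
qed

text \<open>Integration by parts: \<open>G s - G 0\<close> is the integral of \<open>\<phi>\<close> over \<open>0 < r < s\<close>, and mixing these intervals over the law of
  \<open>E t\<close> gives density \<open>F r t\<close> at almost every level \<open>r\<close>.\<close>

lemma bint_nu_by_parts:
  fixes G \<phi> :: "real \<Rightarrow> 'b::banach"
  assumes \<phi>: "continuous_on UNIV \<phi>" "\<And>r. norm (\<phi> r) \<le> C" and G: "continuous_on UNIV G" "\<And>r. norm (G r) \<le> C'"
    and int: "\<And>s. s \<ge> 0 \<Longrightarrow> bint (leb 0 s) \<phi> = G s - G 0" and neg: "\<And>s. s < 0 \<Longrightarrow> G s = G 0"
    and t: "t \<ge> 0"
  shows "bint (nu t) G = G 0 + bint (sojourn t) \<phi>"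
proof -
  have null: "bint (leb 0 s) \<phi> = 0" if "s < 0" for s
    using that by (intro bint_null[OF \<phi> finite_leb sets_leb]) (simp add: emeasure_leb)
  have "strong_integral (nu t) (\<lambda>s. bint (leb 0 s) \<phi>) (bint (sojourn t) \<phi>)"
  proof (rule strong_integral_mixture[OF \<phi>])
    fix A :: "real set" assume A[measurable]: "A \<in> sets borel"
    have "(\<lambda>s. \<integral>\<^sup>+r. indicator A r * (if 0 < r \<and> r < s then 1 else 0) \<partial>lborel) \<in> borel_measurable borel" by measurable
    moreover have eq: "emeasure (leb 0 s) A = (\<integral>\<^sup>+r. indicator A r * (if 0 < r \<and> r < s then 1 else 0) \<partial>lborel)" for s
    proof -
      have "emeasure (leb 0 s) A = (\<integral>\<^sup>+r. indicator (A \<inter> {0<..<s}) r \<partial>lborel)" by (simp add: emeasure_leb)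
      also have "\<dots> = (\<integral>\<^sup>+r. indicator A r * (if 0 < r \<and> r < s then 1 else 0) \<partial>lborel)"
        by (intro nn_integral_cong) (auto simp: indicator_def)
      finally show ?thesis .
    qed
    ultimately show "(\<lambda>s. emeasure (leb 0 s) A) \<in> borel_measurable (nu t)" by simp
    interpret N: prob_space "nu t" by (rule prob_space_nu)
    interpret P: pair_sigma_finite lborel "nu t" ..
    have "(\<integral>\<^sup>+s. emeasure (leb 0 s) A \<partial>nu t) = (\<integral>\<^sup>+r. \<integral>\<^sup>+s. indicator A r * (if 0 < r \<and> r < s then 1 else 0) \<partial>nu t \<partial>lborel)"
      unfolding eq by (rule P.Fubini') measurable
    also have "\<dots> = (\<integral>\<^sup>+r. ennreal (F r t) * indicator ({0<..} \<inter> A) r \<partial>lborel)"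
    proof (rule nn_integral_cong_AE)
      show "AE r in lborel. (\<integral>\<^sup>+s. indicator A r * (if 0 < r \<and> r < s then 1 else 0) \<partial>nu t) = ennreal (F r t) * indicator ({0<..} \<inter> A) r"
        using nu_tail_eq_F_AE_level[OF t]
      proof eventually_elim
        case (elim r)
        have "(\<integral>\<^sup>+s. indicator A r * (if 0 < r \<and> r < s then 1 else 0) \<partial>nu t) = (\<integral>\<^sup>+s. indicator ({0<..} \<inter> A) r * indicator {r<..} s \<partial>nu t)"
          by (intro nn_integral_cong) (auto simp: indicator_def)
        also have "\<dots> = indicator ({0<..} \<inter> A) r * ennreal (measure (nu t) {r<..})"
          by (simp add: nn_integral_cmult_indicator N.emeasure_eq_measure)
        finally show ?case using elim by (auto simp: indicator_def)
      qed
    qed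
    finally show "(\<integral>\<^sup>+s. emeasure (leb 0 s) A \<partial>nu t) = emeasure (sojourn t) A" by (simp add: emeasure_sojourn)
  qed (auto simp: finite_leb finite_sojourn)
  moreover have "(\<lambda>s. bint (leb 0 s) \<phi>) = (\<lambda>s. G s - G 0)"
    using int null neg by (metis linorder_not_le diff_self)
  ultimately have "strong_integral (nu t) (\<lambda>s. G s - G 0) (bint (sojourn t) \<phi>)" by simp
  from bint_eq[OF this] have "bint (sojourn t) \<phi> = bint (nu t) G - bint (nu t) (\<lambda>_. G 0)"
    using bint_diff[OF G, of "\<lambda>_. G 0" "norm (G 0)" "nu t"] by (simp add: finite_nu)
  also have "bint (nu t) (\<lambda>_. G 0) = G 0"
    by (simp add: bint_const finite_nu measure_nu_UNIV)
  finally show ?thesis by simp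
qed

text \<open>The density \<open>F r t\<close> increases with \<open>t\<close>, so the difference of the two measures is a measure, of mass the increment of the
  potential.\<close>

lemma bint_sojourn_increment:
  fixes \<phi> :: "real \<Rightarrow> 'b::banach"
  assumes \<phi>: "continuous_on UNIV \<phi>" "\<And>r. norm (\<phi> r) \<le> C" and st: "s \<le> t"
  shows "norm (bint (sojourn t) \<phi> - bint (sojourn s) \<phi>) \<le> C * (potential t - potential s)"
proof -
  define \<rho> where "\<rho> = density lborel (\<lambda>r. ennreal (F r t - F r s) * indicator {0<..} r)"
  have [simp]: "sets \<rho> = sets borel" by (simp add: \<rho>_def)
  have e: "emeasure (sojourn t) A = emeasure (sojourn s) A + emeasure \<rho> A" if [measurable]: "A \<in> sets borel" for A
  proof -
    have "emeasure \<rho> A = (\<integral>\<^sup>+r. ennreal (F r t - F r s) * indicator ({0<..} \<inter> A) r \<partial>lborel)"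
      unfolding \<rho>_def by (subst emeasure_density) (auto simp: indicator_inter_arith mult.assoc)
    then have "emeasure (sojourn s) A + emeasure \<rho> A
       = (\<integral>\<^sup>+r. ennreal (F r s) * indicator ({0<..} \<inter> A) r + ennreal (F r t - F r s) * indicator ({0<..} \<inter> A) r \<partial>lborel)"
      by (simp add: emeasure_sojourn nn_integral_add)
    also have "\<dots> = emeasure (sojourn t) A"
      unfolding emeasure_sojourn[OF that]
    proof (rule nn_integral_cong)
      fix r
      have "ennreal (F r t) = ennreal (F r s) + ennreal (F r t - F r s)"
        using F_mono[OF st, of r] F_nonneg[of r s] by (simp flip: ennreal_plus)
      then show "ennreal (F r s) * indicator ({0<..} \<inter> A) r + ennreal (F r t - F r s) * indicator ({0<..} \<inter> A) r
        = ennreal (F r t) * indicator ({0<..} \<inter> A) r" by (simp add: distrib_right)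
    qed
    finally show ?thesis ..
  qed
  have fin: "finite_measure \<rho>"
  proof (rule finite_measureI)
    have "emeasure \<rho> UNIV \<le> emeasure (sojourn t) UNIV" using e[of UNIV] by simp
    then have "emeasure \<rho> UNIV < \<infinity>" unfolding emeasure_sojourn_UNIV by (rule le_less_trans) simp
    then show "emeasure \<rho> (space \<rho>) \<noteq> \<infinity>" by (simp add: \<rho>_def)
  qed
  have "ennreal (potential t) = ennreal (potential s + measure \<rho> UNIV)"
    using e[of UNIV] potential_nonneg by (simp add: emeasure_sojourn_UNIV finite_measure.emeasure_eq_measure[OF fin])
  then have m: "measure \<rho> UNIV = potential t - potential s" using potential_nonneg by (subst (asm) ennreal_inj) auto
  have "bint (sojourn t) \<phi> = bint (sojourn s) \<phi> + bint \<rho> \<phi>"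
    by (rule bint_add_measure[OF \<phi>]) (auto simp: finite_sojourn fin e)
  then show ?thesis using bint_norm_le[OF \<phi> fin] m by simp
qed

lemma bint_sojourn_nonpos:
  fixes \<phi> :: "real \<Rightarrow> 'b::banach"
  assumes \<phi>: "continuous_on UNIV \<phi>" "\<And>r. norm (\<phi> r) \<le> C" and t: "t \<le> 0"
  shows "bint (sojourn t) \<phi> = 0"
proof (rule bint_null[OF \<phi> finite_sojourn])
  have "potential t = 0" using potential_mono[OF t] potential_nonneg[of t] potential_0 by simp
  then show "emeasure (sojourn t) UNIV = 0" by (simp add: emeasure_sojourn_UNIV)
qed simp

lemma bint_sojourn_continuous:
  fixes \<phi> :: "real \<Rightarrow> 'b::banach"
  assumes \<phi>: "continuous_on UNIV \<phi>" "\<And>r. norm (\<phi> r) \<le> C"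
  shows "continuous_on UNIV (\<lambda>t. bint (sojourn t) \<phi>)"
  unfolding continuous_on_iff
proof (intro ballI allI impI)
  fix x \<epsilon> :: real assume e: "\<epsilon> > 0"
  have C: "C \<ge> 0" using \<phi>(2)[of 0] norm_ge_zero order_trans by blast
  have e': "\<epsilon> / (C + 1) > 0" using e C by simp
  obtain h where h: "h > 0" "\<forall>s t. s \<le> t \<and> t < s + h \<longrightarrow> potential t - potential s < \<epsilon> / (C + 1)"
    using potential_modulus[OF e'] by blast
  have main: "norm (bint (sojourn t) \<phi> - bint (sojourn s) \<phi>) < \<epsilon>" if "s \<le> t" "t < s + h" for s t
  proof -
    have "norm (bint (sojourn t) \<phi> - bint (sojourn s) \<phi>) \<le> C * (potential t - potential s)" by (rule bint_sojourn_increment[OF \<phi> that(1)])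
    also have "\<dots> \<le> C * (\<epsilon> / (C + 1))"
      using h(2)[rule_format, of s t] that C by (intro mult_left_mono) auto
    also have "\<dots> < \<epsilon>" using e C by (simp add: field_simps)
    finally show ?thesis .
  qed
  show "\<exists>d>0. \<forall>y\<in>UNIV. dist y x < d \<longrightarrow> dist (bint (sojourn y) \<phi>) (bint (sojourn x) \<phi>) < \<epsilon>"
  proof (intro exI[of _ h] conjI ballI impI h(1))
    fix y assume "dist y x < h"
    then show "dist (bint (sojourn y) \<phi>) (bint (sojourn x) \<phi>) < \<epsilon>"
      using main[of x y] main[of y x] by (cases "x \<le> y") (auto simp: dist_norm norm_minus_commute)
  qed
qed

lemma bint_nu_bound:
  fixes \<phi> :: "real \<Rightarrow> 'b::banach"
  assumes \<phi>: "continuous_on UNIV \<phi>" "\<And>r. norm (\<phi> r) \<le> C"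
  shows "norm (bint (nu t) \<phi>) \<le> C"
  using bint_norm_le[OF \<phi> finite_nu sets_nu, of t] by (simp add: measure_nu_UNIV)

text \<open>Replace \<open>\<phi>\<close> by its moving average \<open>G\<close> over an interval of length \<open>d\<close>. This is uniformly close to \<open>\<phi>\<close> and continuously
  differentiable, so by parts its mean is an integral against \<open>sojourn t\<close>, which is continuous in \<open>t\<close>. The lemma is
  meant for orbits of arbitrary vectors, which are uniformly continuous but in general not differentiable.\<close>

lemma bint_nu_continuous:
  fixes \<phi> :: "real \<Rightarrow> 'b::banach"
  assumes \<phi>: "continuous_on UNIV \<phi>" "\<And>r. norm (\<phi> r) \<le> C"
    and uc: "\<And>\<epsilon>. \<epsilon> > 0 \<Longrightarrow> \<exists>d>0. \<forall>r s. \<bar>r - s\<bar> < d \<longrightarrow> norm (\<phi> r - \<phi> s) < \<epsilon>"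
    and neg: "\<And>r. r < 0 \<Longrightarrow> \<phi> r = \<phi> 0"
  shows "continuous_on {0..} (\<lambda>t. bint (nu t) \<phi>)"
proof (rule continuous_on_uniform_approx)
  fix \<epsilon> :: real assume e: "\<epsilon> > 0"
  have C: "C \<ge> 0" using \<phi>(2)[of 0] norm_ge_zero order_trans by blast
  obtain d where d: "d > 0" "\<And>r s. \<bar>r - s\<bar> < d \<Longrightarrow> norm (\<phi> r - \<phi> s) < \<epsilon>" using uc[OF e] by auto
  define Z where "Z x = bint (leb 0 x) \<phi>" for x
  define G where "G s = (1 / d) *\<^sub>R (Z (max 0 s + d) - Z (max 0 s))" for s
  define \<psi> where "\<psi> r = (1 / d) *\<^sub>R (\<phi> (max 0 r + d) - \<phi> (max 0 r))" for r
  have Zc: "continuous_on {0..} Z" unfolding Z_def by (rule bint_leb_continuous[OF \<phi>])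
  have Zd: "(Z has_vector_derivative \<phi> x) (at x)" if "x > 0" for x
    unfolding Z_def by (rule bint_leb_at[OF \<phi> that])
  have Gc: "continuous_on UNIV G"
    unfolding G_def using d(1)
    by (intro continuous_intros continuous_on_compose2[OF Zc]) auto
  have \<psi>c: "continuous_on UNIV \<psi>"
    unfolding \<psi>_def by (intro continuous_intros continuous_on_compose2[OF \<phi>(1)]) auto
  have \<psi>b: "norm (\<psi> r) \<le> (1 / d) * (C + C)" for r
    unfolding \<psi>_def norm_scaleR using d(1) norm_triangle_ineq4[of "\<phi> (max 0 r + d)" "\<phi> (max 0 r)"] \<phi>(2)[of "max 0 r + d"] \<phi>(2)[of "max 0 r"]
    by (intro mult_mono) auto
  have near: "norm (G s - \<phi> s) \<le> \<epsilon>" for s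
  proof -
    let ?s = "max 0 s"
    have ps: "\<phi> s = \<phi> ?s" using neg[of s] by (cases "s < 0") auto
    have "norm (bint (leb ?s (?s + d)) \<phi> - (?s + d - ?s) *\<^sub>R \<phi> ?s) \<le> \<epsilon> * (?s + d - ?s)"
      by (rule bint_leb_mean[OF \<phi>]) (use d e less_imp_le[OF d(2)] in auto)
    moreover have "Z (?s + d) - Z ?s = bint (leb ?s (?s + d)) \<phi>"
      unfolding Z_def using bint_leb_split[OF \<phi>, of 0 ?s "?s + d"] d(1) by simp
    ultimately have 1: "norm (Z (?s + d) - Z ?s - d *\<^sub>R \<phi> s) \<le> \<epsilon> * d" by (simp add: ps)
    have "G s - \<phi> s = (1 / d) *\<^sub>R (Z (?s + d) - Z ?s - d *\<^sub>R \<phi> s)"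
      unfolding G_def using d(1) by (simp add: scaleR_diff_right)
    then have "norm (G s - \<phi> s) = (1 / d) * norm (Z (?s + d) - Z ?s - d *\<^sub>R \<phi> s)"
      using d(1) by (simp only: norm_scaleR) simp
    also have "\<dots> \<le> (1 / d) * (\<epsilon> * d)" using 1 d(1) by (intro mult_left_mono) auto
    finally show ?thesis using d(1) by simp
  qed
  have Gb: "norm (G s) \<le> C + \<epsilon>" for s
    using norm_triangle_ineq[of "G s - \<phi> s" "\<phi> s"] near[of s] \<phi>(2)[of s] by simp
  have int: "bint (leb 0 s) \<psi> = G s - G 0" if s: "s \<ge> 0" for s
  proof (rule bint_leb_FTC[OF \<psi>c \<psi>b s])
    show "continuous_on {0..s} G" by (rule continuous_on_subset[OF Gc]) simp
    fix x assume x: "0 < x" "x < s"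
    have "((\<lambda>s. Z (s + d)) has_vector_derivative \<phi> (x + d)) (at x)"
    proof -
      have "((\<lambda>s. s + d) has_vector_derivative 1) (at x)"
        unfolding has_real_derivative_iff_has_vector_derivative[symmetric] by (auto intro!: derivative_eq_intros)
      then show ?thesis
        using vector_diff_chain_at[of "\<lambda>s. s + d" 1 x Z "\<phi> (x + d)"] Zd[of "x + d"] x d(1) by (simp add: o_def)
    qed
    then have "((\<lambda>s. (1 / d) *\<^sub>R (Z (s + d) - Z s)) has_vector_derivative (1 / d) *\<^sub>R (\<phi> (x + d) - \<phi> x)) (at x)"
      using Zd[OF x(1)] by (auto intro!: derivative_eq_intros)
    then have "((\<lambda>s. (1 / d) *\<^sub>R (Z (s + d) - Z s)) has_vector_derivative \<psi> x) (at x)"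
      using x by (simp add: \<psi>_def max_def)
    then show "(G has_vector_derivative \<psi> x) (at x)"
      by (rule has_vector_derivative_transform_within_open[where S="{0<..}"]) (use x in \<open>auto simp: G_def max_def\<close>)
  qed
  have eq: "bint (nu t) G = G 0 + bint (sojourn t) \<psi>" if "t \<ge> 0" for t
    by (rule bint_nu_by_parts[OF \<psi>c \<psi>b Gc Gb int _ that]) (auto simp: G_def max_def)
  show "\<exists>g. continuous_on {0..} g \<and> (\<forall>x\<in>{0..}. dist (g x) (bint (nu x) \<phi>) \<le> \<epsilon>)"
  proof (intro exI[of _ "\<lambda>t. G 0 + bint (sojourn t) \<psi>"] conjI ballI)
    show "continuous_on {0..} (\<lambda>t. G 0 + bint (sojourn t) \<psi>)"
      by (intro continuous_intros continuous_on_subset[OF bint_sojourn_continuous[OF \<psi>c \<psi>b]]) simp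
    fix t :: real assume t: "t \<in> {0..}"
    have "bint (nu t) G - bint (nu t) \<phi> = bint (nu t) (\<lambda>r. G r - \<phi> r)"
      by (rule bint_diff[OF Gc Gb \<phi> finite_nu sets_nu, symmetric])
    moreover have "norm (bint (nu t) (\<lambda>r. G r - \<phi> r)) \<le> \<epsilon>"
      by (rule bint_nu_bound) (auto intro!: continuous_intros Gc \<phi>(1) near)
    ultimately show "dist (G 0 + bint (sojourn t) \<psi>) (bint (nu t) \<phi>) \<le> \<epsilon>"
      using eq t by (simp add: dist_norm)
  qed
qed

lemma memory_kernel_integral:
  fixes \<phi> :: "real \<Rightarrow> 'b::banach"
  assumes \<phi>: "continuous_on UNIV \<phi>" "\<And>r. norm (\<phi> r) \<le> C"
  shows "strong_integral (restrict_space lborel {0<..<t}) (\<lambda>s. w (t - s) *\<^sub>R bint (sojourn s) \<phi>) (bint (memory_sojourn t) \<phi>)"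
proof -
  have "strong_integral (restrict_space lborel {0<..<t}) (\<lambda>s. bint (scale_measure (ennreal (w (t - s))) (sojourn s)) \<phi>) (bint (memory_sojourn t) \<phi>)"
  proof (rule strong_integral_mixture[OF \<phi>])
    fix A :: "real set" assume A[measurable]: "A \<in> sets borel"
    have m: "(\<lambda>s. ennreal (w (t - s)) * emeasure (sojourn s) A) \<in> borel_measurable borel"
      using emeasure_sojourn_measurable[OF A] by measurable
    then show "(\<lambda>s. emeasure (scale_measure (ennreal (w (t - s))) (sojourn s)) A) \<in> borel_measurable (restrict_space lborel {0<..<t})"
      by (simp add: measurable_restrict_space1)
    have "(\<integral>\<^sup>+s. emeasure (scale_measure (ennreal (w (t - s))) (sojourn s)) A \<partial>restrict_space lborel {0<..<t})
       = (\<integral>\<^sup>+s. ennreal (w (t - s)) * emeasure (sojourn s) A * indicator {0<..<t} s \<partial>lborel)"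
      by (subst nn_integral_restrict_space) auto
    also have "\<dots> = (\<integral>\<^sup>+s. ennreal (w (t - s)) * emeasure (sojourn s) A \<partial>lborel)"
    proof (rule nn_integral_cong)
      fix s
      show "ennreal (w (t - s)) * emeasure (sojourn s) A * indicator {0<..<t} s = ennreal (w (t - s)) * emeasure (sojourn s) A"
        by (cases "s \<le> 0"; cases "s < t") (auto simp: w_nonpos_arg emeasure_sojourn_nonpos)
    qed
    finally show "(\<integral>\<^sup>+s. emeasure (scale_measure (ennreal (w (t - s))) (sojourn s)) A \<partial>restrict_space lborel {0<..<t})
       = emeasure (memory_sojourn t) A" by (simp add: emeasure_memory_sojourn_eq)
  qed (auto simp: finite_scale_measure finite_sojourn finite_memory_sojourn)
  then show ?thesis by (simp add: bint_scale_measure[OF \<phi> finite_sojourn] w_nonneg)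
qed

lemma bint_flux_measure_eq:
  fixes \<phi> :: "real \<Rightarrow> 'b::banach"
  assumes \<phi>: "continuous_on UNIV \<phi>" "\<And>r. norm (\<phi> r) \<le> C"
  shows "bint (flux_measure t) \<phi> = \<kappa> *\<^sub>R bint (sojourn t) \<phi> + bint (memory_sojourn t) \<phi>"
proof -
  have "bint (flux_measure t) \<phi> = bint (scale_measure (ennreal \<kappa>) (sojourn t)) \<phi> + bint (memory_sojourn t) \<phi>"
    by (rule bint_add_measure[OF \<phi>]) (auto simp: finite_scale_measure finite_sojourn finite_memory_sojourn finite_flux_measure emeasure_flux_measure_eq)
  then show ?thesis by (simp add: bint_scale_measure[OF \<phi> finite_sojourn] kappa_nonneg)
qed

lemma bint_flux_measure_mixture:
  fixes \<phi> :: "real \<Rightarrow> 'b::banach"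
  assumes \<phi>: "continuous_on UNIV \<phi>" "\<And>r. norm (\<phi> r) \<le> C"
  shows "bint (flux_measure t) \<phi> = bint (leb 0 t) (\<lambda>s. bint (nu (max 0 s)) \<phi>)"
proof -
  have "strong_integral (leb 0 t) (\<lambda>s. bint (nu (max 0 s)) \<phi>) (bint (flux_measure t) \<phi>)"
  proof (rule strong_integral_mixture[OF \<phi>])
    fix A :: "real set" assume A: "A \<in> sets borel"
    have m: "(\<lambda>s. emeasure (nu (max 0 s)) A) \<in> borel_measurable borel"
      by (rule measurable_compose[OF _ nu_measurable[OF A]]) simp
    then show "(\<lambda>s. emeasure (nu (max 0 s)) A) \<in> borel_measurable (leb 0 t)"
      by (simp add: measurable_cong_sets[OF sets_leb refl])
    have "(\<integral>\<^sup>+s. emeasure (nu (max 0 s)) A \<partial>leb 0 t) = (\<integral>\<^sup>+s. emeasure (nu s) A \<partial>leb 0 t)"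
      unfolding nn_integral_leb[OF m] nn_integral_leb[OF nu_measurable[OF A]]
      by (intro nn_integral_cong) (auto simp: indicator_def)
    then show "(\<integral>\<^sup>+s. emeasure (nu (max 0 s)) A \<partial>leb 0 t) = emeasure (flux_measure t) A" by (simp add: flux_measure_mixture[OF A])
  qed (auto simp: finite_nu finite_flux_measure)
  then show ?thesis by (rule bint_eq[symmetric])
qed

end

section \<open>Existence\<close>

text \<open>A product of a measurable scalar function and a continuous vector function is Borel: it factors through the plane, as a
  measurable map followed by a continuous one.\<close>

lemma memory_integrand_measurable:
  fixes v :: "real \<Rightarrow> 'b::banach"
  assumes w: "w \<in> borel_measurable borel" and v: "continuous_on {0..} v"
  shows "(\<lambda>s. w (t - s) *\<^sub>R (v s - f)) \<in> borel_measurable (restrict_space lborel {0<..<t})"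
proof -
  have c: "continuous_on UNIV (\<lambda>p::real \<times> real. fst p *\<^sub>R (v (max 0 (snd p)) - f))"
    by (intro continuous_intros continuous_on_compose2[OF v]) auto
  have [measurable]: "w \<in> borel_measurable borel" by fact
  have "(\<lambda>s. (w (t - s), s)) \<in> measurable borel (borel :: (real \<times> real) measure)"
    by (rule borel_measurable_Pair) measurable
  from measurable_compose[OF this borel_measurable_continuous_onI[OF c]]
  have "(\<lambda>s. w (t - s) *\<^sub>R (v (max 0 s) - f)) \<in> borel_measurable lborel" by simp
  then have "(\<lambda>s. w (t - s) *\<^sub>R (v (max 0 s) - f)) \<in> borel_measurable (restrict_space lborel {0<..<t})"
    by (rule measurable_restrict_space1)
  then show ?thesis
    by (rule measurable_cong[THEN iffD1, rotated]) (auto simp: space_restrict_space)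
qed

locale subordinated_semigroup = subordinator_setting \<kappa> \<mu> M S + bounded_semigroup T D L
  for \<kappa> :: real and \<mu> :: "real measure" and M :: "'w measure" and S :: "real \<Rightarrow> 'w \<Rightarrow> real"
    and T :: "real \<Rightarrow> 'b::banach \<Rightarrow>\<^sub>L 'b" and D :: "'b set" and L :: "'b \<Rightarrow> 'b"
begin

text \<open>The candidate solution, the expectation of \<open>T (E t) f\<close>, written as an integral over the line.\<close>

definition mean :: "'b \<Rightarrow> real \<Rightarrow> 'b" where "mean f t = bint (nu t) (orbit f)"

lemma mean_expectation:
  assumes t: "t \<ge> 0"
  shows "banach_integrable (inverse_law M S t) (\<lambda>s. T s f)"
    and "subordinate_expectation M S T f t = mean f t"
proof -
  have il: "inverse_law M S t = restrict_space (nu t) {0..}" by (simp add: inverse_law_def nu_def)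
  have sp: "space (inverse_law M S t) = {0..}" unfolding il by (simp add: space_restrict_space nu_def)
  have s: "strong_integral (inverse_law M S t) (\<lambda>s. T s f) (mean f t)"
    unfolding mean_def
    by (rule strong_integral_cong[THEN iffD1, OF _ refl strong_integral_inverse_law[OF orbit_continuous orbit_bound t]])
       (auto simp: sp orbit_def)
  have "orbit f \<in> borel_measurable (nu t)"
    unfolding measurable_cong_sets[OF sets_nu refl] by (rule borel_measurable_continuous_onI[OF orbit_continuous])
  then have "orbit f \<in> borel_measurable (inverse_law M S t)"
    unfolding il by (rule measurable_restrict_space1)
  then have m: "(\<lambda>s. T s f) \<in> borel_measurable (inverse_law M S t)"
    by (rule measurable_cong[THEN iffD1, rotated]) (auto simp: sp orbit_def)
  show "banach_integrable (inverse_law M S t) (\<lambda>s. T s f)" "subordinate_expectation M S T f t = mean f t"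
    unfolding subordinate_expectation_def using banach_integral_eq[OF m s] by auto
qed

lemma mean_bound: "norm (mean f t) \<le> K * norm f"
  unfolding mean_def by (rule bint_nu_bound[OF orbit_continuous orbit_bound])

lemma orbit_diff: "orbit (x - y) r = orbit x r - orbit y r"
  by (simp add: orbit_def blinfun.diff_right)

lemma orbit_scaleR: "orbit (c *\<^sub>R x) r = c *\<^sub>R orbit x r"
  by (simp add: orbit_def blinfun.scaleR_right)

lemma mean_diff: "mean (x - y) t = mean x t - mean y t"
  unfolding mean_def
  using bint_diff[OF orbit_continuous[of x] orbit_bound[of x] orbit_continuous[of y] orbit_bound[of y] finite_nu[of t] sets_nu]
  by (simp add: orbit_diff[abs_def])

lemma mean_scaleR: "mean (c *\<^sub>R x) t = c *\<^sub>R mean x t"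
  unfolding mean_def
  using bint_linear[OF bounded_linear_scaleR_right[of c] orbit_continuous[of x] orbit_bound[of x] finite_nu[of t] sets_nu]
  by (simp add: orbit_scaleR[abs_def])

lemma T_mean:
  assumes h: "h \<ge> 0" shows "T h (mean x t) = mean (T h x) t"
proof -
  have "bint (nu t) (\<lambda>r. T h (orbit x r)) = T h (mean x t)"
    unfolding mean_def by (rule bint_linear[OF blinfun.bounded_linear_right orbit_continuous orbit_bound finite_nu sets_nu])
  moreover have "T h (orbit x r) = orbit (T h x) r" for r
    using T_add[OF h, of "max 0 r" x] T_add[of "max 0 r" h x] h by (simp add: orbit_def add.commute)
  ultimately show ?thesis by (simp add: mean_def)
qed

text \<open>The semigroup commutes with the mean, so the difference quotient of \<open>mean f t\<close> is the mean of the difference quotient of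
  \<open>f\<close>, and the mean is a bounded operator.\<close>

lemma mean_generator:
  assumes f: "f \<in> D" shows "mean f t \<in> D" "L (mean f t) = mean (L f) t"
proof -
  have "((\<lambda>h. (T h (mean f t) - mean f t) /\<^sub>R h) \<longlongrightarrow> mean (L f) t) (at_right 0)"
  proof (rule LIM_zero_cancel, rule Lim_null_comparison)
    show "\<forall>\<^sub>F h in at_right 0. norm ((T h (mean f t) - mean f t) /\<^sub>R h - mean (L f) t)
       \<le> K * norm ((T h f - f) /\<^sub>R h - L f)"
      using eventually_at_right_less[of "0::real"]
    proof eventually_elim
      case (elim h)
      have "(T h (mean f t) - mean f t) /\<^sub>R h - mean (L f) t = mean ((T h f - f) /\<^sub>R h - L f) t"
        using elim by (simp add: mean_diff mean_scaleR T_mean)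
      then show ?case using mean_bound by simp
    qed
    have "((\<lambda>h. norm ((T h f - f) /\<^sub>R h - L f)) \<longlongrightarrow> 0) (at_right 0)"
      using generatorD[OF f] by (simp add: tendsto_norm_zero_iff LIM_zero_iff)
    from tendsto_mult_left[OF this, of K] show "((\<lambda>h. K * norm ((T h f - f) /\<^sub>R h - L f)) \<longlongrightarrow> 0) (at_right 0)" by simp
  qed
  from generatorI[OF this] show "mean f t \<in> D" "L (mean f t) = mean (L f) t" by auto
qed

lemma orbit_nonpos: "r \<le> 0 \<Longrightarrow> orbit x r = x"
  by (simp add: orbit_def max_def T_0)

lemma mean_continuous: "continuous_on {0..} (mean f)"
  unfolding mean_def
  by (rule bint_nu_continuous[OF orbit_continuous orbit_bound orbit_modulus]) (simp_all add: orbit_nonpos)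

lemma mean_eq:
  assumes f: "f \<in> D" and t: "t \<ge> 0"
  shows "mean f t = f + bint (sojourn t) (orbit (L f))"
proof -
  have "bint (nu t) (orbit f) = orbit f 0 + bint (sojourn t) (orbit (L f))"
    by (rule bint_nu_by_parts[OF orbit_continuous orbit_bound orbit_continuous orbit_bound _ _ t])
       (auto simp: orbit_integral[OF f] orbit_nonpos, simp add: orbit_def)
  then show ?thesis by (simp add: mean_def orbit_nonpos)
qed

lemma mean_0: "f \<in> D \<Longrightarrow> mean f 0 = f"
  by (simp add: mean_eq bint_sojourn_nonpos[OF orbit_continuous orbit_bound])

lemma mean_memory:
  assumes f: "f \<in> D" and v: "\<And>s. s \<ge> 0 \<Longrightarrow> v s = mean f s"
  shows "banach_integrable (restrict_space lborel {0<..<t}) (\<lambda>s. w (t - s) *\<^sub>R (v s - f))"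
    and "memory_integral w f v t = bint (memory_sojourn t) (orbit (L f))"
proof -
  have "continuous_on {0..} v"
    by (rule continuous_on_eq[OF mean_continuous]) (simp add: v)
  then have m: "(\<lambda>s. w (t - s) *\<^sub>R (v s - f)) \<in> borel_measurable (restrict_space lborel {0<..<t})"
    by (rule memory_integrand_measurable[OF w_measurable])
  have s: "strong_integral (restrict_space lborel {0<..<t}) (\<lambda>s. w (t - s) *\<^sub>R (v s - f)) (bint (memory_sojourn t) (orbit (L f)))"
    by (rule strong_integral_cong[THEN iffD1, OF _ refl memory_kernel_integral[OF orbit_continuous orbit_bound]])
       (auto simp: space_restrict_space v mean_eq[OF f])
  show "banach_integrable (restrict_space lborel {0<..<t}) (\<lambda>s. w (t - s) *\<^sub>R (v s - f))"
    "memory_integral w f v t = bint (memory_sojourn t) (orbit (L f))"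
    unfolding memory_integral_def using banach_integral_eq[OF m s] by auto
qed

lemma mean_max_continuous: "continuous_on UNIV (\<lambda>s. mean g (max 0 s))"
  by (intro continuous_on_compose2[OF mean_continuous] continuous_intros) auto

text \<open>Integrate the orbit of \<open>L f\<close> against the flux measure. As a density the flux splits into drift and memory
  terms; as a mixture it is the time integral of the laws of the inverse.\<close>

lemma mean_integrated_equation:
  assumes f: "f \<in> D" and t: "t \<ge> 0"
  shows "\<kappa> *\<^sub>R (mean f t - f) + bint (memory_sojourn t) (orbit (L f)) = bint (leb 0 t) (\<lambda>s. mean (L f) (max 0 s))"
proof -
  have "mean f t - f = bint (sojourn t) (orbit (L f))" using mean_eq[OF f t] by simp
  then show ?thesis
    unfolding mean_def[of "L f"]
    using bint_flux_measure_eq[OF orbit_continuous orbit_bound, of t "L f"] bint_flux_measure_mixture[OF orbit_continuous orbit_bound, of t "L f"]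
    by simp
qed

text \<open>The statement allows any \<open>v\<close> that agrees with the mean at nonnegative times, since the expectation is defined differently at
  negative ones.\<close>

lemma mean_solution:
  assumes f: "f \<in> D" and v: "\<And>s. s \<ge> 0 \<Longrightarrow> v s = mean f s"
  shows "time_fractional_solution \<kappa> w D L f v"
  unfolding time_fractional_solution_def
proof (intro conjI allI impI)
  show "v 0 = f" by (simp add: v mean_0 f)
  show "bdd_above ((\<lambda>t. norm (v t)) ` {0<..})"
    by (rule bdd_aboveI[of _ "K * norm f"]) (auto simp: v mean_bound)
  show "bdd_above ((\<lambda>t. norm (L (v t))) ` {0..})"
    by (rule bdd_aboveI[of _ "K * norm (L f)"]) (auto simp: v mean_bound mean_generator[OF f])
  show "continuous_on {0..} v"
    by (rule continuous_on_eq[OF mean_continuous]) (simp add: v)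
  show "continuous_on {0..} (\<lambda>t. L (v t))"
    by (rule continuous_on_eq[OF mean_continuous[of "L f"]]) (simp add: v mean_generator[OF f])
  show "v t \<in> D" if "0 \<le> t" for t using that by (simp add: v mean_generator[OF f])
  fix t :: real assume t: "0 < t"
  show "banach_integrable (restrict_space lborel {0<..<t}) (\<lambda>s. w (t - s) *\<^sub>R (v s - f))"
    by (rule mean_memory[OF f v])
  let ?Z = "\<lambda>t. bint (leb 0 t) (\<lambda>s. mean (L f) (max 0 s))"
  have "(?Z has_vector_derivative mean (L f) (max 0 t)) (at t)"
    by (rule bint_leb_at[OF mean_max_continuous mean_bound t])
  then have "((\<lambda>h. (?Z (t + h) - ?Z t) /\<^sub>R h) \<longlongrightarrow> L (v t)) (at 0)"
    using t unfolding has_vector_derivative_iff_quotient by (simp add: v mean_generator[OF f])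
  then show "((\<lambda>\<delta>. (\<kappa> *\<^sub>R (v (t + \<delta>) - v t) + memory_integral w f v (t + \<delta>) - memory_integral w f v t) /\<^sub>R \<delta>)
           \<longlongrightarrow> L (v t)) (at 0)"
  proof (rule Lim_transform_eventually)
    have "\<forall>\<^sub>F h in at 0. dist h 0 < t" using t by (auto simp: eventually_at)
    then show "\<forall>\<^sub>F h in at 0. (?Z (t + h) - ?Z t) /\<^sub>R h =
       (\<kappa> *\<^sub>R (v (t + h) - v t) + memory_integral w f v (t + h) - memory_integral w f v t) /\<^sub>R h"
    proof eventually_elim
      case (elim h)
      then have th: "0 \<le> t + h" by (auto simp: dist_real_def)
      show ?case
        using t th by (simp add: mean_integrated_equation[OF f, symmetric] mean_memory(2)[OF f v] v algebra_simps)
    qed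
  qed
qed

lemma mean_lipschitz:
  assumes f: "f \<in> D" and k: "\<kappa> > 0"
  shows "(K * norm (L f) / \<kappa>)-lipschitz_on UNIV (\<lambda>t. bint (sojourn t) (orbit (L f)))"
proof (rule lipschitz_onI)
  let ?y = "\<lambda>t. bint (sojourn t) (orbit (L f))"
  have *: "norm (?y t - ?y s) \<le> K * norm (L f) / \<kappa> * (t - s)" if "s \<le> t" for s t
  proof -
    have "norm (?y t - ?y s) \<le> K * norm (L f) * (potential t - potential s)"
      by (rule bint_sojourn_increment[OF orbit_continuous orbit_bound that])
    also have "\<dots> \<le> K * norm (L f) * ((t - s) / \<kappa>)"
      using potential_lipschitz[of "t - s" s] that k K_ge_1 by (intro mult_left_mono) (auto simp: field_simps)
    finally show ?thesis by simp
  qed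
  show "0 \<le> K * norm (L f) / \<kappa>" using k K_ge_1 by simp
  fix s t :: real
  show "dist (?y s) (?y t) \<le> K * norm (L f) / \<kappa> * dist s t"
    using *[of s t] *[of t s] by (cases "s \<le> t") (auto simp: dist_norm norm_minus_commute)
qed

end

section \<open>Differentiability for positive drift\<close>

context subordinator_setting
begin

lemma laplace_w_vanishes:
  assumes "\<epsilon> > 0"
  shows "\<exists>l>0. (\<integral>\<^sup>+s. ennreal (exp (- l * s)) * ennreal (w s) \<partial>lborel) \<le> ennreal \<epsilon>"
proof -
  have "(\<lambda>n::nat. \<integral>\<^sup>+s. ennreal (exp (- real (Suc n) * s)) * ennreal (w s) \<partial>lborel) \<longlonglongrightarrow> (\<integral>\<^sup>+s. 0 \<partial>(lborel :: real measure))"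
  proof (rule nn_integral_dominated_convergence[where w="\<lambda>s. ennreal (exp (- 1 * s)) * ennreal (w s)"])
    show "(\<integral>\<^sup>+s. ennreal (exp (- 1 * s)) * ennreal (w s) \<partial>lborel) < \<infinity>"
      using laplace_w'[of 1] by simp
    show "AE s in lborel. ennreal (exp (- real (Suc n) * s)) * ennreal (w s) \<le> ennreal (exp (- 1 * s)) * ennreal (w s)" for n
    proof (rule AE_I2)
      fix s
      show "ennreal (exp (- real (Suc n) * s)) * ennreal (w s) \<le> ennreal (exp (- 1 * s)) * ennreal (w s)"
      proof (cases "s > 0")
        case True
        then have "1 * s \<le> real (Suc n) * s" by (intro mult_right_mono) auto
        then have "exp (- real (Suc n) * s) \<le> exp (- 1 * s)"
          by (simp only: exp_le_cancel_iff mult_minus_left neg_le_iff_le)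
        then show ?thesis by (intro mult_right_mono ennreal_leI) auto
      qed (simp add: w_nonpos_arg)
    qed
    show "AE s in lborel. (\<lambda>n. ennreal (exp (- real (Suc n) * s)) * ennreal (w s)) \<longlonglongrightarrow> 0"
    proof (rule AE_I2)
      fix s :: real
      show "(\<lambda>n. ennreal (exp (- real (Suc n) * s)) * ennreal (w s)) \<longlonglongrightarrow> 0"
      proof (cases "s > 0")
        case True
        have "(\<lambda>n::nat. exp (- real (Suc n) * s) * w s) \<longlonglongrightarrow> 0" using True by real_asymp
        from tendsto_ennrealI[OF this] show ?thesis by (simp add: ennreal_mult w_nonneg)
      qed (simp add: w_nonpos_arg)
    qed
  qed measurable
  then have "\<forall>\<^sub>F n in sequentially. (\<integral>\<^sup>+s. ennreal (exp (- real (Suc n) * s)) * ennreal (w s) \<partial>lborel) < ennreal \<epsilon>"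
    using assms by (intro order_tendstoD(2)) (auto simp: zero_less_iff_neq_zero)
  then obtain n where "(\<integral>\<^sup>+s. ennreal (exp (- real (Suc n) * s)) * ennreal (w s) \<partial>lborel) < ennreal \<epsilon>"
    using eventually_happens by force
  then show ?thesis by (intro exI[of _ "real (Suc n)"]) auto
qed

text \<open>Truncation at \<open>R\<close> makes the kernel a finite measure; times up to \<open>R\<close> do not see the difference.\<close>

definition tail_kernel :: "real \<Rightarrow> real measure" where
  "tail_kernel R = density lborel (\<lambda>s. ennreal (w s) * indicator {0<..<R} s)"

lemma sets_tail_kernel [simp, measurable_cong]: "sets (tail_kernel R) = sets borel"
  by (simp add: tail_kernel_def)

lemma finite_tail_kernel: "finite_measure (tail_kernel R)"
proof (rule finite_measureI)
  show "emeasure (tail_kernel R) (space (tail_kernel R)) \<noteq> \<infinity>"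
    using nn_integral_w_Ioo_finite[of R] by (simp add: tail_kernel_def emeasure_density)
qed

lemma nn_integral_tail_kernel:
  "g \<in> borel_measurable borel \<Longrightarrow> (\<integral>\<^sup>+s. g s \<partial>tail_kernel R) = (\<integral>\<^sup>+s. ennreal (w s) * indicator {0<..<R} s * g s \<partial>lborel)"
  unfolding tail_kernel_def by (subst nn_integral_density) auto

lemma bint_memory_sojourn_convolution:
  fixes \<phi> :: "real \<Rightarrow> 'b::banach"
  assumes \<phi>: "continuous_on UNIV \<phi>" "\<And>r. norm (\<phi> r) \<le> C" and t: "t \<le> R"
  shows "bint (tail_kernel R) (\<lambda>s. bint (sojourn (t - s)) \<phi>) = bint (memory_sojourn t) \<phi>"
proof (rule bint_eq, rule strong_integral_mixture[OF \<phi>])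
  fix A :: "real set" assume A: "A \<in> sets borel"
  have m[measurable]: "(\<lambda>s. emeasure (sojourn (t - s)) A) \<in> borel_measurable borel"
    by (rule measurable_compose[OF _ emeasure_sojourn_measurable[OF A]]) measurable
  then show "(\<lambda>s. emeasure (sojourn (t - s)) A) \<in> borel_measurable (tail_kernel R)"
    by (simp add: measurable_cong_sets[OF sets_tail_kernel refl])
  have "(\<integral>\<^sup>+s. emeasure (sojourn (t - s)) A \<partial>tail_kernel R) = (\<integral>\<^sup>+s. ennreal (w s) * indicator {0<..<R} s * emeasure (sojourn (t - s)) A \<partial>lborel)"
    by (rule nn_integral_tail_kernel[OF m])
  also have "\<dots> = (\<integral>\<^sup>+s. ennreal (w s) * emeasure (sojourn (t - s)) A \<partial>lborel)"
  proof (rule nn_integral_cong)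
    fix s
    show "ennreal (w s) * indicator {0<..<R} s * emeasure (sojourn (t - s)) A = ennreal (w s) * emeasure (sojourn (t - s)) A"
      using t emeasure_sojourn_nonpos[of "t - s" A] by (cases "s \<le> 0"; cases "s < R") (auto simp: w_nonpos_arg)
  qed
  also have "\<dots> = emeasure (memory_sojourn t) A"
    using A by (simp add: emeasure_memory_sojourn nn_integral_conv emeasure_sojourn)
  finally show "(\<integral>\<^sup>+s. emeasure (sojourn (t - s)) A \<partial>tail_kernel R) = emeasure (memory_sojourn t) A" .
qed (auto simp: finite_sojourn finite_memory_sojourn)

text \<open>A Gronwall argument in the weighted norm \<open>sup exp (- l t) V t\<close>: for large \<open>l\<close> the weighted mass of \<open>w\<close> is at most
  \<open>\<kappa> / 2\<close>, so the norm is at most half of itself.\<close>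

lemma volterra_osc_vanishes:
  fixes V :: "real \<Rightarrow> ennreal"
  assumes k: "\<kappa> > 0" and Vm: "V \<in> borel_measurable borel" and bd: "\<And>t. V t \<le> ennreal B"
    and neg: "\<And>t. t < 0 \<Longrightarrow> V t = 0"
    and ineq: "\<And>t. 0 < t \<Longrightarrow> t < R \<Longrightarrow> ennreal \<kappa> * V t \<le> (\<integral>\<^sup>+s. V (t - s) \<partial>tail_kernel R)"
    and t: "0 < t" "t < R"
  shows "V t = 0"
proof -
  have [measurable]: "V \<in> borel_measurable borel" by fact
  obtain l where l: "l > 0" "(\<integral>\<^sup>+s. ennreal (exp (- l * s)) * ennreal (w s) \<partial>lborel) \<le> ennreal (\<kappa> / 2)"
    using laplace_w_vanishes[of "\<kappa> / 2"] k by auto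
  define \<Theta> where "\<Theta> = (SUP t\<in>{0<..<R}. ennreal (exp (- l * t)) * V t)"
  have le: "ennreal (exp (- l * t)) * V t \<le> \<Theta>" if "0 < t" "t < R" for t
    unfolding \<Theta>_def by (rule SUP_upper) (use that in auto)
  have fin: "\<Theta> \<le> ennreal B"
    unfolding \<Theta>_def
  proof (rule SUP_least)
    fix t assume "t \<in> {0<..<R}"
    then have "ennreal (exp (- l * t)) * V t \<le> 1 * V t" using l(1) by (intro mult_right_mono) auto
    then show "ennreal (exp (- l * t)) * V t \<le> ennreal B" using bd[of t] by (simp add: order_trans)
  qed
  have "ennreal \<kappa> * (ennreal (exp (- l * t)) * V t) \<le> ennreal (\<kappa> / 2) * \<Theta>" if t: "0 < t" "t < R" for t
  proof -
    have "ennreal \<kappa> * (ennreal (exp (- l * t)) * V t) = ennreal (exp (- l * t)) * (ennreal \<kappa> * V t)" by (simp add: ac_simps)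
    also have "\<dots> \<le> ennreal (exp (- l * t)) * (\<integral>\<^sup>+s. V (t - s) \<partial>tail_kernel R)" by (intro mult_left_mono ineq t) simp
    also have "\<dots> = (\<integral>\<^sup>+s. ennreal (exp (- l * t)) * (ennreal (w s) * indicator {0<..<R} s * V (t - s)) \<partial>lborel)"
      by (subst nn_integral_tail_kernel, measurable) (subst nn_integral_cmult, measurable)
    also have "\<dots> \<le> (\<integral>\<^sup>+s. (ennreal (exp (- l * s)) * ennreal (w s)) * \<Theta> \<partial>lborel)"
    proof (rule nn_integral_mono_AE)
      show "AE s in lborel. ennreal (exp (- l * t)) * (ennreal (w s) * indicator {0<..<R} s * V (t - s))
         \<le> (ennreal (exp (- l * s)) * ennreal (w s)) * \<Theta>"
        using AE_lborel_singleton[of t]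
      proof eventually_elim
        case (elim s)
        show ?case
        proof (cases "0 < s \<and> s < t")
          case True
          have "ennreal (exp (- l * t)) = ennreal (exp (- l * s)) * ennreal (exp (- l * (t - s)))"
            by (simp add: algebra_simps flip: ennreal_mult exp_add)
          then have "ennreal (exp (- l * t)) * (ennreal (w s) * V (t - s))
             = (ennreal (exp (- l * s)) * ennreal (w s)) * (ennreal (exp (- l * (t - s))) * V (t - s))"
            by (simp only: ac_simps)
          also have "\<dots> \<le> (ennreal (exp (- l * s)) * ennreal (w s)) * \<Theta>"
            using True t by (intro mult_left_mono le) auto
          finally show ?thesis using True t by simp
        next
          case False
          then have "s \<le> 0 \<or> t - s < 0" using elim by auto
          then show ?thesis using neg[of "t - s"] by (auto simp: w_nonpos_arg)
        qed
      qed
    qed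
    also have "\<dots> = (\<integral>\<^sup>+s. ennreal (exp (- l * s)) * ennreal (w s) \<partial>lborel) * \<Theta>" by (rule nn_integral_multc) measurable
    also have "\<dots> \<le> ennreal (\<kappa> / 2) * \<Theta>" using l(2) by (rule mult_right_mono) simp
    finally show ?thesis .
  qed
  then have "(SUP t\<in>{0<..<R}. ennreal \<kappa> * (ennreal (exp (- l * t)) * V t)) \<le> ennreal (\<kappa> / 2) * \<Theta>"
    by (intro SUP_least) auto
  then have *: "ennreal \<kappa> * \<Theta> \<le> ennreal (\<kappa> / 2) * \<Theta>"
    unfolding \<Theta>_def using t by (subst SUP_mult_left_ennreal) auto
  obtain \<theta> where \<theta>: "\<Theta> = ennreal \<theta>" "\<theta> \<ge> 0" using fin by (cases \<Theta>) (auto simp: top_unique)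
  have "\<kappa> * \<theta> \<le> \<kappa> / 2 * \<theta>"
    using * k \<theta> by (simp add: ennreal_mult[symmetric] ennreal_le_iff)
  then have "\<theta> \<le> 0" using k by (simp add: mult_le_cancel_right)
  then have "\<Theta> = 0" using \<theta> by simp
  then show ?thesis using le[OF t] by simp
qed

text \<open>Difference quotients \<open>q h\<close> of \<open>y\<close> satisfy the equation with the difference quotients of \<open>\<zeta>\<close> on the right, and those
  converge. Hence the oscillation \<open>W\<close> of \<open>q h\<close> as \<open>h\<close> tends to \<open>0\<close>, the decreasing limit of the suprema \<open>V n\<close>, satisfies the
  inequality of \<open>volterra_osc_vanishes\<close>; the passage to the limit under the integral is dominated because
  \<open>y\<close> is Lipschitz. Vanishing oscillation is the Cauchy criterion for the derivative.\<close>

lemma volterra_differentiable: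
  fixes y \<zeta> :: "real \<Rightarrow> 'b::banach"
  assumes k: "\<kappa> > 0" and lip: "\<Lambda>-lipschitz_on UNIV y" and bd: "\<And>t. norm (y t) \<le> C" and neg: "\<And>t. t \<le> 0 \<Longrightarrow> y t = 0"
    and eq: "\<And>t. t \<le> R \<Longrightarrow> 0 \<le> t \<Longrightarrow> \<kappa> *\<^sub>R y t + bint (tail_kernel R) (\<lambda>s. y (t - s)) = \<zeta> t"
    and der: "\<And>t. 0 < t \<Longrightarrow> t < R \<Longrightarrow> \<exists>D. (\<zeta> has_vector_derivative D) (at t)"
    and t: "0 < t" "t < R"
  shows "\<exists>D. (y has_vector_derivative D) (at t)"
proof -
  define q where "q h t = (y (t + h) - y t) /\<^sub>R h" for h t
  have yc: "continuous_on UNIV y" by (rule lipschitz_on_continuous_on[OF lip])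
  have L0: "\<Lambda> \<ge> 0" using lip by (rule lipschitz_on_nonneg)
  have qb: "norm (q h t) \<le> \<Lambda>" for h t
  proof (cases "h = 0")
    case False
    have "norm (y (t + h) - y t) \<le> \<Lambda> * \<bar>h\<bar>"
      using lipschitz_onD[OF lip, of "t + h" t] by (simp add: dist_norm)
    then show ?thesis using False unfolding q_def norm_scaleR by (simp add: divide_simps mult.commute)
  qed (simp add: q_def L0)
  have qc: "continuous_on UNIV (q h)" for h
    unfolding q_def by (intro continuous_intros continuous_on_compose2[OF yc]) auto
  define H where "H n = {h::real. h \<noteq> 0 \<and> \<bar>h\<bar> < 1 / real (Suc n)}" for n
  define V where "V n t = (SUP p\<in>H n \<times> H n. ennreal (norm (q (fst p) t - q (snd p) t)))" for n t
  have Vm[measurable]: "V n \<in> borel_measurable borel" for n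
  proof (rule borel_measurableI_greater)
    fix a :: ennreal
    \<comment> \<open>a supremum of continuous functions is lower semicontinuous, so the uncountable supremum is measurable\<close>
    have "{x \<in> space borel. a < V n x} = (\<Union>p\<in>H n \<times> H n. {x. a < ennreal (norm (q (fst p) x - q (snd p) x))})"
      unfolding V_def less_SUP_iff Collect_bex_eq[symmetric] by simp
    also have "open \<dots>"
      by (intro open_UN ballI open_Collect_less continuous_intros continuous_on_ennreal qc)
    finally show "{x \<in> space borel. a < V n x} \<in> sets borel" by simp
  qed
  have Vb: "V n t \<le> ennreal (2 * \<Lambda>)" for n t
    unfolding V_def
  proof (rule SUP_least)
    fix p show "ennreal (norm (q (fst p) t - q (snd p) t)) \<le> ennreal (2 * \<Lambda>)"
      using norm_triangle_ineq4[of "q (fst p) t" "q (snd p) t"] qb[of "fst p" t] qb[of "snd p" t]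
      by (intro ennreal_leI) simp
  qed
  have Vdec: "V n t \<le> V m t" if "m \<le> n" for m n t
  proof -
    have "1 / real (Suc n) \<le> 1 / real (Suc m)" using that by (intro divide_left_mono) auto
    then have "H n \<subseteq> H m" unfolding H_def by auto
    then show ?thesis unfolding V_def by (intro SUP_subset_mono) auto
  qed
  define W where "W t = (INF n. V n t)" for t
  have Wm[measurable]: "W \<in> borel_measurable borel" unfolding W_def by measurable
  have Wle: "W t \<le> V n t" for n t unfolding W_def by (rule INF_lower) simp
  have "W t = 0"
  proof (rule volterra_osc_vanishes[OF k Wm _ _ _ t])
    show "W t \<le> ennreal (2 * \<Lambda>)" for t using Wle[of t 0] Vb[of 0 t] by (rule order_trans)
    show "W t = 0" if neg_t: "t < 0" for t
    proof -
      obtain n where n: "inverse (real (Suc n)) < - t" using reals_Archimedean[of "- t"] neg_t by auto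
      have "V n t \<le> 0"
        unfolding V_def
      proof (rule SUP_least)
        fix p assume "p \<in> H n \<times> H n"
        then have "\<bar>fst p\<bar> < - t" "\<bar>snd p\<bar> < - t" using n by (auto simp: H_def inverse_eq_divide)
        then have "q (fst p) t = 0" "q (snd p) t = 0" using neg_t by (auto simp: q_def neg)
        then show "ennreal (norm (q (fst p) t - q (snd p) t)) \<le> 0" by simp
      qed
      then show ?thesis using Wle[of t n] by simp
    qed
    fix t assume t: "0 < t" "t < R"
    show "ennreal \<kappa> * W t \<le> (\<integral>\<^sup>+s. W (t - s) \<partial>tail_kernel R)"
    proof (rule ennreal_le_epsilon)
      fix \<epsilon> :: real assume e: "\<epsilon> > 0"
      obtain D where D: "(\<zeta> has_vector_derivative D) (at t)" using der[OF t] by blast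
      from tendstoD[OF D[unfolded has_vector_derivative_iff_quotient], of "\<epsilon> / 2"] e
      obtain d where d: "d > 0" "\<And>h. h \<noteq> 0 \<Longrightarrow> \<bar>h\<bar> < d \<Longrightarrow> norm ((\<zeta> (t + h) - \<zeta> t) /\<^sub>R h - D) < \<epsilon> / 2"
        by (auto simp: eventually_at dist_norm)
      \<comment> \<open>small enough that \<open>t + h\<close> stays in \<open>(0, R)\<close>, where the equation holds\<close>
      obtain N where N: "inverse (real (Suc N)) < min d (min t (R - t))"
        using reals_Archimedean[of "min d (min t (R - t))"] d(1) t by auto
      have qeq: "\<kappa> *\<^sub>R q h t + bint (tail_kernel R) (\<lambda>s. q h (t - s)) = (\<zeta> (t + h) - \<zeta> t) /\<^sub>R h" if h: "h \<noteq> 0" "\<bar>h\<bar> < min t (R - t)" for h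
      proof -
        have c: "continuous_on UNIV (\<lambda>s. y (a - s))" for a
          by (intro continuous_on_compose2[OF yc] continuous_intros) auto
        have qq: "q h (t - s) = inverse h *\<^sub>R (y (t + h - s) - y (t - s))" for s
          by (simp add: q_def algebra_simps)
        have "bint (tail_kernel R) (\<lambda>s. q h (t - s)) = inverse h *\<^sub>R bint (tail_kernel R) (\<lambda>s. y (t + h - s) - y (t - s))"
          unfolding qq
          by (rule bint_linear[OF bounded_linear_scaleR_right continuous_on_diff[OF c c] _ finite_tail_kernel sets_tail_kernel, of _ _ "C + C"])
             (intro order_trans[OF norm_triangle_ineq4] add_mono bd)
        also have "bint (tail_kernel R) (\<lambda>s. y (t + h - s) - y (t - s)) = bint (tail_kernel R) (\<lambda>s. y (t + h - s)) - bint (tail_kernel R) (\<lambda>s. y (t - s))"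
          by (rule bint_diff[OF c bd c bd finite_tail_kernel sets_tail_kernel])
        finally have I: "bint (tail_kernel R) (\<lambda>s. q h (t - s))
           = inverse h *\<^sub>R (bint (tail_kernel R) (\<lambda>s. y (t + h - s)) - bint (tail_kernel R) (\<lambda>s. y (t - s)))" .
        have "(\<zeta> (t + h) - \<zeta> t) /\<^sub>R h = inverse h *\<^sub>R
            ((\<kappa> *\<^sub>R y (t + h) + bint (tail_kernel R) (\<lambda>s. y (t + h - s))) - (\<kappa> *\<^sub>R y t + bint (tail_kernel R) (\<lambda>s. y (t - s))))"
        proof -
          have "t + h \<le> R" "0 \<le> t + h" using h(2) by linarith+
          then show ?thesis using eq[of "t + h"] eq[of t] t by simp
        qed
        then show ?thesis unfolding I unfolding q_def by (simp add: algebra_simps)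
      qed
      have main: "ennreal \<kappa> * V n t \<le> ennreal \<epsilon> + (\<integral>\<^sup>+s. V n (t - s) \<partial>tail_kernel R)" if n: "n \<ge> N" for n
      proof -
        have small: "1 / real (Suc n) < min d (min t (R - t))"
        proof -
          have "1 / real (Suc n) \<le> 1 / real (Suc N)" using n by (intro divide_left_mono) auto
          then show ?thesis using N by (simp add: inverse_eq_divide)
        qed
        have "ennreal \<kappa> * ennreal (norm (q a t - q b t)) \<le> ennreal \<epsilon> + (\<integral>\<^sup>+s. V n (t - s) \<partial>tail_kernel R)"
          if ab: "a \<in> H n" "b \<in> H n" for a b
        proof -
          have a: "a \<noteq> 0" "\<bar>a\<bar> < d" "\<bar>a\<bar> < min t (R - t)" and b: "b \<noteq> 0" "\<bar>b\<bar> < d" "\<bar>b\<bar> < min t (R - t)"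
            using ab small by (auto simp: H_def)
          have c: "continuous_on UNIV (\<lambda>s. q h (t - s))" for h
            by (intro continuous_on_compose2[OF qc] continuous_intros) auto
          let ?I = "bint (tail_kernel R) (\<lambda>s. q a (t - s) - q b (t - s))"
          have "\<kappa> *\<^sub>R (q a t - q b t) + ?I = (\<zeta> (t + a) - \<zeta> t) /\<^sub>R a - (\<zeta> (t + b) - \<zeta> t) /\<^sub>R b"
            unfolding bint_diff[OF c[of a] qb[of a] c[of b] qb[of b] finite_tail_kernel[of R] sets_tail_kernel]
              qeq[OF a(1,3), symmetric] qeq[OF b(1,3), symmetric]
            by (simp add: algebra_simps)
          then have ke: "\<kappa> *\<^sub>R (q a t - q b t) = ((\<zeta> (t + a) - \<zeta> t) /\<^sub>R a - D) - ((\<zeta> (t + b) - \<zeta> t) /\<^sub>R b - D) - ?I"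
            by (simp add: algebra_simps)
          have "norm (\<kappa> *\<^sub>R (q a t - q b t)) \<le> norm ((\<zeta> (t + a) - \<zeta> t) /\<^sub>R a - D) + norm ((\<zeta> (t + b) - \<zeta> t) /\<^sub>R b - D) + norm ?I"
            unfolding ke
            using norm_triangle_ineq4[of "((\<zeta> (t + a) - \<zeta> t) /\<^sub>R a - D) - ((\<zeta> (t + b) - \<zeta> t) /\<^sub>R b - D)" ?I]
              norm_triangle_ineq4[of "(\<zeta> (t + a) - \<zeta> t) /\<^sub>R a - D" "(\<zeta> (t + b) - \<zeta> t) /\<^sub>R b - D"]
            by linarith
          then have "\<kappa> * norm (q a t - q b t) \<le> \<epsilon> + norm ?I"
            using d(2)[OF a(1,2)] d(2)[OF b(1,2)] k by simp
          then have "ennreal (\<kappa> * norm (q a t - q b t)) \<le> ennreal \<epsilon> + ennreal (norm ?I)"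
            using e by (simp add: ennreal_leI flip: ennreal_plus)
          also have "ennreal (norm ?I) \<le> (\<integral>\<^sup>+s. ennreal (norm (q a (t - s) - q b (t - s))) \<partial>tail_kernel R)"
            by (rule bint_norm_le_nn[OF continuous_on_diff[OF c c] _ finite_tail_kernel sets_tail_kernel, of _ _ "\<Lambda> + \<Lambda>"])
               (intro order_trans[OF norm_triangle_ineq4] add_mono qb)
          also have "\<dots> \<le> (\<integral>\<^sup>+s. V n (t - s) \<partial>tail_kernel R)"
            unfolding V_def using ab by (intro nn_integral_mono SUP_upper2[of "(a, b)"]) auto
          finally show ?thesis using k by (simp add: ennreal_mult add_left_mono)
        qed
        then show ?thesis
          unfolding V_def[of n t] by (subst SUP_mult_left_ennreal) (auto intro!: SUP_least)
      qed
      have "(\<lambda>n. \<integral>\<^sup>+s. V n (t - s) \<partial>tail_kernel R) \<longlonglongrightarrow> (\<integral>\<^sup>+s. W (t - s) \<partial>tail_kernel R)"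
      proof (rule nn_integral_dominated_convergence[where w="\<lambda>_. ennreal (2 * \<Lambda>)"])
        show "(\<integral>\<^sup>+s. ennreal (2 * \<Lambda>) \<partial>tail_kernel R) < \<infinity>"
          using finite_measure.emeasure_finite[OF finite_tail_kernel, of R UNIV]
          by (simp add: less_top[symmetric] ennreal_mult_eq_top_iff tail_kernel_def)
        show "AE s in tail_kernel R. (\<lambda>n. V n (t - s)) \<longlonglongrightarrow> W (t - s)"
          unfolding W_def using Vdec by (intro AE_I2 LIMSEQ_INF) (auto simp: decseq_def)
        show "AE s in tail_kernel R. V n (t - s) \<le> ennreal (2 * \<Lambda>)" for n using Vb by simp
      qed measurable
      then have lim: "(\<lambda>n. ennreal \<epsilon> + (\<integral>\<^sup>+s. V n (t - s) \<partial>tail_kernel R)) \<longlonglongrightarrow> ennreal \<epsilon> + (\<integral>\<^sup>+s. W (t - s) \<partial>tail_kernel R)"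
        by (intro tendsto_add tendsto_const)
      have "ennreal \<kappa> * W t \<le> ennreal \<epsilon> + (\<integral>\<^sup>+s. W (t - s) \<partial>tail_kernel R)"
      proof (rule LIMSEQ_le_const[OF lim], intro exI allI impI)
        fix n assume "N \<le> n"
        have "ennreal \<kappa> * W t \<le> ennreal \<kappa> * V n t" by (intro mult_left_mono Wle) simp
        also have "\<dots> \<le> ennreal \<epsilon> + (\<integral>\<^sup>+s. V n (t - s) \<partial>tail_kernel R)" by (rule main[OF \<open>N \<le> n\<close>])
        finally show "ennreal \<kappa> * W t \<le> ennreal \<epsilon> + (\<integral>\<^sup>+s. V n (t - s) \<partial>tail_kernel R)" .
      qed
      then show "ennreal \<kappa> * W t \<le> (\<integral>\<^sup>+s. W (t - s) \<partial>tail_kernel R) + ennreal \<epsilon>" by (simp add: add.commute)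
    qed
  qed
  have osc: "\<exists>n. \<forall>a\<in>H n. \<forall>b\<in>H n. norm (q a t - q b t) < \<epsilon>" if e: "\<epsilon> > 0" for \<epsilon>
  proof -
    have "W t < ennreal \<epsilon>" using \<open>W t = 0\<close> e by simp
    then obtain n where n: "V n t < ennreal \<epsilon>" unfolding W_def by (auto simp: INF_less_iff)
    have "norm (q a t - q b t) < \<epsilon>" if "a \<in> H n" "b \<in> H n" for a b
    proof -
      have "ennreal (norm (q a t - q b t)) \<le> V n t"
        unfolding V_def using that by (intro SUP_upper2[of "(a, b)"]) auto
      then have "ennreal (norm (q a t - q b t)) < ennreal \<epsilon>" using n by (rule le_less_trans)
      then show ?thesis by (simp add: ennreal_less_iff)
    qed
    then show ?thesis by blast
  qed
  define h where "h j = 1 / real (Suc (Suc j))" for j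
  have hH: "h j \<in> H n" if "n \<le> j" for n j
  proof -
    have "real (Suc n) < real (Suc (Suc j))" using that by simp
    then have "1 / real (Suc (Suc j)) < 1 / real (Suc n)" by (rule divide_strict_left_mono) simp_all
    then show ?thesis unfolding h_def H_def by simp
  qed
  have "Cauchy (\<lambda>j. q (h j) t)"
  proof (rule CauchyI)
    fix \<epsilon> :: real assume "\<epsilon> > 0"
    from osc[OF this] obtain n where "\<forall>a\<in>H n. \<forall>b\<in>H n. norm (q a t - q b t) < \<epsilon>" by blast
    then show "\<exists>M. \<forall>m\<ge>M. \<forall>n\<ge>M. norm (q (h m) t - q (h n) t) < \<epsilon>" using hH by (intro exI[of _ n]) auto
  qed
  then obtain v where v: "(\<lambda>j. q (h j) t) \<longlonglongrightarrow> v" using Cauchy_convergent convergent_def by blast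
  have "((\<lambda>a. q a t) \<longlongrightarrow> v) (at 0)"
  proof (rule tendstoI)
    fix \<epsilon> :: real assume e: "\<epsilon> > 0"
    obtain n where n: "\<And>a b. a \<in> H n \<Longrightarrow> b \<in> H n \<Longrightarrow> norm (q a t - q b t) < \<epsilon> / 2"
      using osc[of "\<epsilon> / 2"] e by auto
    have le: "norm (q a t - v) \<le> \<epsilon> / 2" if "a \<in> H n" for a
    proof (rule LIMSEQ_le_const2)
      show "(\<lambda>j. norm (q a t - q (h j) t)) \<longlonglongrightarrow> norm (q a t - v)" by (intro tendsto_intros v)
      show "\<exists>N. \<forall>j\<ge>N. norm (q a t - q (h j) t) \<le> \<epsilon> / 2"
        using n[OF that hH] by (intro exI[of _ n] allI impI less_imp_le) simp
    qed
    have "dist (q a t) v < \<epsilon>" if "a \<noteq> 0" "dist a 0 < 1 / real (Suc n)" for a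
      using le[of a] that e by (auto simp: H_def dist_norm)
    then show "\<forall>\<^sub>F a in at 0. dist (q a t) v < \<epsilon>"
      unfolding eventually_at by (intro exI[of _ "1 / real (Suc n)"]) auto
  qed
  then show ?thesis unfolding q_def has_vector_derivative_iff_quotient[symmetric] by blast
qed

end

context subordinated_semigroup
begin

lemma mean_differentiable:
  assumes f: "f \<in> D" and k: "\<kappa> > 0" and t: "t > 0"
  shows "\<exists>v. (mean f has_vector_derivative v) (at t)"
proof -
  let ?y = "\<lambda>t. bint (sojourn t) (orbit (L f))"
  let ?\<zeta> = "\<lambda>t. bint (leb 0 t) (\<lambda>s. mean (L f) (max 0 s))"
  have yb: "norm (?y t) \<le> K * norm f + norm f" for t
  proof (cases "t \<ge> 0")
    case True
    have "?y t = mean f t - f" using mean_eq[OF f True] by simp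
    then show ?thesis using norm_triangle_ineq4[of "mean f t" f] mean_bound[of f t] by simp
  next
    case False
    then have "?y t = 0" by (intro bint_sojourn_nonpos[OF orbit_continuous orbit_bound]) simp
    then show ?thesis using K_ge_1 by simp
  qed
  have "\<exists>v. (?y has_vector_derivative v) (at t)"
  proof (rule volterra_differentiable[OF k mean_lipschitz[OF f k] yb, where \<zeta>="?\<zeta>" and R="t + 1"])
    show "?y t = 0" if "t \<le> 0" for t by (rule bint_sojourn_nonpos[OF orbit_continuous orbit_bound that])
    show "\<kappa> *\<^sub>R ?y s + bint (tail_kernel (t + 1)) (\<lambda>r. ?y (s - r)) = ?\<zeta> s" if "s \<le> t + 1" "0 \<le> s" for s
    proof -
      have "mean f s - f = ?y s" using mean_eq[OF f that(2)] by simp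
      then show ?thesis
        using mean_integrated_equation[OF f that(2)] bint_memory_sojourn_convolution[OF orbit_continuous orbit_bound that(1), of "L f"]
        by simp
    qed
    show "\<exists>D. (?\<zeta> has_vector_derivative D) (at s)" if "0 < s" for s
      using bint_leb_at[OF mean_max_continuous mean_bound that] by blast
  qed (use t in auto)
  then obtain v where v: "(?y has_vector_derivative v) (at t)" by blast
  then have "((\<lambda>t. f + ?y t) has_vector_derivative v) (at t)"
    by (auto intro!: derivative_eq_intros)
  then have "(mean f has_vector_derivative v) (at t)"
    by (rule has_vector_derivative_transform_within_open[where S="{0<..}"]) (use t in \<open>auto simp: mean_eq[OF f]\<close>)
  then show ?thesis by blast
qed

end

section \<open>Uniqueness\<close>

context subordinator_setting
begin

text \<open>The kernel of the memory integral as a measure in the variable \<open>s\<close> of the integrand.\<close>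

definition reflected_kernel :: "real \<Rightarrow> real measure" where
  "reflected_kernel t = density lborel (\<lambda>s. ennreal (w (t - s)) * indicator {0<..<t} s)"

lemma sets_reflected_kernel [simp, measurable_cong]: "sets (reflected_kernel t) = sets borel"
  by (simp add: reflected_kernel_def)

lemma emeasure_reflected_kernel:
  assumes "A \<in> sets borel"
  shows "emeasure (reflected_kernel t) A = (\<integral>\<^sup>+s. ennreal (w (t - s)) * indicator ({0<..<t} \<inter> A) s \<partial>lborel)"
  using assms unfolding reflected_kernel_def by (subst emeasure_density) (auto simp: indicator_inter_arith mult.assoc)

lemma emeasure_reflected_kernel_UNIV: "emeasure (reflected_kernel t) UNIV = (\<integral>\<^sup>+s. ennreal (w s) * indicator {0<..<t} s \<partial>lborel)"
proof -
  have "(\<integral>\<^sup>+s. ennreal (w s) * indicator {0<..<t} s \<partial>lborel)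
      = ennreal \<bar>-1\<bar> * (\<integral>\<^sup>+s. ennreal (w (t + (-1) * s)) * indicator {0<..<t} (t + (-1) * s) \<partial>lborel)"
    by (rule nn_integral_real_affine) auto
  also have "\<dots> = (\<integral>\<^sup>+s. ennreal (w (t - s)) * indicator ({0<..<t} \<inter> UNIV) s \<partial>lborel)"
    by (auto intro!: nn_integral_cong simp: indicator_def)
  finally show ?thesis by (simp add: emeasure_reflected_kernel)
qed

lemma finite_reflected_kernel: "finite_measure (reflected_kernel t)"
  by (rule finite_measureI)
     (use nn_integral_w_Ioo_finite[of t] in \<open>simp add: reflected_kernel_def emeasure_reflected_kernel_UNIV[unfolded reflected_kernel_def]\<close>)

text \<open>On \<open>0 < s < 1 / l\<close> the weight \<open>exp (- l s)\<close> is at least \<open>1 / e\<close>, so the mass is at most \<open>e\<close> times a small Laplace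
  transform.\<close>

lemma w_mass_vanishes: "((\<lambda>t. measure (reflected_kernel t) UNIV) \<longlongrightarrow> 0) (at_right 0)"
proof (rule tendstoI)
  fix \<epsilon> :: real assume e: "\<epsilon> > 0"
  obtain l where l: "l > 0" "(\<integral>\<^sup>+s. ennreal (exp (- l * s)) * ennreal (w s) \<partial>lborel) \<le> ennreal (\<epsilon> / 4)"
    using laplace_w_vanishes[of "\<epsilon> / 4"] e by auto
  have "measure (reflected_kernel t) UNIV < \<epsilon>" if t: "0 < t" "t < 1 / l" for t
  proof -
    have "emeasure (reflected_kernel t) UNIV \<le> (\<integral>\<^sup>+s. ennreal (exp 1) * (ennreal (exp (- l * s)) * ennreal (w s)) \<partial>lborel)"
      unfolding emeasure_reflected_kernel_UNIV
    proof (rule nn_integral_mono)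
      fix s
      have "1 \<le> exp 1 * exp (- l * s)" if "s < t"
      proof -
        have "l * s \<le> l * (1 / l)" using that t l(1) by (intro mult_left_mono) auto
        then show ?thesis using l(1) by (simp flip: exp_add)
      qed
      then show "ennreal (w s) * indicator {0<..<t} s \<le> ennreal (exp 1) * (ennreal (exp (- l * s)) * ennreal (w s))"
        using w_nonneg[of s] mult_right_mono[of 1 "exp 1 * exp (- l * s)" "w s"]
        by (cases "s \<in> {0<..<t}") (auto simp: mult.assoc simp flip: ennreal_mult intro!: ennreal_leI)
    qed
    also have "\<dots> = ennreal (exp 1) * (\<integral>\<^sup>+s. ennreal (exp (- l * s)) * ennreal (w s) \<partial>lborel)"
      by (rule nn_integral_cmult) measurable
    also have "\<dots> \<le> ennreal (exp 1) * ennreal (\<epsilon> / 4)" by (intro mult_left_mono l(2)) simp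
    also have "\<dots> = ennreal (exp 1 * (\<epsilon> / 4))" using e by (intro ennreal_mult[symmetric]) auto
    finally have "measure (reflected_kernel t) UNIV \<le> exp 1 * (\<epsilon> / 4)"
      using e by (simp add: finite_measure.emeasure_eq_measure[OF finite_reflected_kernel] ennreal_le_iff)
    also have "\<dots> \<le> 3 * (\<epsilon> / 4)" using e exp_le by (intro mult_right_mono) auto
    also have "\<dots> < \<epsilon>" using e by simp
    finally show ?thesis .
  qed
  then show "\<forall>\<^sub>F t in at_right 0. dist (measure (reflected_kernel t) UNIV) 0 < \<epsilon>"
    unfolding eventually_at_right_field using l(1) by (intro exI[of _ "1 / l"]) auto
qed

lemma strong_integral_memory:
  fixes z :: "real \<Rightarrow> 'b::banach"
  assumes z: "continuous_on UNIV z" "\<And>r. norm (z r) \<le> C"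
  shows "strong_integral (restrict_space lborel {0<..<t}) (\<lambda>s. w (t - s) *\<^sub>R z s) (bint (reflected_kernel t) z)"
proof -
  have "strong_integral (restrict_space lborel {0<..<t}) (\<lambda>s. bint (scale_measure (ennreal (w (t - s))) (return borel s)) z) (bint (reflected_kernel t) z)"
  proof (rule strong_integral_mixture[OF z])
    fix A :: "real set" assume A[measurable]: "A \<in> sets borel"
    have "(\<lambda>s. ennreal (w (t - s)) * indicator A s) \<in> borel_measurable lborel" by measurable
    then show "(\<lambda>s. emeasure (scale_measure (ennreal (w (t - s))) (return borel s)) A) \<in> borel_measurable (restrict_space lborel {0<..<t})"
      by (simp add: measurable_restrict_space1)
    have "(\<integral>\<^sup>+s. emeasure (scale_measure (ennreal (w (t - s))) (return borel s)) A \<partial>restrict_space lborel {0<..<t})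
       = (\<integral>\<^sup>+s. ennreal (w (t - s)) * indicator A s * indicator {0<..<t} s \<partial>lborel)"
      by (subst nn_integral_restrict_space) auto
    also have "\<dots> = emeasure (reflected_kernel t) A"
      by (simp add: emeasure_reflected_kernel indicator_inter_arith ac_simps)
    finally show "(\<integral>\<^sup>+s. emeasure (scale_measure (ennreal (w (t - s))) (return borel s)) A \<partial>restrict_space lborel {0<..<t})
       = emeasure (reflected_kernel t) A" .
  qed (auto simp: finite_scale_measure prob_space.finite_measure prob_space_return finite_reflected_kernel)
  moreover have "bint (scale_measure (ennreal (w (t - s))) (return borel s)) z = w (t - s) *\<^sub>R z s" for s
    by (subst bint_scale_measure[OF z]) (auto simp: bint_return[OF z] prob_space.finite_measure prob_space_return w_nonneg)
  ultimately show ?thesis by simp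
qed

lemma laplace_memory:
  fixes z :: "real \<Rightarrow> 'b::banach"
  assumes z: "continuous_on UNIV z" "\<And>r. norm (z r) \<le> C" and l: "l > 0"
  shows "strong_integral (laplace_measure l) (\<lambda>t. bint (reflected_kernel t) z) (((\<Phi> l - \<kappa> * l) / l) *\<^sub>R bint (laplace_measure l) z)"
proof -
  let ?c = "(\<Phi> l - \<kappa> * l) / l"
  have c0: "?c \<ge> 0" using laplace_exponent_ge[OF l] l by simp
  have reflected_kernel_eq: "emeasure (reflected_kernel t) A = (\<integral>\<^sup>+s. ennreal (w s) * indicator ({0<..} \<inter> A) (t - s) \<partial>lborel)" if A[measurable]: "A \<in> sets borel" for t A
  proof -
    have "emeasure (reflected_kernel t) A = (\<integral>\<^sup>+s. ennreal (w (t - s)) * indicator ({0<..} \<inter> A) s \<partial>lborel)"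
      unfolding emeasure_reflected_kernel[OF A] by (intro nn_integral_cong) (auto simp: indicator_def w_nonpos_arg)
    also have "\<dots> = ennreal \<bar>-1\<bar> * (\<integral>\<^sup>+s. ennreal (w (t - (t + (-1) * s))) * indicator ({0<..} \<inter> A) (t + (-1) * s) \<partial>lborel)"
      by (rule nn_integral_real_affine) auto
    finally show ?thesis by simp
  qed
  have "strong_integral (laplace_measure l) (\<lambda>t. bint (reflected_kernel t) z) (bint (scale_measure (ennreal ?c) (laplace_measure l)) z)"
  proof (rule strong_integral_mixture[OF z])
    fix A :: "real set" assume A[measurable]: "A \<in> sets borel"
    have m[measurable]: "(\<lambda>t. emeasure (reflected_kernel t) A) \<in> borel_measurable borel"
      unfolding reflected_kernel_eq[OF A] by measurable
    then show "(\<lambda>t. emeasure (reflected_kernel t) A) \<in> borel_measurable (laplace_measure l)"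
      by (simp add: measurable_cong_sets[OF sets_laplace_measure refl])
    have "(\<integral>\<^sup>+t. emeasure (reflected_kernel t) A \<partial>laplace_measure l)
       = (\<integral>\<^sup>+t. ennreal (exp (- l * t)) * (\<integral>\<^sup>+s. ennreal (w s) * indicator ({0<..} \<inter> A) (t - s) \<partial>lborel) \<partial>lborel)"
      unfolding nn_integral_laplace_measure[OF m]
    proof (rule nn_integral_cong)
      fix t
      have "emeasure (reflected_kernel t) A = 0" if "t \<le> 0" using that A by (simp add: emeasure_reflected_kernel)
      then show "ennreal (exp (- l * t)) * (indicator {0<..} t * emeasure (reflected_kernel t) A)
        = ennreal (exp (- l * t)) * (\<integral>\<^sup>+s. ennreal (w s) * indicator ({0<..} \<inter> A) (t - s) \<partial>lborel)"
        unfolding reflected_kernel_eq[OF A, symmetric] by (cases "t \<le> 0") (simp_all add: indicator_def)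
    qed
    also have "\<dots> = ennreal ?c * (\<integral>\<^sup>+t. ennreal (exp (- l * t)) * indicator ({0<..} \<inter> A) t \<partial>lborel)"
      by (rule laplace_convolution[OF _ l]) measurable
    finally show "(\<integral>\<^sup>+t. emeasure (reflected_kernel t) A \<partial>laplace_measure l) = emeasure (scale_measure (ennreal ?c) (laplace_measure l)) A"
      using emeasure_laplace_measure[OF A, of l] by simp
  qed (auto simp: finite_reflected_kernel finite_scale_measure finite_laplace_measure l)
  then show ?thesis by (simp add: bint_scale_measure[OF z finite_laplace_measure[OF l]] c0)
qed

end

context bounded_semigroup
begin

text \<open>The integral for the resolvent of \<open>L\<close> at \<open>q\<close>, truncated at \<open>N\<close> so that it runs over a bounded interval; the truncation
  error is the explicit term in \<open>resolvent_generator\<close>.\<close>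

definition resolvent :: "real \<Rightarrow> real \<Rightarrow> 'b \<Rightarrow> 'b" where
  "resolvent q N x = bint (leb 0 N) (\<lambda>r. exp (- q * max 0 r) *\<^sub>R orbit x r)"

lemma resolvent_integrand:
  assumes "q \<ge> 0"
  shows "continuous_on UNIV (\<lambda>r. exp (- q * max 0 r) *\<^sub>R orbit x r)" "norm (exp (- q * max 0 r) *\<^sub>R orbit x r) \<le> K * norm x"
proof -
  show "continuous_on UNIV (\<lambda>r. exp (- q * max 0 r) *\<^sub>R orbit x r)" by (intro continuous_intros orbit_continuous)
  have "exp (- q * max 0 r) \<le> 1" using assms by simp
  then have "exp (- q * max 0 r) * norm (orbit x r) \<le> 1 * norm (orbit x r)" by (rule mult_right_mono) simp
  then show "norm (exp (- q * max 0 r) *\<^sub>R orbit x r) \<le> K * norm x" using orbit_bound[of x r] by simp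
qed

lemma resolvent_bounded_linear:
  assumes q: "q \<ge> 0" and N: "N \<ge> 0"
  shows "bounded_linear (resolvent q N)"
proof (rule bounded_linear_intro[where K="K * N"])
  note int = strong_integral_bint[OF resolvent_integrand[OF q] finite_leb[of 0 N] sets_leb]
  fix x y and c :: real
  have "strong_integral (leb 0 N) (\<lambda>r. exp (- q * max 0 r) *\<^sub>R orbit (x + y) r) (resolvent q N x + resolvent q N y)"
    unfolding resolvent_def using strong_integral_add[OF int[of x] int[of y]]
    by (simp add: orbit_def blinfun.add_right scaleR_add_right)
  then show "resolvent q N (x + y) = resolvent q N x + resolvent q N y"
    unfolding resolvent_def[of q N "x + y"] by (rule bint_eq)
  have "strong_integral (leb 0 N) (\<lambda>r. exp (- q * max 0 r) *\<^sub>R orbit (c *\<^sub>R x) r) (c *\<^sub>R resolvent q N x)"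
    unfolding resolvent_def using strong_integral_bounded_linear[OF bounded_linear_scaleR_right[of c] int[of x]]
    by (simp add: orbit_def blinfun.scaleR_right mult.commute)
  then show "resolvent q N (c *\<^sub>R x) = c *\<^sub>R resolvent q N x"
    unfolding resolvent_def[of q N "c *\<^sub>R x"] by (rule bint_eq)
  have "measure (leb 0 N) UNIV = N" using emeasure_leb_UNIV[of 0 N] N by (simp add: measure_def)
  then show "norm (resolvent q N x) \<le> norm x * (K * N)"
    unfolding resolvent_def using bint_norm_le[OF resolvent_integrand(1)[OF q, of x] resolvent_integrand(2)[OF q, of _ x] finite_leb[of 0 N] sets_leb] by (simp add: ac_simps)
qed

lemma resolvent_generator:
  assumes q: "q \<ge> 0" and N: "N \<ge> 0" and x: "x \<in> D"
  shows "resolvent q N (q *\<^sub>R x - L x) = x - exp (- q * N) *\<^sub>R T N x"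
proof -
  have d: "((\<lambda>r. T r x) has_vector_derivative T s (L x)) (at s)" if "0 < s" for s
  proof -
    have "((\<lambda>r. T r x) has_vector_derivative T s (L x)) (at s within {0<..})"
      by (rule has_vector_derivative_within_subset[OF orbit_derivative[OF x]]) (use that in auto)
    then show ?thesis using at_within_open[of s "{0<..}"] that by simp
  qed
  have "resolvent q N (q *\<^sub>R x - L x) = - exp (- q * N) *\<^sub>R T N x - (- exp (- q * 0) *\<^sub>R T 0 x)"
    unfolding resolvent_def
  proof (rule bint_leb_FTC[OF resolvent_integrand[OF q] N])
    show "continuous_on {0..N} (\<lambda>r. - exp (- q * r) *\<^sub>R T r x)"
    proof (rule continuous_on_scaleR)
      show "continuous_on {0..N} (\<lambda>r. - exp (- q * r))" by (intro continuous_intros)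
      show "continuous_on {0..N} (\<lambda>r. T r x)"
        by (rule continuous_on_eq[OF continuous_on_subset[OF orbit_continuous[of x]]]) (auto simp: orbit_def)
    qed
    fix s assume s: "0 < s" "s < N"
    have e: "((\<lambda>r. - exp (- q * r)) has_real_derivative q * exp (- q * s)) (at s)"
      by (auto intro!: derivative_eq_intros)
    have "((\<lambda>r. - exp (- q * r) *\<^sub>R T r x) has_vector_derivative (- exp (- q * s)) *\<^sub>R T s (L x) + (q * exp (- q * s)) *\<^sub>R T s x) (at s)"
      by (rule has_vector_derivative_scaleR[OF e d[OF s(1)]])
    also have "(- exp (- q * s)) *\<^sub>R T s (L x) + (q * exp (- q * s)) *\<^sub>R T s x = exp (- q * max 0 s) *\<^sub>R orbit (q *\<^sub>R x - L x) s"
      using s by (simp add: orbit_def blinfun.diff_right blinfun.scaleR_right algebra_simps)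
    finally show "((\<lambda>r. - exp (- q * r) *\<^sub>R T r x) has_vector_derivative exp (- q * max 0 s) *\<^sub>R orbit (q *\<^sub>R x - L x) s) (at s)" .
  qed
  then show ?thesis by (simp add: T_0)
qed

end

context subordinated_semigroup
begin

text \<open>The two sides have the same derivative at every \<open>t > 0\<close> and tend to \<open>0\<close> as \<open>t\<close> tends to \<open>0\<close>; for the memory term
  because the mass of the kernel does.\<close>

lemma solution_integrated_equation:
  assumes sol: "time_fractional_solution \<kappa> w D L f v" and t: "t > 0"
  shows "\<exists>C. \<forall>s\<ge>0. norm (v s - f) \<le> C" "\<exists>C. \<forall>s\<ge>0. norm (L (v s)) \<le> C"
    "\<kappa> *\<^sub>R (v t - f) + bint (reflected_kernel t) (\<lambda>s. v (max 0 s) - f) = bint (leb 0 t) (\<lambda>s. L (v (max 0 s)))"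
proof -
  from sol have v0: "v 0 = f" and bv: "bdd_above ((\<lambda>t. norm (v t)) ` {0<..})" and bL: "bdd_above ((\<lambda>t. norm (L (v t))) ` {0..})"
    and vc: "continuous_on {0..} v" and Lc: "continuous_on {0..} (\<lambda>t. L (v t))"
    and lim: "\<And>t. t > 0 \<Longrightarrow> ((\<lambda>\<delta>. (\<kappa> *\<^sub>R (v (t + \<delta>) - v t) + memory_integral w f v (t + \<delta>) - memory_integral w f v t) /\<^sub>R \<delta>) \<longlongrightarrow> L (v t)) (at 0)"
    unfolding time_fractional_solution_def by auto
  obtain B1 where B1: "\<And>s. s > 0 \<Longrightarrow> norm (v s) \<le> B1" using bv unfolding bdd_above_def by auto
  obtain B2 where B2: "\<And>s. s \<ge> 0 \<Longrightarrow> norm (L (v s)) \<le> B2" using bL unfolding bdd_above_def by auto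
  let ?C = "max 0 B1 + norm f"
  have vb: "norm (v s - f) \<le> ?C" if "s \<ge> 0" for s
  proof (cases "s = 0")
    case False
    then show ?thesis using B1[of s] that norm_triangle_ineq4[of "v s" f] by simp
  qed (simp add: v0)
  show "\<exists>C. \<forall>s\<ge>0. norm (v s - f) \<le> C" using vb by blast
  show "\<exists>C. \<forall>s\<ge>0. norm (L (v s)) \<le> C" using B2 by blast
  let ?z = "\<lambda>s. v (max 0 s) - f"
  have zc: "continuous_on UNIV ?z" by (intro continuous_intros continuous_on_compose2[OF vc]) auto
  have zb: "norm (?z s) \<le> ?C" for s by (rule vb) simp
  let ?g = "\<lambda>s. L (v (max 0 s))"
  have gc: "continuous_on UNIV ?g" by (intro continuous_on_compose2[OF Lc] continuous_intros) auto
  have gb: "norm (?g s) \<le> B2" for s by (rule B2) simp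
  have mem: "memory_integral w f v t = bint (reflected_kernel t) ?z" for t
  proof -
    have "strong_integral (restrict_space lborel {0<..<t}) (\<lambda>s. w (t - s) *\<^sub>R (v s - f)) (bint (reflected_kernel t) ?z)"
      by (rule strong_integral_cong[THEN iffD1, OF _ refl strong_integral_memory[OF zc zb]]) (auto simp: space_restrict_space)
    then show ?thesis
      unfolding memory_integral_def by (rule banach_integral_eq(2)[OF memory_integrand_measurable[OF w_measurable vc]])
  qed
  \<comment> \<open>extended by its limit at \<open>0\<close>, so that the fundamental theorem applies on \<open>{0..t}\<close>\<close>
  define Q where "Q t = (if t \<le> 0 then 0 else \<kappa> *\<^sub>R (v t - f) + bint (reflected_kernel t) ?z)" for t
  have Qd: "(Q has_vector_derivative ?g t) (at t)" if t: "t > 0" for t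
    unfolding has_vector_derivative_iff_quotient
  proof (rule Lim_transform_eventually)
    show "((\<lambda>\<delta>. (\<kappa> *\<^sub>R (v (t + \<delta>) - v t) + memory_integral w f v (t + \<delta>) - memory_integral w f v t) /\<^sub>R \<delta>) \<longlongrightarrow> ?g t) (at 0)"
      using lim[OF t] t by (simp add: max_def)
    have "\<forall>\<^sub>F h in at 0. dist h 0 < t" using t by (auto simp: eventually_at)
    then show "\<forall>\<^sub>F h in at 0. (\<kappa> *\<^sub>R (v (t + h) - v t) + memory_integral w f v (t + h) - memory_integral w f v t) /\<^sub>R h
        = (Q (t + h) - Q t) /\<^sub>R h"
    proof eventually_elim
      case (elim h)
      then have "0 < t + h" by (auto simp: dist_real_def)
      then show ?case using t by (simp add: Q_def mem algebra_simps)
    qed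
  qed
  have Q0: "(Q \<longlongrightarrow> 0) (at_right 0)"
  proof (rule Lim_null_comparison)
    show "\<forall>\<^sub>F t in at_right 0. norm (Q t) \<le> \<kappa> * norm (v t - f) + ?C * measure (reflected_kernel t) UNIV"
      using eventually_at_right_less[of "0::real"]
    proof eventually_elim
      case (elim t)
      have "norm (Q t) \<le> norm (\<kappa> *\<^sub>R (v t - f)) + norm (bint (reflected_kernel t) ?z)"
        using elim norm_triangle_ineq[of "\<kappa> *\<^sub>R (v t - f)" "bint (reflected_kernel t) ?z"] by (simp add: Q_def)
      then show ?case using bint_norm_le[OF zc zb finite_reflected_kernel sets_reflected_kernel, of t] kappa_nonneg by simp
    qed
    have "(v \<longlongrightarrow> v 0) (at 0 within {0..})" using vc by (simp add: continuous_on)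
    then have "(v \<longlongrightarrow> f) (at_right 0)" unfolding v0 by (rule tendsto_within_subset) auto
    then have "((\<lambda>t. norm (v t - f)) \<longlongrightarrow> 0) (at_right 0)" by (simp add: tendsto_norm_zero_iff LIM_zero_iff)
    from tendsto_add[OF tendsto_mult_left[OF this, of \<kappa>] tendsto_mult_left[OF w_mass_vanishes, of ?C]]
    show "((\<lambda>t. \<kappa> * norm (v t - f) + ?C * measure (reflected_kernel t) UNIV) \<longlongrightarrow> 0) (at_right 0)" by simp
  qed
  have "bint (leb 0 t) ?g = Q t - Q 0"
  proof (rule bint_leb_FTC[OF gc gb])
    show "continuous_on {0..t} Q"
      unfolding continuous_on_eq_continuous_within
    proof
      fix s assume s: "s \<in> {0..t}"
      show "continuous (at s within {0..t}) Q"
      proof (cases "s = 0")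
        case True
        have "(Q \<longlongrightarrow> 0) (at 0 within {0..t})"
          using Q0 t by (simp add: at_within_Icc_at_right)
        then show ?thesis using True by (simp add: continuous_within Q_def)
      next
        case False
        then have "s > 0" using s by simp
        from has_vector_derivative_continuous[OF Qd[OF this]] show ?thesis by (rule continuous_at_imp_continuous_at_within)
      qed
    qed
  qed (use t Qd in auto)
  then show "\<kappa> *\<^sub>R (v t - f) + bint (reflected_kernel t) ?z = bint (leb 0 t) ?g" using t by (simp add: Q_def)
qed

text \<open>Both solutions satisfy the integrated equation, so its Laplace transform gives \<open>\<Phi> l \<cdot> V = (transform of L d)\<close> for the
  transform \<open>V\<close> of their difference \<open>d\<close>. The truncated resolvent is applied under the integral sign, where
  \<open>d\<close> takes values in the domain of \<open>L\<close>.\<close>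

lemma solution_unique:
  assumes v: "time_fractional_solution \<kappa> w D L f v" and u: "time_fractional_solution \<kappa> w D L f u" and t: "t \<ge> 0"
  shows "v t = u t"
proof -
  have vD: "\<And>s. s \<ge> 0 \<Longrightarrow> v s \<in> D" "v 0 = f" and vc: "continuous_on {0..} v" "continuous_on {0..} (\<lambda>t. L (v t))"
    using v unfolding time_fractional_solution_def by auto
  have uD: "\<And>s. s \<ge> 0 \<Longrightarrow> u s \<in> D" "u 0 = f" and uc: "continuous_on {0..} u" "continuous_on {0..} (\<lambda>t. L (u t))"
    using u unfolding time_fractional_solution_def by auto
  obtain A1 A2 where A: "\<And>s. s \<ge> 0 \<Longrightarrow> norm (v s - f) \<le> A1" "\<And>s. s \<ge> 0 \<Longrightarrow> norm (L (v s)) \<le> A2"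
    using solution_integrated_equation(1,2)[OF v zero_less_one] by blast
  obtain B1 B2 where B: "\<And>s. s \<ge> 0 \<Longrightarrow> norm (u s - f) \<le> B1" "\<And>s. s \<ge> 0 \<Longrightarrow> norm (L (u s)) \<le> B2"
    using solution_integrated_equation(1,2)[OF u zero_less_one] by blast
  define d where "d s = v (max 0 s) - u (max 0 s)" for s
  define g where "g s = L (v (max 0 s)) - L (u (max 0 s))" for s
  have ext: "continuous_on UNIV (\<lambda>s. h (max 0 s))" if "continuous_on {0..} h" for h :: "real \<Rightarrow> 'b"
    by (rule continuous_on_compose2[OF that]) (auto intro!: continuous_intros)
  have c: "continuous_on UNIV (\<lambda>s. v (max 0 s) - f)" "continuous_on UNIV (\<lambda>s. u (max 0 s) - f)"
      "continuous_on UNIV (\<lambda>s. L (v (max 0 s)))" "continuous_on UNIV (\<lambda>s. L (u (max 0 s)))"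
    using ext[OF vc(1)] ext[OF uc(1)] ext[OF vc(2)] ext[OF uc(2)] by (auto intro!: continuous_on_diff)
  have b: "norm (v (max 0 s) - f) \<le> A1" "norm (u (max 0 s) - f) \<le> B1" "norm (L (v (max 0 s))) \<le> A2" "norm (L (u (max 0 s))) \<le> B2" for s
    using A B by simp_all
  have d_eq: "d = (\<lambda>s. (v (max 0 s) - f) - (u (max 0 s) - f))" by (simp add: d_def fun_eq_iff)
  have dc: "continuous_on UNIV d" unfolding d_eq by (rule continuous_on_diff[OF c(1,2)])
  have db: "norm (d s) \<le> A1 + B1" for s
    unfolding d_eq by (rule order_trans[OF norm_triangle_ineq4 add_mono[OF b(1,2)]])
  have gc: "continuous_on UNIV g" unfolding g_def by (rule continuous_on_diff[OF c(3,4)])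
  have gb: "norm (g s) \<le> A2 + B2" for s
    unfolding g_def by (rule order_trans[OF norm_triangle_ineq4 add_mono[OF b(3,4)]])
  have d0: "d s = 0" if "s \<le> 0" for s using that vD(2) uD(2) by (simp add: d_def max_def)
  have eq: "\<kappa> *\<^sub>R d s + bint (reflected_kernel s) d = bint (leb 0 s) g" for s
  proof (cases "s > 0")
    case True
    have e1: "bint (reflected_kernel s) d = bint (reflected_kernel s) (\<lambda>s. v (max 0 s) - f) - bint (reflected_kernel s) (\<lambda>s. u (max 0 s) - f)"
      unfolding d_eq by (rule bint_diff[OF c(1) b(1) c(2) b(2) finite_reflected_kernel sets_reflected_kernel])
    have e2: "bint (leb 0 s) g = bint (leb 0 s) (\<lambda>s. L (v (max 0 s))) - bint (leb 0 s) (\<lambda>s. L (u (max 0 s)))"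
      unfolding g_def by (rule bint_diff[OF c(3) b(3) c(4) b(4) finite_leb sets_leb])
    show ?thesis
      unfolding e1 e2 solution_integrated_equation(3)[OF v True, symmetric] solution_integrated_equation(3)[OF u True, symmetric]
      using True by (simp add: d_def algebra_simps)
  next
    case False
    have "bint (reflected_kernel s) d = 0" using False by (intro bint_null[OF dc db finite_reflected_kernel sets_reflected_kernel]) (simp add: emeasure_reflected_kernel)
    moreover have "bint (leb 0 s) g = 0" using False by (intro bint_null[OF gc gb finite_leb sets_leb]) (simp add: emeasure_leb)
    ultimately show ?thesis using False by (simp add: d0)
  qed
  have "d t = 0"
  proof (rule bint_laplace_unique[OF dc db d0])
    fix l :: real assume l: "l > 0"
    note fin = finite_laplace_measure[OF l]
    let ?V = "bint (laplace_measure l) d" and ?q = "\<Phi> l"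
    have q: "?q > 0" by (rule laplace_exponent_pos[OF l])
    have "strong_integral (laplace_measure l) (\<lambda>s. \<kappa> *\<^sub>R d s + bint (reflected_kernel s) d) (\<kappa> *\<^sub>R ?V + ((?q - \<kappa> * l) / l) *\<^sub>R ?V)"
      by (rule strong_integral_add[OF strong_integral_bounded_linear[OF bounded_linear_scaleR_right strong_integral_bint[OF dc db fin sets_laplace_measure]]
            laplace_memory[OF dc db l]])
    then have "strong_integral (laplace_measure l) (\<lambda>s. bint (leb 0 s) g) (\<kappa> *\<^sub>R ?V + ((?q - \<kappa> * l) / l) *\<^sub>R ?V)"
      by (simp add: eq)
    from strong_integral_unique[OF this laplace_primitive[OF gc gb l]]
    have "(\<kappa> + (?q - \<kappa> * l) / l) *\<^sub>R ?V = (1 / l) *\<^sub>R bint (laplace_measure l) g" by (simp add: scaleR_add_left)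
    moreover have "\<kappa> + (?q - \<kappa> * l) / l = (1 / l) * ?q" using l by (simp add: field_simps)
    ultimately have "(1 / l) *\<^sub>R (?q *\<^sub>R ?V) = (1 / l) *\<^sub>R bint (laplace_measure l) g" by simp
    then have Vg: "?q *\<^sub>R ?V = bint (laplace_measure l) g" using l by (simp only: scaleR_cancel_left) simp
    have fix_N: "?V = exp (- ?q * N) *\<^sub>R T N ?V" if N: "N \<ge> 0" for N
    proof -
      let ?R = "resolvent ?q N"
      have R: "bounded_linear ?R" using q N by (intro resolvent_bounded_linear) auto
      have A1: "bounded_linear (\<lambda>x. exp (- ?q * N) *\<^sub>R T N x)"
        by (intro bounded_linear_compose[OF bounded_linear_scaleR_right] blinfun.bounded_linear_right)
      note sd = strong_integral_bint[OF dc db fin sets_laplace_measure]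
      note sg = strong_integral_bint[OF gc gb fin sets_laplace_measure]
      have "strong_integral (laplace_measure l) (\<lambda>s. ?R (?q *\<^sub>R d s - g s)) (?R (?q *\<^sub>R ?V - bint (laplace_measure l) g))"
        by (rule strong_integral_bounded_linear[OF R strong_integral_diff[OF strong_integral_bounded_linear[OF bounded_linear_scaleR_right sd] sg]])
      moreover have "?R (?q *\<^sub>R d s - g s) = d s - exp (- ?q * N) *\<^sub>R T N (d s)" for s
      proof -
        have D: "v (max 0 s) \<in> D" "u (max 0 s) \<in> D" using vD(1) uD(1) by auto
        have "g s = L (d s)" "d s \<in> D" using generator_diff[OF D] by (simp_all add: g_def d_def)
        then show ?thesis using resolvent_generator[of ?q N "d s"] q N by simp
      qed
      ultimately have "strong_integral (laplace_measure l) (\<lambda>s. d s - exp (- ?q * N) *\<^sub>R T N (d s)) (?R 0)"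
        by (simp add: Vg)
      moreover have "strong_integral (laplace_measure l) (\<lambda>s. d s - exp (- ?q * N) *\<^sub>R T N (d s)) (?V - exp (- ?q * N) *\<^sub>R T N ?V)"
        by (rule strong_integral_diff[OF sd strong_integral_bounded_linear[OF A1 sd]])
      ultimately have "?V - exp (- ?q * N) *\<^sub>R T N ?V = ?R 0" by (rule strong_integral_unique[rotated])
      also have "?R 0 = 0" using R by (rule linear_simps(3))
      finally show ?thesis by simp
    qed
    have "norm ?V \<le> 0"
    proof (rule LIMSEQ_le_const)
      have "(\<lambda>n::nat. exp (- ?q * real n)) \<longlonglongrightarrow> 0" using q by real_asymp
      then show "(\<lambda>n::nat. exp (- ?q * real n) * (K * norm ?V)) \<longlonglongrightarrow> 0" by (rule tendsto_mult_left_zero)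
      show "\<exists>N. \<forall>n\<ge>N. norm ?V \<le> exp (- ?q * real n) * (K * norm ?V)"
      proof (intro exI allI impI)
        fix n :: nat
        have "norm ?V = exp (- ?q * real n) * norm (T (real n) ?V)"
          by (subst fix_N[of "real n"]) simp_all
        also have "\<dots> \<le> exp (- ?q * real n) * (K * norm ?V)" by (intro mult_left_mono T_bound) auto
        finally show "norm ?V \<le> exp (- ?q * real n) * (K * norm ?V)" .
      qed
    qed
    then show "?V = 0" by simp
  qed
  then show ?thesis using t by (simp add: d_def)
qed

end

theorem theorem2p3:
  fixes \<kappa> :: real
    and \<mu> :: "real measure"
    and M :: "'w measure"
    and S :: "real \<Rightarrow> 'w \<Rightarrow> real"
    and T :: "real \<Rightarrow> 'b::banach \<Rightarrow>\<^sub>L 'b"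
    and D :: "'b set"
    and L :: "'b \<Rightarrow> 'b"
    and f :: 'b
  assumes "\<kappa> \<ge> 0"
    and "sets \<mu> = sets (restrict_space borel {0<..})"
    and "emeasure \<mu> {0<..} = \<infinity>"
    and "(\<integral>\<^sup>+x. ennreal (min 1 x) \<partial>\<mu>) < \<infinity>"
    and "subordinator M \<kappa> \<mu> S"
    and "strongly_continuous_semigroup T"
    and "uniformly_bounded T"
    and "infinitesimal_generator T D L"
    and "f \<in> D"
  shows "(\<forall>t\<ge>0. banach_integrable (inverse_law M S t) (\<lambda>s. T s f))
    \<and> time_fractional_solution \<kappa> (levy_tail \<mu>) D L f (subordinate_expectation M S T f)
    \<and> (\<kappa> > 0 \<longrightarrow>
         (\<exists>C. C-lipschitz_on {0..} (subordinate_expectation M S T f)) \<and>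
         (AE t in lebesgue. t \<ge> 0 \<longrightarrow>
            (\<exists>v. (subordinate_expectation M S T f has_vector_derivative v) (at t within {0..}))))
    \<and> (\<forall>u. time_fractional_solution \<kappa> (levy_tail \<mu>) D L f u \<longrightarrow>
         (\<forall>t\<ge>0. u t = subordinate_expectation M S T f t))"
proof -
  interpret subordinated_semigroup \<kappa> \<mu> M S T D L
    by unfold_locales (fact assms)+
  let ?u = "subordinate_expectation M S T f"
  note f = \<open>f \<in> D\<close>
  have u: "?u s = mean f s" if "s \<ge> 0" for s by (rule mean_expectation(2)[OF that])
  have sol: "time_fractional_solution \<kappa> (levy_tail \<mu>) D L f ?u" by (rule mean_solution[OF f u])
  have "\<exists>C. C-lipschitz_on {0..} ?u" if k: "\<kappa> > 0"
  proof (intro exI lipschitz_onI)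
    show "0 \<le> K * norm (L f) / \<kappa>" using k K_ge_1 by simp
    fix s t :: real assume "s \<in> {0..}" "t \<in> {0..}"
    then show "dist (?u s) (?u t) \<le> K * norm (L f) / \<kappa> * dist s t"
      using lipschitz_onD[OF mean_lipschitz[OF f k], of s t] by (simp add: u mean_eq[OF f])
  qed
  moreover have "AE t in lebesgue. t \<ge> 0 \<longrightarrow> (\<exists>v. (?u has_vector_derivative v) (at t within {0..}))" if k: "\<kappa> > 0"
  proof -
    have "AE t in lebesgue. t \<noteq> (0::real)"
      by (rule AE_completion[OF AE_lborel_singleton])
    then show ?thesis
    proof eventually_elim
      case (elim t)
      show ?case
      proof
        assume "t \<ge> 0"
        then have t: "t > 0" using elim by simp
        obtain v where "(mean f has_vector_derivative v) (at t)" using mean_differentiable[OF f k t] by blast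
        then have "(?u has_vector_derivative v) (at t)"
          by (rule has_vector_derivative_transform_within_open[where S="{0<..}"]) (use t in \<open>auto simp: u\<close>)
        then show "\<exists>v. (?u has_vector_derivative v) (at t within {0..})"
          using has_vector_derivative_at_within by blast
      qed
    qed
  qed
  ultimately show ?thesis
    using mean_expectation(1) sol solution_unique[OF _ sol] by simp
qed

end
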